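(* Let $f$ be analytic in an open neighbourhood of the closed unit disk, having exactly $s$ zeroes in $D_1$ (counted with multiplicity), and $(s,p)$-valent in $D_1$. Let $Z$ be a subset of $D_1$ with $\rho=\rho(Z)=\inf\{\eta: Z\subset D_\eta\}<1$. Then for every $0<R<1$, $$\sup_{|z|\le R}|f(z)|\le\sigma_p(R,\rho)\,K_s(Z)\,\sup_Z|f|,\qquad \sigma_p(R,\rho)=\Big(\frac{1+R}{1-R}\cdot\frac{1+\rho}{1-\rho}\Big)^{2p}.$$
   Context: $D_r=\{z\in\mathbb C:|z|<r\}$. A function $f$ regular in a domain $\Omega$ is $(s,p)$-valent in $\Omega$ if for every polynomial $P$ of degree at most $s$ the equation $f(z)=P(z)$ has at most $p$ solutions in $\Omega$, counted with multiplicity. For $Z\subset D_1$, $d\in\mathbb N$, $\alpha>0$: $c_{d,\alpha}(Z)=\inf\{(\sum_{j=1}^q r_j^\alpha)^{1/\alpha}: Z$ is covered by $q\le d$ disks of radii $r_1,\dots,r_q>0\}$, and $K_d(Z)=\inf_{\alpha>0}\big(6e^{1/\alpha}/c_{d,\alpha}(Z)\big)^d$ (a term with $c_{d,\alpha}(Z)=0$ being $+\infty$); for $d=0$, $K_0(Z)=1$. *)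

theory Defs
  imports "HOL-Analysis.Analysis" "HOL-Computational_Algebra.Polynomial" "HOL-Library.Extended_Nat"
begin

definition zero_mult :: "(complex \<Rightarrow> complex) \<Rightarrow> complex \<Rightarrow> enat" where
  "zero_mult g z = (if \<exists>n. (deriv ^^ n) g z \<noteq> 0
                    then enat (LEAST n. (deriv ^^ n) g z \<noteq> 0) else \<infinity>)"

definition num_zeros :: "(complex \<Rightarrow> complex) \<Rightarrow> complex set \<Rightarrow> enat" where
  "num_zeros g A = (SUP S \<in> {S. finite S \<and> S \<subseteq> {z \<in> A. g z = 0}}. \<Sum>z\<in>S. zero_mult g z)"

definition sp_valent :: "nat \<Rightarrow> nat \<Rightarrow> (complex \<Rightarrow> complex) \<Rightarrow> complex set \<Rightarrow> bool" where
  "sp_valent s p f \<Omega> \<longleftrightarrow>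
     (\<forall>P :: complex poly. degree P \<le> s \<longrightarrow> num_zeros (\<lambda>z. f z - poly P z) \<Omega> \<le> enat p)"

definition cover_const :: "nat \<Rightarrow> real \<Rightarrow> complex set \<Rightarrow> real" where
  "cover_const d \<alpha> Z = Inf {(\<Sum>j<q. r j powr \<alpha>) powr (1/\<alpha>) | q c r.
       q \<le> d \<and> (\<forall>j<q. r j > 0) \<and> Z \<subseteq> (\<Union>j<q. ball (c j) (r j))}"

definition K_const :: "nat \<Rightarrow> complex set \<Rightarrow> ereal" where
  "K_const d Z = (if d = 0 then 1 else
     (INF \<alpha> \<in> {0<..}. (if cover_const d \<alpha> Z = 0 then \<infinity>
                        else ereal ((6 * exp (1/\<alpha>) / cover_const d \<alpha> Z) ^ d))))"

definition rho :: "complex set \<Rightarrow> real" where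
  "rho Z = Inf {\<eta>. Z \<subseteq> ball 0 \<eta>}"

definition sigma :: "nat \<Rightarrow> real \<Rightarrow> real \<Rightarrow> real" where
  "sigma p R \<rho> = ((1+R)/(1-R) * ((1+\<rho>)/(1-\<rho>))) ^ (2*p)"

end

theory Submission
  imports Defs "HOL-Probability.Probability" "HOL-Complex_Analysis.Complex_Analysis" "HOL-Library.Multiset"
begin

text \<open>
  Dividing \<open>f\<close> by the monic polynomial \<open>P\<close> with the same zeros gives a zero-free function \<open>g\<close> that takes
  every value at most \<open>p\<close> times, since \<open>g z = c\<close> implies \<open>f z = c * P z\<close>. Cartan's lemma bounds \<open>P\<close> from
  below at some point of \<open>Z\<close>, and \<open>\<bar>P\<bar> \<le> 2 ^ s\<close> on the disc.  For \<open>g\<close> one needs the sharp distortion theorem,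
  which by Moebius invariance and integration along radii reduces to \<open>\<bar>\<phi>' 0\<bar> \<le> 4 * p\<close> for \<open>\<phi> = ln g\<close>.

  For that estimate let \<open>X r\<close> be the function \<open>t \<mapsto> Re (\<phi> (exp (r + \<i> * t)))\<close> and let \<open>A r\<close> be the maximum of the mean of
  \<open>X r * F\<close> over all rearrangements \<open>F\<close> of the cosine; it is attained at the monotone rearrangement
  \<open>F r\<close>. Fixing \<open>F\<close> and varying the radius gives a function that touches \<open>A\<close> from
  below, and as \<open>X\<close> is harmonic, the Polya--Szego inequality in the angle says that its second derivative
  at the point of contact is at least \<open>A\<close>. By the maximum principle \<open>A r * exp (- r)\<close> is
  nondecreasing, so it is at least its limit \<open>\<bar>\<phi>' 0\<bar> / 2\<close> at \<open>-\<infinity>\<close>, and \<open>A r\<close> is at most the mean of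
  \<open>(\<partial>X/\<partial>r) * F r\<close>. The latter is an area integral over the Riemann surface of \<open>\<phi>\<close>, which is
  at most \<open>2 * p\<close> because \<open>exp \<phi>\<close> is \<open>p\<close>-valent.
\<close>

section \<open>Functions on the circle and their ranks\<close>

text \<open>The bound \<open>\<bar>\<phi>' 0\<bar> \<le> 4 * p\<close> has to be sharp: integrated
  against the hyperbolic metric, 4 * p becomes the exponent 2 * p of \<open>sigma\<close>. Equality
  holds for \<open>g z = ((1 + z) / (1 - z)) ^ (2 * p)\<close>. For p = 1 the bound is Koebe's
  quarter theorem; for larger p no univalent function is at hand, and p is felt only through an area
  counted with multiplicity. The pairing with rearranged cosines is chosen because it loses nothing
  on the extremal function: there \<open>X r\<close> is even in t and decreasing on {0..pi},
  \<open>F r\<close> is the cosine itself, and \<open>A r = 2 * p * exp r\<close>. Two obstacles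
  shape the argument. A maximum over a family need not be differentiable, so the inequality "second
  derivative of \<open>A\<close> at least \<open>A\<close>" is used only through smooth functions
  touching \<open>A\<close> from below. And \<open>X r\<close> may have critical points, so sums
  over the boundary points of level sets are never formed; integrals over thin bands of levels
  replace them.\<close>

definition circ :: "real measure" where
  "circ = uniform_measure lborel {0..2*pi}"

lemma sets_circ [simp, measurable_cong]: "sets circ = sets borel"
  by (simp add: circ_def)

lemma space_circ [simp]: "space circ = UNIV"
  by (simp add: circ_def)

interpretation circ: prob_space circ
  unfolding circ_def by (rule prob_space_uniform_measure) auto

lemma AE_circ: "(\<And>\<theta>. \<theta> \<in> {0..2*pi} \<Longrightarrow> P \<theta>) \<Longrightarrow> AE \<theta> in circ. P \<theta>"
  unfolding circ_def by (rule AE_uniform_measureI) auto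

lemma integral_uniform_interval_measurable:
  fixes h :: "real \<Rightarrow> real"
  assumes [measurable]: "h \<in> borel_measurable borel" and "a < b"
  shows "(\<integral>\<theta>. h \<theta> \<partial>uniform_measure lborel {a..b}) = (LINT \<theta>:{a..b}|lborel. h \<theta>) / (b - a)"
proof -
  have "uniform_measure lborel {a..b} = density lborel (\<lambda>x. ennreal (indicator {a..b} x / (b-a)))"
    unfolding uniform_measure_def using assms(2)
    by (intro density_cong) (auto simp: indicator_def divide_ennreal[symmetric] ennreal_1[symmetric] simp del: ennreal_1)
  then have "(\<integral>\<theta>. h \<theta> \<partial>uniform_measure lborel {a..b}) = (\<integral>\<theta>. (indicator {a..b} \<theta> / (b-a)) *\<^sub>R h \<theta> \<partial>lborel)"
    using assms(2) by (simp add: integral_density)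
  also have "\<dots> = (\<integral>\<theta>. (indicator {a..b} \<theta> *\<^sub>R h \<theta>) / (b-a) \<partial>lborel)"
    by (intro Bochner_Integration.integral_cong) auto
  also have "\<dots> = (LINT \<theta>:{a..b}|lborel. h \<theta>) / (b-a)"
    unfolding set_lebesgue_integral_def by simp
  finally show ?thesis .
qed

lemma integral_uniform_interval:
  fixes h :: "real \<Rightarrow> real"
  assumes "continuous_on UNIV h" "a < b"
  shows "(\<integral>\<theta>. h \<theta> \<partial>uniform_measure lborel {a..b}) = integral {a..b} h / (b - a)"
proof -
  have "(LINT \<theta>:{a..b}|lborel. h \<theta>) = integral {a..b} h"
    by (intro set_borel_integral_eq_integral borel_integrable_atLeastAtMost')
       (use assms continuous_on_subset in blast)
  then show ?thesis
    using integral_uniform_interval_measurable[OF borel_measurable_continuous_onI[OF assms(1)] assms(2)] by simp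
qed

lemma integral_circ:
  fixes h :: "real \<Rightarrow> real"
  assumes "continuous_on UNIV h"
  shows "(\<integral>\<theta>. h \<theta> \<partial>circ) = integral {0..2*pi} h / (2*pi)"
  using integral_uniform_interval[OF assms, of 0 "2*pi"] by (simp add: circ_def)

lemma integrable_circ_bounded:
  fixes h :: "real \<Rightarrow> real"
  assumes [measurable]: "h \<in> borel_measurable borel" and "\<And>\<theta>. \<bar>h \<theta>\<bar> \<le> B"
  shows "integrable circ h"
  by (rule circ.integrable_const_bound[where B=B]) (use assms in auto)

lemma integrable_circ_continuous:
  fixes h :: "real \<Rightarrow> real"
  assumes h: "continuous_on UNIV h"
  shows "integrable circ h"
proof -
  have "compact (h ` {0..2*pi})"
    using h continuous_on_subset by (intro compact_continuous_image) blast+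
  then have "bounded (h ` {0..2*pi})" by (rule compact_imp_bounded)
  then obtain B where "\<And>t. t \<in> {0..2*pi} \<Longrightarrow> \<bar>h t\<bar> \<le> B"
    by (auto simp: bounded_iff) (metis atLeastAtMost_iff)
  moreover have [measurable]: "h \<in> borel_measurable borel"
    by (rule borel_measurable_continuous_onI[OF h])
  ultimately show ?thesis
    by (intro circ.integrable_const_bound[where B=B]) (auto intro!: AE_circ)
qed

lemma abs_integral_circ_le:
  fixes h :: "real \<Rightarrow> real"
  assumes "continuous_on UNIV h" "\<And>t. t \<in> {0..2*pi} \<Longrightarrow> \<bar>h t\<bar> \<le> B"
  shows "\<bar>\<integral>t. h t \<partial>circ\<bar> \<le> B"
proof -
  have "\<bar>\<integral>t. h t \<partial>circ\<bar> \<le> (\<integral>t. \<bar>h t\<bar> \<partial>circ)" by (rule integral_abs_bound)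
  also have "\<dots> \<le> (\<integral>t. B \<partial>circ)"
    by (intro integral_mono_AE AE_circ integrable_abs integrable_circ_continuous assms) auto
  finally show ?thesis by (simp add: circ.prob_space[simplified])
qed

text \<open>Encodes a rearrangement of the cosine by its angle:
  \<open>cos (\<alpha> \<theta>)\<close> has the distribution of the cosine on the circle when
  \<open>\<alpha>\<close> is uniformly distributed on {0..pi}.\<close>

definition equidist :: "(real \<Rightarrow> real) \<Rightarrow> bool" where
  "equidist \<alpha> \<longleftrightarrow> \<alpha> \<in> borel_measurable borel \<and> (\<forall>t\<in>{0..pi}. measure circ {\<theta>. \<alpha> \<theta> \<le> t} = t / pi)"

text \<open>A distribution function is monotone with values in {0..1}, so its values on {0..pi},
  which run from 0 to 1, determine it everywhere.\<close>

lemma equidist_distr: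
  assumes "equidist \<alpha>"
  shows "distr circ borel \<alpha> = uniform_measure lborel {0..pi}"
proof (rule cdf_unique)
  have [measurable]: "\<alpha> \<in> borel_measurable borel" using assms by (simp add: equidist_def)
  show r1: "real_distribution (distr circ borel \<alpha>)"
    by (simp add: real_distribution_def real_distribution_axioms_def circ.prob_space_distr)
  show "real_distribution (uniform_measure lborel {0..pi})"
    unfolding real_distribution_def real_distribution_axioms_def
    by (auto intro!: prob_space_uniform_measure)
  show "cdf (distr circ borel \<alpha>) = cdf (uniform_measure lborel {0..pi})"
  proof
    fix t
    have c1: "cdf (distr circ borel \<alpha>) t = measure circ {\<theta>. \<alpha> \<theta> \<le> t}" for t
      by (simp add: cdf_def measure_distr vimage_def)
    have c2: "cdf (uniform_measure lborel {0..pi}) t = measure lborel ({0..pi} \<inter> {..t}) / pi"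
      by (simp add: cdf_def)
    consider "t < 0" | "t \<in> {0..pi}" | "t > pi" by fastforce
    then show "cdf (distr circ borel \<alpha>) t = cdf (uniform_measure lborel {0..pi}) t"
    proof cases
      case 1
      then have "measure circ {\<theta>. \<alpha> \<theta> \<le> t} \<le> measure circ {\<theta>. \<alpha> \<theta> \<le> 0}"
        by (intro circ.finite_measure_mono) auto
      also have "\<dots> = 0" using assms by (auto simp: equidist_def)
      finally have "measure circ {\<theta>. \<alpha> \<theta> \<le> t} = 0"
        by (simp add: measure_le_0_iff)
      moreover have "{0..pi} \<inter> {..t} = {}" using 1 by auto
      ultimately show ?thesis by (simp add: c1 c2)
    next
      case 2
      then have "{0..pi} \<inter> {..t} = {0..t}" by auto
      then show ?thesis using 2 assms by (simp add: c1 c2 equidist_def)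
    next
      case 3
      then have "measure circ {\<theta>. \<alpha> \<theta> \<le> t} \<ge> measure circ {\<theta>. \<alpha> \<theta> \<le> pi}"
        by (intro circ.finite_measure_mono) auto
      moreover have "measure circ {\<theta>. \<alpha> \<theta> \<le> pi} = 1" using assms by (auto simp: equidist_def)
      ultimately have "measure circ {\<theta>. \<alpha> \<theta> \<le> t} = 1"
        using circ.prob_le_1[of "{\<theta>. \<alpha> \<theta> \<le> t}"] by linarith
      moreover have "{0..pi} \<inter> {..t} = {0..pi}" using 3 by auto
      ultimately show ?thesis by (simp add: c1 c2)
    qed
  qed
qed

lemma equidist_integral:
  fixes q :: "real \<Rightarrow> real"
  assumes "equidist \<alpha>" "continuous_on UNIV q"
  shows "(\<integral>\<theta>. q (\<alpha> \<theta>) \<partial>circ) = integral {0..pi} q / pi"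
proof -
  have [measurable]: "\<alpha> \<in> borel_measurable borel" "q \<in> borel_measurable borel"
    using assms by (auto simp: equidist_def intro: borel_measurable_continuous_onI)
  have "(\<integral>\<theta>. q (\<alpha> \<theta>) \<partial>circ) = (\<integral>t. q t \<partial>distr circ borel \<alpha>)"
    by (subst integral_distr) auto
  then show ?thesis
    using integral_uniform_interval[OF assms(2), of 0 pi] by (simp add: equidist_distr[OF assms(1)])
qed

text \<open>Makes the cosine itself a competitor, since
  \<open>- cos \<bar>\<theta> - pi\<bar> = cos \<theta>\<close>.\<close>

lemma equidist_abs: "equidist (\<lambda>\<theta>. \<bar>\<theta> - pi\<bar>)"
  unfolding equidist_def
proof (intro conjI ballI)
  fix t assume t: "t \<in> {0..pi}"
  have "{\<theta>. \<bar>\<theta> - pi\<bar> \<le> t} = {pi-t..pi+t}" by auto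
  moreover have "{0..2*pi} \<inter> {pi-t..pi+t} = {pi-t..pi+t}" using t by auto
  ultimately show "measure circ {\<theta>. \<bar>\<theta> - pi\<bar> \<le> t} = t / pi"
    using t by (simp add: circ_def)
qed simp

section \<open>Distribution function, rank and quantile of a periodic function\<close>

locale profile =
  fixes u :: "real \<Rightarrow> real"
  assumes cont: "continuous_on UNIV u"
    and periodic: "u (\<theta> + 2*pi) = u \<theta>"
    and null_levels: "measure circ {\<theta>. u \<theta> = x} = 0"
begin

definition G :: "real \<Rightarrow> real" where "G = cdf (distr circ borel u)"

definition rank :: "real \<Rightarrow> real" where "rank \<theta> = pi * G (u \<theta>)"

lemma u_measurable [measurable]: "u \<in> borel_measurable borel"
  using cont by (intro borel_measurable_continuous_onI)

lemma real_distr: "real_distribution (distr circ borel u)"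
  by (simp add: real_distribution_def real_distribution_axioms_def circ.prob_space_distr)

lemma G_eq: "G x = measure circ {\<theta>. u \<theta> \<le> x}"
  by (simp add: G_def cdf_def measure_distr vimage_def)

text \<open>Null level sets mean that the distribution of \<open>u\<close> has no atoms. This is
  what makes the rank exactly uniform, with no ties to be broken.\<close>

lemma G_cont: "continuous_on UNIV G"
proof -
  interpret D: real_distribution "distr circ borel u" by (rule real_distr)
  have "isCont G x" for x
    unfolding G_def D.isCont_cdf
    using null_levels[of x] by (simp add: measure_distr vimage_def)
  then show ?thesis by (simp add: continuous_on_eq_continuous_at)
qed

lemma G_range: "0 \<le> G x" "G x \<le> 1"
  by (simp_all add: G_eq)

lemma G_mono: "x \<le> y \<Longrightarrow> G x \<le> G y"
  unfolding G_eq by (rule circ.finite_measure_mono) auto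

lemma exists_reduced: "\<exists>\<theta>'\<in>{0..2*pi}. u \<theta>' = u \<theta>"
proof -
  define k where "k = \<lfloor>\<theta> / (2*pi)\<rfloor>"
  have per: "u (x + 2*pi * real n) = u x" for x n
  proof (induction n)
    case (Suc n)
    have "u (x + 2*pi * real (Suc n)) = u ((x + 2*pi * real n) + 2*pi)"
      by (simp add: algebra_simps)
    then show ?case using Suc periodic by simp
  qed simp
  have per': "u (x - 2*pi * of_int k) = u x" for x
  proof (cases "k \<ge> 0")
    case True
    then show ?thesis using per[of "x - 2*pi * of_int k" "nat k"] by simp
  next
    case False
    then show ?thesis using per[of x "nat (-k)"] by simp
  qed
  have "of_int k \<le> \<theta>/(2*pi)" "\<theta>/(2*pi) < of_int k + 1" by (auto simp: k_def)
  then have "\<theta> - 2*pi * of_int k \<in> {0..2*pi}"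
    by (auto simp: field_simps)
  then show ?thesis using per' by blast
qed

definition lo :: real where "lo = Inf (range u)"
definition hi :: real where "hi = Sup (range u)"

lemma range_attained: "\<exists>p\<in>{0..2*pi}. u p = lo" "\<exists>p\<in>{0..2*pi}. u p = hi" "u \<theta> \<in> {lo..hi}"
proof -
  have im: "u ` {0..2*pi} = range u" using exists_reduced by (auto simp: image_iff) metis
  have "compact (u ` {0..2*pi})"
    using cont continuous_on_subset by (intro compact_continuous_image) blast+
  then have c: "compact (range u)" by (simp add: im)
  have "lo \<in> range u" "hi \<in> range u"
    unfolding lo_def hi_def using c
    by (auto intro!: closed_contains_Inf closed_contains_Sup bounded_imp_bdd_below bounded_imp_bdd_above
        compact_imp_bounded compact_imp_closed)
  then have "lo \<in> u ` {0..2*pi}" "hi \<in> u ` {0..2*pi}" by (simp_all add: im)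
  then show "\<exists>p\<in>{0..2*pi}. u p = lo" "\<exists>p\<in>{0..2*pi}. u p = hi" by force+
  show "u \<theta> \<in> {lo..hi}"
    unfolding lo_def hi_def using c
    by (auto intro!: cINF_lower cSUP_upper bounded_imp_bdd_below bounded_imp_bdd_above compact_imp_bounded)
qed

lemma G_hi: "G hi = 1"
proof -
  have "{\<theta>. u \<theta> \<le> hi} = space circ" using range_attained(3) by auto
  then show ?thesis unfolding G_eq by (simp only: circ.prob_space)
qed

lemma G_lo: "G lo = 0"
proof -
  have "{\<theta>. u \<theta> \<le> lo} = {\<theta>. u \<theta> = lo}" using range_attained(3) by (auto intro: antisym)
  then show ?thesis unfolding G_eq using null_levels by simp
qed

lemma lo_less_hi: "lo < hi"
proof (rule ccontr)
  assume "\<not> lo < hi"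
  moreover have "lo \<le> hi" using range_attained(3)[of 0] by auto
  ultimately have "lo = hi" by simp
  with G_hi G_lo show False by simp
qed

text \<open>Between a minimum and a maximum, the continuous \<open>u\<close> takes values strictly
  between x and y on a nonempty open set, which has positive measure. Strictness is what makes
  \<open>G\<close> invertible on its range.\<close>

lemma G_strict:
  assumes "lo \<le> x" "x < y" "y \<le> hi"
  shows "G x < G y"
proof -
  obtain p q where pq: "p \<in> {0..2*pi}" "q \<in> {0..2*pi}" "u p = lo" "u q = hi"
    using range_attained by blast
  define S where "S = u -` {x<..<y} \<inter> {min p q<..<max p q}"
  have oS: "open S"
    unfolding S_def using cont by (intro open_Int open_vimage) auto
  have "\<exists>z. min p q \<le> z \<and> z \<le> max p q \<and> u z = (x+y)/2"
  proof (cases "p \<le> q")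
    case True
    then show ?thesis using IVT'[of u p "(x+y)/2" q] pq assms cont continuous_on_subset by force
  next
    case False
    then show ?thesis using IVT2'[of u p "(x+y)/2" q] pq assms cont continuous_on_subset by force
  qed
  then obtain z where z: "min p q \<le> z" "z \<le> max p q" "u z = (x+y)/2" by blast
  have "z \<noteq> p" "z \<noteq> q" using z(3) pq assms by (auto simp: field_simps)
  then have "z \<in> S" using z assms by (auto simp: S_def field_simps min_def max_def split: if_splits)
  then obtain e where e: "e > 0" "ball z e \<subseteq> S" using oS open_contains_ball by blast
  have Ssub: "S \<subseteq> {0..2*pi}" using pq by (auto simp: S_def)
  have "0 < measure lborel (ball z e)" using e content_ball_pos by (simp add: measure_def)
  also have "measure lborel (ball z e) \<le> measure lborel S"
  proof (rule measure_mono_fmeasurable[OF e(2)])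
    show "S \<in> fmeasurable lborel"
      by (rule fmeasurableI2[of "{0..2*pi}"]) (use Ssub oS in \<open>auto simp: fmeasurable_def\<close>)
  qed auto
  finally have "0 < measure lborel S" .
  then have "0 < measure circ S"
    using Ssub oS by (simp add: circ_def Int_absorb1)
  also have "measure circ S \<le> measure circ ({\<theta>. u \<theta> \<le> y} - {\<theta>. u \<theta> \<le> x})"
    by (rule circ.finite_measure_mono) (auto simp: S_def)
  also have "\<dots> = G y - G x"
    unfolding G_eq using assms by (intro circ.finite_measure_Diff) auto
  finally show ?thesis by simp
qed

lemma rank_range: "rank \<theta> \<in> {0..pi}"
  using G_range[of "u \<theta>"] by (auto simp: rank_def)

lemma rank_cont: "continuous_on UNIV rank"
  unfolding rank_def
  by (intro continuous_intros continuous_on_compose2[OF G_cont cont]) auto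

text \<open>The inverse of \<open>pi * G\<close> on the range of \<open>u\<close>, extended by constants outside \<open>{0..pi}\<close>.\<close>

definition quant :: "real \<Rightarrow> real" where
  "quant t = the_inv_into {lo..hi} G (max 0 (min 1 (t / pi)))"

lemma G_inj: "inj_on G {lo..hi}"
proof (rule inj_onI)
  fix x y assume "x \<in> {lo..hi}" "y \<in> {lo..hi}" "G x = G y"
  then show "x = y" using G_strict[of x y] G_strict[of y x] by (cases x y rule: linorder_cases) auto
qed

lemma G_image: "G ` {lo..hi} = {0..1}"
proof
  show "G ` {lo..hi} \<subseteq> {0..1}" using G_range by auto
  show "{0..1} \<subseteq> G ` {lo..hi}"
  proof
    fix y :: real assume "y \<in> {0..1}"
    then obtain x where "lo \<le> x" "x \<le> hi" "G x = y"
      using IVT'[of G lo y hi] G_lo G_hi lo_less_hi G_cont continuous_on_subset by fastforce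
    then show "y \<in> G ` {lo..hi}" by auto
  qed
qed

lemma quant_cont: "continuous_on UNIV quant"
proof -
  have "continuous_on (G ` {lo..hi}) (the_inv_into {lo..hi} G)"
    by (rule continuous_on_inv)
      (use G_cont continuous_on_subset G_inj in \<open>auto simp: the_inv_into_f_f\<close>)
  then have "continuous_on {0..1} (the_inv_into {lo..hi} G)" by (simp add: G_image)
  then show ?thesis
    unfolding quant_def by (rule continuous_on_compose2) (auto intro!: continuous_intros)
qed

lemma quant_rank: "quant (rank \<theta>) = u \<theta>"
proof -
  have "max 0 (min 1 (rank \<theta> / pi)) = G (u \<theta>)"
    using G_range[of "u \<theta>"] by (simp add: rank_def)
  then show ?thesis
    unfolding quant_def using range_attained(3) G_inj by (simp add: the_inv_into_f_f)
qed

lemma quant_in: "quant t \<in> {lo..hi}"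
  unfolding quant_def by (rule the_inv_into_into[OF G_inj]) (auto simp: G_image)

lemma G_quant: "t \<in> {0..pi} \<Longrightarrow> pi * G (quant t) = t"
  unfolding quant_def by (subst f_the_inv_into_f[OF G_inj]) (auto simp: G_image)

lemma quant_mono: "t \<in> {0..pi} \<Longrightarrow> t' \<in> {0..pi} \<Longrightarrow> t \<le> t' \<Longrightarrow> quant t \<le> quant t'"
  using G_quant[of t] G_quant[of t'] G_strict[of "quant t'" "quant t"] quant_in[of t] quant_in[of t']
  by (smt (verit) atLeastAtMost_iff mult_less_cancel_left_pos pi_gt_zero)

lemma rank_le_iff: "t \<in> {0..pi} \<Longrightarrow> rank \<theta> \<le> t \<longleftrightarrow> u \<theta> \<le> quant t"
  using G_strict[of "quant t" "u \<theta>"] G_mono[of "u \<theta>" "quant t"] quant_in[of t] range_attained(3)[of \<theta>]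
    G_quant[of t]
  unfolding rank_def
  by (smt (verit) atLeastAtMost_iff mult_le_cancel_left_pos pi_gt_zero)

text \<open>The probability integral transform: a sublevel set of the rank is a sublevel set of
  \<open>u\<close>, and \<open>quant\<close> inverts \<open>pi * G\<close>.\<close>

lemma rank_equidist: "equidist rank"
  unfolding equidist_def
proof (intro conjI ballI)
  show "rank \<in> borel_measurable borel"
    using rank_cont by (rule borel_measurable_continuous_onI)
  fix t assume t: "t \<in> {0..pi}"
  have "measure circ {\<theta>. rank \<theta> \<le> t} = G (quant t)"
    unfolding G_eq using rank_le_iff[OF t] by simp
  then show "measure circ {\<theta>. rank \<theta> \<le> t} = t / pi"
    using G_quant[OF t] by (simp add: field_simps)
qed

lemma integral_rank: "(\<integral>\<theta>. - u \<theta> * cos (rank \<theta>) \<partial>circ) = - integral {0..pi} (\<lambda>t. quant t * cos t) / pi"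
proof -
  have "(\<integral>\<theta>. - u \<theta> * cos (rank \<theta>) \<partial>circ) = (\<integral>\<theta>. (\<lambda>t. - (quant t * cos t)) (rank \<theta>) \<partial>circ)"
    by (simp add: quant_rank)
  also have "\<dots> = integral {0..pi} (\<lambda>t. - (quant t * cos t)) / pi"
    by (rule equidist_integral[OF rank_equidist]) (intro continuous_intros quant_cont)
  finally show ?thesis by simp
qed

text \<open>Young's inequality for the convex primitive of \<open>- cos (pi * G x)\<close>; the dual term only depends
  on the distribution of \<open>\<alpha>\<close>.\<close>

lemma hardy_littlewood:
  assumes \<alpha>: "equidist \<alpha>" "\<And>\<theta>. \<theta> \<in> {0..2*pi} \<Longrightarrow> \<alpha> \<theta> \<in> {0..pi}"
  shows "(\<integral>\<theta>. - u \<theta> * cos (\<alpha> \<theta>) \<partial>circ) \<le> (\<integral>\<theta>. - u \<theta> * cos (rank \<theta>) \<partial>circ)"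
proof -
  have [measurable]: "\<alpha> \<in> borel_measurable borel" using \<alpha> by (simp add: equidist_def)
  have [measurable]: "rank \<in> borel_measurable borel" using rank_equidist by (simp add: equidist_def)
  define f where "f x = - cos (pi * G x)" for x
  have fc: "continuous_on UNIV f"
    unfolding f_def by (intro continuous_intros G_cont)
  have fm: "f x \<le> f y" if "x \<le> y" for x y
    unfolding f_def using G_mono[OF that] G_range[of x] G_range[of y]
    by (auto intro!: cos_monotone_0_pi_le)
  \<comment> \<open>Clamping the upper limit to the range of \<open>u\<close> makes
    \<open>\<Psi>\<close> continuous on the whole line.\<close>
  define \<Psi> where "\<Psi> y = integral {lo..max lo (min hi y)} f" for y
  have \<Psi>eq: "\<Psi> y = integral {lo..y} f" if "y \<in> {lo..hi}" for y
    using that by (simp add: \<Psi>_def min_absorb2 max_absorb2)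
  have fint: "f integrable_on {a..b}" for a b
    using fc continuous_on_subset by (intro integrable_continuous_interval) blast
  have conv: "f x * (y - x) \<le> \<Psi> y - \<Psi> x" if xy: "x \<in> {lo..hi}" "y \<in> {lo..hi}" for x y
  proof (cases "x \<le> y")
    case True
    have "integral {lo..x} f + integral {x..y} f = integral {lo..y} f"
      using xy True by (intro Henstock_Kurzweil_Integration.integral_combine fint) auto
    moreover have "integral {x..y} (\<lambda>_. f x) \<le> integral {x..y} f"
      by (intro integral_le fint) (auto intro: fm)
    ultimately show ?thesis using xy True by (simp add: \<Psi>eq mult.commute)
  next
    case False
    have "integral {lo..y} f + integral {y..x} f = integral {lo..x} f"
      using xy False by (intro Henstock_Kurzweil_Integration.integral_combine fint) auto
    moreover have "integral {y..x} f \<le> integral {y..x} (\<lambda>_. f x)"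
      by (intro integral_le fint) (auto intro: fm)
    ultimately show ?thesis using xy False by (simp add: \<Psi>eq algebra_simps)
  qed
  have "continuous_on {lo..hi} (\<lambda>y. integral {lo..y} f)"
    by (rule indefinite_integral_continuous_1[OF fint])
  then have \<Psi>c: "continuous_on UNIV \<Psi>"
    unfolding \<Psi>_def by (rule continuous_on_compose2) (use lo_less_hi in \<open>auto intro!: continuous_intros\<close>)
  \<comment> \<open>The Legendre conjugate of \<open>\<Psi>\<close> at slope \<open>- cos t\<close>:
    the supremum is attained at \<open>quant t\<close>, where the slope of \<open>\<Psi>\<close> is
    \<open>- cos (pi * G (quant t)) = - cos t\<close>.\<close>
  define k where "k t = - \<Psi> (quant t) - quant t * cos t" for t
  have kc: "continuous_on UNIV k"
    unfolding k_def by (intro continuous_intros quant_cont continuous_on_compose2[OF \<Psi>c quant_cont]) auto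
  have [measurable]: "k \<in> borel_measurable borel" "\<Psi> \<in> borel_measurable borel"
    using kc \<Psi>c by (auto intro: borel_measurable_continuous_onI)
  have bnd: "\<exists>B. \<forall>x\<in>{a..b}. \<bar>h x\<bar> \<le> B" if "continuous_on UNIV h" for h :: "real \<Rightarrow> real" and a b
  proof -
    have "compact (h ` {a..b})"
      using that continuous_on_subset by (intro compact_continuous_image) blast+
    then have "bounded (h ` {a..b})" by (rule compact_imp_bounded)
    then show ?thesis by (auto simp: bounded_iff)
  qed
  have int: "integrable circ h" if "h \<in> borel_measurable borel" "\<And>\<theta>. \<theta> \<in> {0..2*pi} \<Longrightarrow> \<bar>h \<theta>\<bar> \<le> B" for h :: "real \<Rightarrow> real" and B
    by (rule circ.integrable_const_bound[where B=B]) (use that in \<open>auto intro!: AE_circ\<close>)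
  obtain Bk where Bk: "\<And>t. t \<in> {0..pi} \<Longrightarrow> \<bar>k t\<bar> \<le> Bk" using bnd[OF kc, of 0 pi] by blast
  obtain B\<Psi> where B\<Psi>: "\<And>t. t \<in> {lo..hi} \<Longrightarrow> \<bar>\<Psi> t\<bar> \<le> B\<Psi>" using bnd[OF \<Psi>c, of lo hi] by blast
  obtain Bu where Bu: "\<And>t. t \<in> {0..2*pi} \<Longrightarrow> \<bar>u t\<bar> \<le> Bu" using bnd[OF cont, of 0 "2*pi"] by blast
  have iu: "integrable circ (\<lambda>\<theta>. - u \<theta> * cos (\<alpha> \<theta>))"
    by (rule int[where B = Bu])
       (use Bu in \<open>auto simp: abs_mult intro: order_trans[OF mult_left_le]\<close>)
  have i\<Psi>: "integrable circ (\<lambda>\<theta>. \<Psi> (u \<theta>))"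
    by (rule int[where B=B\<Psi>]) (use B\<Psi> range_attained in auto)
  have ik: "integrable circ (\<lambda>\<theta>. k (\<alpha> \<theta>))" "integrable circ (\<lambda>\<theta>. k (rank \<theta>))"
    using Bk \<alpha>(2) rank_range by (auto intro!: int[where B=Bk])
  have young: "- u \<theta> * cos (\<alpha> \<theta>) \<le> \<Psi> (u \<theta>) + k (\<alpha> \<theta>)" if "\<theta> \<in> {0..2*pi}" for \<theta>
    using conv[OF quant_in[of "\<alpha> \<theta>"] range_attained(3)[of \<theta>]] G_quant[OF \<alpha>(2)[OF that]]
    by (simp add: k_def f_def algebra_simps)
  have "(\<integral>\<theta>. - u \<theta> * cos (\<alpha> \<theta>) \<partial>circ) \<le> (\<integral>\<theta>. \<Psi> (u \<theta>) + k (\<alpha> \<theta>) \<partial>circ)"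
    by (intro integral_mono_AE iu Bochner_Integration.integrable_add i\<Psi> ik AE_circ young)
  also have "\<dots> = (\<integral>\<theta>. \<Psi> (u \<theta>) \<partial>circ) + (\<integral>\<theta>. k (\<alpha> \<theta>) \<partial>circ)"
    by (intro Bochner_Integration.integral_add i\<Psi> ik)
  also have "(\<integral>\<theta>. k (\<alpha> \<theta>) \<partial>circ) = (\<integral>\<theta>. k (rank \<theta>) \<partial>circ)"
    by (simp add: equidist_integral[OF \<alpha>(1) kc] equidist_integral[OF rank_equidist kc])
  also have "(\<integral>\<theta>. \<Psi> (u \<theta>) \<partial>circ) + (\<integral>\<theta>. k (rank \<theta>) \<partial>circ) = (\<integral>\<theta>. \<Psi> (u \<theta>) + k (rank \<theta>) \<partial>circ)"
    by (intro Bochner_Integration.integral_add[symmetric] i\<Psi> ik)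
  \<comment> \<open>Young's inequality is an equality for the rank, because
    \<open>quant (rank \<theta>) = u \<theta>\<close>.\<close>
  also have "\<dots> = (\<integral>\<theta>. - u \<theta> * cos (rank \<theta>) \<partial>circ)"
    by (simp add: k_def quant_rank)
  finally show ?thesis .
qed

end

section \<open>A one-dimensional Polya--Szego inequality\<close>

text \<open>The building block for primitives of piecewise linear functions. Only the corner at 0
  needs the difference quotient.\<close>

lemma DERIV_pos_part_square:
  "((\<lambda>y::real. (max 0 y)\<^sup>2 / 2) has_real_derivative max 0 y) (at y)"
proof -
  consider "y > 0" | "y < 0" | "y = 0" by linarith
  then show ?thesis
  proof cases
    case 1
    have "((\<lambda>y::real. y\<^sup>2 / 2) has_real_derivative y) (at y)"
      by (auto intro!: derivative_eq_intros)
    then have "((\<lambda>y::real. (max 0 y)\<^sup>2 / 2) has_real_derivative y) (at y)"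
      by (rule has_field_derivative_transform_within_open[where S="{0<..}"]) (use 1 in auto)
    then show ?thesis using 1 by simp
  next
    case 2
    have "((\<lambda>y::real. (0::real)) has_real_derivative 0) (at y)" by simp
    then have "((\<lambda>y::real. (max 0 y)\<^sup>2 / 2) has_real_derivative 0) (at y)"
      by (rule has_field_derivative_transform_within_open[where S="{..<0}"]) (use 2 in auto)
    then show ?thesis using 2 by simp
  next
    case 3
    have "((\<lambda>h::real. (max 0 h)\<^sup>2 / 2 / h) \<longlongrightarrow> 0) (at 0)"
    proof (rule tendsto_0_le[of "\<lambda>h. h" _ _ 1])
      show "\<forall>\<^sub>F h::real in at 0. norm ((max 0 h)\<^sup>2 / 2 / h) \<le> norm h * 1"
      proof (rule always_eventually, rule allI)
        fix h :: real
        show "norm ((max 0 h)\<^sup>2 / 2 / h) \<le> norm h * 1"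
          by (cases "h > 0") (auto simp: power2_eq_square max_def)
      qed
    qed (rule tendsto_ident_at)
    then show ?thesis using 3 by (simp add: DERIV_def)
  qed
qed

text \<open>\<open>\<kappa>\<close> rises from 0 to 1 over a length \<open>\<eta>\<close> after x1
  and falls back over a length \<open>\<eta>\<close> before x2. It is a continuous substitute for
  the indicator of the band of levels between x1 and x2, so that its primitive composed with
  \<open>u\<close> is differentiable and can be integrated by parts; the two ramps cost
  \<open>\<eta>\<close> in total.\<close>

lemma exists_primitive_of_trapezoid:
  fixes x1 x2 \<eta> :: real
  assumes "\<eta> > 0" "2 * \<eta> < x2 - x1"
  shows "\<exists>c \<kappa>. (\<forall>x. (c has_real_derivative \<kappa> x) (at x)) \<and> continuous_on UNIV \<kappa>
    \<and> (\<forall>x. 0 \<le> \<kappa> x \<and> \<kappa> x \<le> 1) \<and> (\<forall>x. x \<le> x1 \<or> x2 \<le> x \<longrightarrow> \<kappa> x = 0)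
    \<and> (\<forall>x\<le>x1. c x = 0) \<and> (\<forall>x\<ge>x2. c x = x2 - x1 - \<eta>)"
proof -
  define p :: "real \<Rightarrow> real" where "p y = (max 0 y)\<^sup>2 / 2" for y
  define c where "c x = (p (x-x1) - p (x-x1-\<eta>) - p (x-x2+\<eta>) + p (x-x2)) / \<eta>" for x
  define \<kappa> where "\<kappa> x = (max 0 (x-x1) - max 0 (x-x1-\<eta>) - max 0 (x-x2+\<eta>) + max 0 (x-x2)) / \<eta>" for x
  have dp: "((\<lambda>x. p (x + k)) has_real_derivative max 0 (x + k)) (at x)" for k x
    using DERIV_pos_part_square[of "x+k", folded p_def] unfolding DERIV_shift .
  have "(c has_real_derivative \<kappa> x) (at x)" for x
    unfolding c_def \<kappa>_def
    using dp[of "-x1" x] dp[of "-x1-\<eta>" x] dp[of "-x2+\<eta>" x] dp[of "-x2" x]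
    by (intro DERIV_cdivide DERIV_add DERIV_diff) (simp_all add: algebra_simps)
  moreover have "continuous_on UNIV \<kappa>"
    unfolding \<kappa>_def using assms by (intro continuous_intros) auto
  moreover have "0 \<le> \<kappa> x \<and> \<kappa> x \<le> 1" for x
    using assms unfolding \<kappa>_def by (auto simp: max_def field_simps)
  moreover have "\<forall>x. x \<le> x1 \<or> x2 \<le> x \<longrightarrow> \<kappa> x = 0"
    using assms unfolding \<kappa>_def by (auto simp: max_def field_simps)
  moreover have "\<forall>x\<le>x1. c x = 0"
    using assms unfolding c_def p_def by (auto simp: max_def field_simps)
  moreover have "c x = x2 - x1 - \<eta>" if "x \<ge> x2" for x
  proof -
    have "c x = ((x-x1)\<^sup>2 / 2 - (x-x1-\<eta>)\<^sup>2 / 2 - (x-x2+\<eta>)\<^sup>2 / 2 + (x-x2)\<^sup>2 / 2) / \<eta>"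
      using assms that unfolding c_def p_def by (simp add: max_def)
    also have "\<dots> = x2 - x1 - \<eta>"
      using assms by (simp add: field_simps power2_eq_square)
    finally show ?thesis .
  qed
  ultimately show ?thesis by (intro exI[of _ c] exI[of _ \<kappa>] conjI allI impI) auto
qed

text \<open>Cutting the interval into N equal pieces divides the total quadratic error by N, so it
  vanishes in the limit. No derivative of D is involved.\<close>

lemma nondecreasing_if_quadratic_lower_bound:
  fixes D :: "real \<Rightarrow> real"
  assumes D: "\<And>s t. a \<le> s \<Longrightarrow> s \<le> t \<Longrightarrow> t \<le> b \<Longrightarrow> - K * (t - s)\<^sup>2 \<le> D t - D s"
    and st: "a \<le> s" "s \<le> t" "t \<le> b"
  shows "D s \<le> D t"
proof -
  have *: "- K * (t - s)\<^sup>2 / real (Suc n) \<le> D t - D s" for n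
  proof -
    define N where "N = Suc n"
    define \<tau> where "\<tau> k = s + (t - s) * real k / N" for k
    have N: "N > 0" by (simp add: N_def)
    have "D t - D s = (\<Sum>k<N. D (\<tau> (Suc k)) - D (\<tau> k))"
      using N sum_lessThan_telescope[of "\<lambda>k. D (\<tau> k)" N] by (simp add: \<tau>_def)
    also have "\<dots> \<ge> (\<Sum>k<N. - K * ((t - s) / N)\<^sup>2)"
    proof (rule sum_mono)
      fix k assume k: "k \<in> {..<N}"
      have "\<tau> (Suc k) - \<tau> k = ((t - s) * real (Suc k) - (t - s) * real k) / N"
        unfolding \<tau>_def by (simp only: diff_divide_distrib add_diff_cancel_left)
      also have "(t - s) * real (Suc k) - (t - s) * real k = t - s" by (simp add: algebra_simps)
      finally have d: "\<tau> (Suc k) - \<tau> k = (t - s) / N" .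
      have "\<tau> (Suc k) \<le> s + (t - s) * 1"
        unfolding \<tau>_def times_divide_eq_right[symmetric] using k st N
        by (intro add_left_mono mult_left_mono) (auto simp: field_simps)
      moreover have "a \<le> \<tau> k" using st N by (auto simp: \<tau>_def intro!: add_increasing2)
      moreover have "\<tau> k \<le> \<tau> (Suc k)" using d st N divide_nonneg_nonneg[of "t - s" "real N"] by linarith
      ultimately show "- K * ((t - s) / N)\<^sup>2 \<le> D (\<tau> (Suc k)) - D (\<tau> k)"
        using D[of "\<tau> k" "\<tau> (Suc k)"] st by (simp add: d)
    qed
    also have "(\<Sum>k<N. - K * ((t - s) / N)\<^sup>2) = - K * (t - s)\<^sup>2 / N"
      using N by (simp add: power2_eq_square)
    finally show ?thesis by (simp add: N_def)
  qed
  have "(\<lambda>n. - K * (t - s)\<^sup>2 / real (Suc n)) \<longlonglongrightarrow> 0"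
    by (intro LIMSEQ_Suc tendsto_divide_0[OF tendsto_const] filterlim_real_at_infinity_sequentially)
  then have "0 \<le> D t - D s"
    by (rule LIMSEQ_le_const2) (use * in blast)
  then show ?thesis by simp
qed

text \<open>The cosine changes sign exactly at pi/2, so replacing D by the constant D (pi/2) can
  only increase the integral, and the cosine has integral 0.\<close>

lemma integral_cos_mult_nondecreasing:
  fixes D :: "real \<Rightarrow> real"
  assumes "continuous_on {0..pi} D" and "\<And>s t. 0 \<le> s \<Longrightarrow> s \<le> t \<Longrightarrow> t \<le> pi \<Longrightarrow> D s \<le> D t"
  shows "integral {0..pi} (\<lambda>t. cos t * D t) \<le> 0"
proof -
  have c: "(cos has_integral (sin pi - sin 0)) {0..pi}"
    by (rule fundamental_theorem_of_calculus)
       (auto simp flip: has_real_derivative_iff_has_vector_derivative intro!: derivative_eq_intros)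
  have "integral {0..pi} (\<lambda>t. cos t * D t) \<le> integral {0..pi} (\<lambda>t. cos t * D (pi/2))"
  proof (rule integral_le)
    fix t assume t: "t \<in> {0..pi}"
    show "cos t * D t \<le> cos t * D (pi/2)"
    proof (cases "t \<le> pi/2")
      case True
      then show ?thesis using t assms(2)[of t "pi/2"] by (intro mult_left_mono cos_ge_zero) auto
    next
      case False
      then have "cos t \<le> 0" using t cos_monotone_0_pi_le[of "pi/2" t] by auto
      then show ?thesis using False t assms(2)[of "pi/2" t] by (intro mult_left_mono_neg) auto
    qed
  qed (auto intro!: integrable_continuous_interval continuous_intros assms)
  also have "\<dots> = 0" using integral_unique[OF c] by simp
  finally show ?thesis .
qed

section \<open>Derivative of the quantile of a smooth periodic function\<close>

locale smooth_profile = profile +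
  fixes u1 u2 :: "real \<Rightarrow> real"
  assumes deriv1: "(u has_real_derivative u1 \<theta>) (at \<theta>)"
    and deriv2: "(u1 has_real_derivative u2 \<theta>) (at \<theta>)"
    and cont2: "continuous_on UNIV u2"
    and periodic1: "u1 (\<theta> + 2*pi) = u1 \<theta>"
begin

lemma cont1: "continuous_on UNIV u1"
  using deriv2 by (meson DERIV_isCont continuous_at_imp_continuous_on)

lemma integral_u2: "(\<integral>\<theta>. u2 \<theta> \<partial>circ) = 0"
proof -
  have "(u2 has_integral (u1 (2*pi) - u1 0)) {0..2*pi}"
    by (rule fundamental_theorem_of_calculus)
       (auto simp flip: has_real_derivative_iff_has_vector_derivative intro: deriv2 has_field_derivative_at_within)
  then show ?thesis using periodic1[of 0] by (simp add: integral_circ[OF cont2] integral_unique)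
qed

text \<open>The first claim integrates the derivative of \<open>u1 \<theta> * c (u \<theta>)\<close>
  over a period. The second is a total variation bound: a closed path from the minimum to the
  maximum and back crosses every level at least twice.\<close>

lemma trapezoid_identities:
  assumes c: "\<And>x. (c has_real_derivative \<kappa> x) (at x)" and \<kappa>: "continuous_on UNIV \<kappa>" "\<And>x. 0 \<le> \<kappa> x"
    and cm: "c lo = 0" "c hi = m"
  shows "(\<integral>\<theta>. \<kappa> (u \<theta>) * (u1 \<theta>)\<^sup>2 \<partial>circ) = - (\<integral>\<theta>. u2 \<theta> * c (u \<theta>) \<partial>circ)"
    and "m / pi \<le> (\<integral>\<theta>. \<kappa> (u \<theta>) * \<bar>u1 \<theta>\<bar> \<partial>circ)"
proof -
  have cc: "continuous_on UNIV c" using c by (meson DERIV_isCont continuous_at_imp_continuous_on)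
  have \<kappa>u: "continuous_on S (\<lambda>\<theta>. \<kappa> (u \<theta>))" for S
    using continuous_on_compose2[OF \<kappa>(1) cont] continuous_on_subset by blast
  have cu: "continuous_on S (\<lambda>\<theta>. c (u \<theta>))" for S
    using continuous_on_compose2[OF cc cont] continuous_on_subset by blast
  have c1: "continuous_on S u1" and c2: "continuous_on S u2" for S
    using cont1 cont2 continuous_on_subset by blast+
  have dcu: "((\<lambda>\<theta>. c (u \<theta>)) has_real_derivative \<kappa> (u \<theta>) * u1 \<theta>) (at \<theta>)" for \<theta>
    using DERIV_chain2[OF c deriv1] by simp
  have "((\<lambda>\<theta>. u2 \<theta> * c (u \<theta>) + \<kappa> (u \<theta>) * (u1 \<theta>)\<^sup>2) has_integral
      (u1 (2*pi) * c (u (2*pi)) - u1 0 * c (u 0))) {0..2*pi}"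
  proof (rule fundamental_theorem_of_calculus)
    fix \<theta> :: real
    have "((\<lambda>\<theta>. u1 \<theta> * c (u \<theta>)) has_real_derivative u2 \<theta> * c (u \<theta>) + \<kappa> (u \<theta>) * (u1 \<theta>)\<^sup>2) (at \<theta>)"
      using DERIV_mult[OF deriv2 dcu, of \<theta>] by (simp add: power2_eq_square algebra_simps)
    then show "((\<lambda>\<theta>. u1 \<theta> * c (u \<theta>)) has_vector_derivative u2 \<theta> * c (u \<theta>) + \<kappa> (u \<theta>) * (u1 \<theta>)\<^sup>2) (at \<theta> within {0..2*pi})"
      by (simp flip: has_real_derivative_iff_has_vector_derivative add: has_field_derivative_at_within)
  qed simp
  then have "integral {0..2*pi} (\<lambda>\<theta>. u2 \<theta> * c (u \<theta>) + \<kappa> (u \<theta>) * (u1 \<theta>)\<^sup>2) = 0"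
    using periodic[of 0] periodic1[of 0] by (simp add: integral_unique)
  moreover have "integral {0..2*pi} (\<lambda>\<theta>. u2 \<theta> * c (u \<theta>) + \<kappa> (u \<theta>) * (u1 \<theta>)\<^sup>2)
     = integral {0..2*pi} (\<lambda>\<theta>. u2 \<theta> * c (u \<theta>)) + integral {0..2*pi} (\<lambda>\<theta>. \<kappa> (u \<theta>) * (u1 \<theta>)\<^sup>2)"
    by (intro Henstock_Kurzweil_Integration.integral_add integrable_continuous_interval continuous_intros cu \<kappa>u c1 c2)
  ultimately show "(\<integral>\<theta>. \<kappa> (u \<theta>) * (u1 \<theta>)\<^sup>2 \<partial>circ) = - (\<integral>\<theta>. u2 \<theta> * c (u \<theta>) \<partial>circ)"
    by (subst (1 2) integral_circ) (auto intro!: continuous_intros cu \<kappa>u c1 c2 simp: field_simps)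
  define h where "h \<theta> = \<kappa> (u \<theta>) * \<bar>u1 \<theta>\<bar>" for \<theta>
  have hc: "continuous_on S h" for S
    unfolding h_def by (intro continuous_intros \<kappa>u c1)
  have hi: "h integrable_on {a..b}" for a b
    by (intro integrable_continuous_interval hc)
  have seg: "\<bar>c (u b) - c (u a)\<bar> \<le> integral {a..b} h" if "a \<le> b" for a b
  proof -
    have I: "((\<lambda>\<theta>. \<kappa> (u \<theta>) * u1 \<theta>) has_integral (c (u b) - c (u a))) {a..b}"
      by (rule fundamental_theorem_of_calculus[OF that])
         (auto simp flip: has_real_derivative_iff_has_vector_derivative intro: dcu has_field_derivative_at_within)
    have "norm (integral {a..b} (\<lambda>\<theta>. \<kappa> (u \<theta>) * u1 \<theta>)) \<le> integral {a..b} h"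
      using I by (intro integral_norm_bound_integral hi) (auto simp: h_def abs_mult \<kappa>)
    then show ?thesis using I by (simp add: integral_unique)
  qed
  obtain p q where pq: "p \<in> {0..2*pi}" "q \<in> {0..2*pi}" "u p = lo" "u q = hi"
    using range_attained by blast
  have comb: "integral {0..a} h + integral {a..b} h + integral {b..2*pi} h = integral {0..2*pi} h"
    if "0 \<le> a" "a \<le> b" "b \<le> 2*pi" for a b
    using that Henstock_Kurzweil_Integration.integral_combine[of 0 a "2*pi" h] Henstock_Kurzweil_Integration.integral_combine[of a b "2*pi" h] hi by auto
  have u0: "u (2*pi) = u 0" using periodic[of 0] by simp
  \<comment> \<open>Between the two extremal points \<open>c (u \<theta>)\<close> varies by at least
    m. The two outer pieces, glued at the endpoints of the period, give another m.\<close>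
  have "2 * m \<le> integral {0..2*pi} h"
  proof (cases "p \<le> q")
    case True
    then show ?thesis
      using comb[of p q] seg[of 0 p] seg[of p q] seg[of q "2*pi"] pq cm by (auto simp: u0)
  next
    case False
    then show ?thesis
      using comb[of q p] seg[of 0 q] seg[of q p] seg[of p "2*pi"] pq cm by (auto simp: u0)
  qed
  then show "m / pi \<le> (\<integral>\<theta>. \<kappa> (u \<theta>) * \<bar>u1 \<theta>\<bar> \<partial>circ)"
    using integral_circ[of h] hc unfolding h_def by (simp add: field_simps)
qed

text \<open>\<open>2 * w t\<close> is the integral of \<open>u2\<close> over the sublevel set of \<open>quant t\<close> in one period, hence the sum
  of \<open>\<bar>u1\<bar>\<close> over its boundary points.\<close>

definition w :: "real \<Rightarrow> real" where
  "w t = pi * (\<integral>\<theta>. indicator {\<theta>. rank \<theta> \<le> t} \<theta> * u2 \<theta> \<partial>circ)"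

lemma rank_measurable [measurable]: "rank \<in> borel_measurable borel"
  using rank_equidist by (simp add: equidist_def)

lemma u2_measurable [measurable]: "u2 \<in> borel_measurable borel"
  using cont2 by (rule borel_measurable_continuous_onI)

lemma measure_rank_between:
  assumes "0 \<le> s" "s \<le> t" "t \<le> pi"
  shows "measure circ {\<theta>. s < rank \<theta> \<and> rank \<theta> \<le> t} = (t - s) / pi"
proof -
  have "measure circ ({\<theta>. rank \<theta> \<le> t} - {\<theta>. rank \<theta> \<le> s}) = t / pi - s / pi"
    using rank_equidist assms
    by (subst circ.finite_measure_Diff) (auto simp: equidist_def)
  also have "{\<theta>. rank \<theta> \<le> t} - {\<theta>. rank \<theta> \<le> s} = {\<theta>. s < rank \<theta> \<and> rank \<theta> \<le> t}" by auto
  finally show ?thesis by (simp add: diff_divide_distrib)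
qed

lemma exists_u2_bound: "\<exists>C. \<forall>\<theta>\<in>{0..2*pi}. \<bar>u2 \<theta>\<bar> \<le> C"
  using compact_imp_bounded[OF compact_continuous_image[OF continuous_on_subset[OF cont2, of "{0..2*pi}"]]] compact_Icc
  by (auto simp: bounded_iff)

lemma u2_integrable: "h \<in> borel_measurable borel \<Longrightarrow> (\<And>\<theta>. \<bar>h \<theta>\<bar> \<le> B) \<Longrightarrow> integrable circ (\<lambda>\<theta>. h \<theta> * u2 \<theta>)"
proof -
  assume [measurable]: "h \<in> borel_measurable borel" and B: "\<And>\<theta>. \<bar>h \<theta>\<bar> \<le> B"
  obtain C where C: "\<And>\<theta>. \<theta> \<in> {0..2*pi} \<Longrightarrow> \<bar>u2 \<theta>\<bar> \<le> C"
    using compact_imp_bounded[OF compact_continuous_image[OF continuous_on_subset[OF cont2, of "{0..2*pi}"]]]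
 compact_Icc
    by (auto simp: bounded_iff) (metis atLeastAtMost_iff)
  have "0 \<le> B" using B[of 0] by linarith
  show ?thesis
    by (rule circ.integrable_const_bound[where B="B * C"])
       (use C B \<open>0 \<le> B\<close> in \<open>auto intro!: AE_circ mult_mono simp: abs_mult\<close>)
qed

lemma w_lipschitz:
  assumes C: "\<And>\<theta>. \<theta> \<in> {0..2*pi} \<Longrightarrow> \<bar>u2 \<theta>\<bar> \<le> C" and st: "0 \<le> s" "s \<le> t" "t \<le> pi"
  shows "\<bar>w t - w s\<bar> \<le> C * (t - s)"
proof -
  have C0: "0 \<le> C" using C[of 0] by auto
  have "w t - w s = pi * (\<integral>\<theta>. indicator {\<theta>. rank \<theta> \<le> t} \<theta> * u2 \<theta> - indicator {\<theta>. rank \<theta> \<le> s} \<theta> * u2 \<theta> \<partial>circ)"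
    unfolding w_def
    by (subst Bochner_Integration.integral_diff)
       (auto intro!: u2_integrable[where B=1] simp: right_diff_distrib)
  moreover have "\<bar>\<integral>\<theta>. indicator {\<theta>. rank \<theta> \<le> t} \<theta> * u2 \<theta> - indicator {\<theta>. rank \<theta> \<le> s} \<theta> * u2 \<theta> \<partial>circ\<bar>
      \<le> (\<integral>\<theta>. C * indicator {\<theta>. s < rank \<theta> \<and> rank \<theta> \<le> t} \<theta> \<partial>circ)"
    by (intro order_trans[OF integral_abs_bound] integral_mono_AE AE_circ integrable_abs
         Bochner_Integration.integrable_diff u2_integrable[where B=1] integrable_circ_bounded[where B=C])
       (use st C C0 in \<open>auto simp: indicator_def\<close>)
  ultimately show ?thesis
    using measure_rank_between[OF st] by (simp add: abs_mult field_simps)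
qed

text \<open>The finite-difference form of "the derivative of \<open>quant\<close> is at most
  \<open>w\<close>". At a regular level that derivative is 2 divided by the sum of
  \<open>1 / \<bar>u1\<bar>\<close> over the preimages in one period. There are at least two
  preimages, so Cauchy-Schwarz bounds it by half the sum of \<open>\<bar>u1\<bar>\<close>, which is
  \<open>w\<close>. In the proof the band between \<open>quant s\<close> and \<open>quant t\<close>
  replaces a single level, at an error of second order.\<close>

lemma quant_increment:
  assumes C: "\<And>\<theta>. \<theta> \<in> {0..2*pi} \<Longrightarrow> \<bar>u2 \<theta>\<bar> \<le> C" and st: "0 \<le> s" "s < t" "t \<le> pi"
  shows "quant t - quant s \<le> (t - s) * (w s + C * (t - s))"
proof (rule field_le_epsilon)
  let ?I = "indicator {\<theta>. s < rank \<theta> \<and> rank \<theta> \<le> t} :: real \<Rightarrow> real" and ?S = "indicator {\<theta>. rank \<theta> \<le> s} :: real \<Rightarrow> real"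
  fix e :: real assume e: "e > 0"
  define x1 where "x1 = quant s"
  define x2 where "x2 = quant t"
  have C0: "0 \<le> C" using C[of 0] by auto
  have "x1 \<le> x2" unfolding x1_def x2_def using quant_mono st by auto
  moreover have "x1 \<noteq> x2"
    using G_quant[of s] G_quant[of t] st by (auto simp: x1_def x2_def)
  ultimately have x12: "x1 < x2" by simp
  \<comment> \<open>Below a third of the width so that the trapezoid fits, and at most e because the
    ramps lower the increment by exactly \<open>\<eta>\<close>.\<close>
  define \<eta> where "\<eta> = min e ((x2 - x1) / 3)"
  have \<eta>: "\<eta> > 0" "2 * \<eta> < x2 - x1" "\<eta> \<le> e" using e x12 by (auto simp: \<eta>_def min_def)
  define m where "m = x2 - x1 - \<eta>"
  have m: "m > 0" using \<eta> by (simp add: m_def)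
  obtain c \<kappa> where dc: "\<And>x. (c has_real_derivative \<kappa> x) (at x)" and \<kappa>c: "continuous_on UNIV \<kappa>"
    and \<kappa>01: "\<And>x. 0 \<le> \<kappa> x" "\<And>x. \<kappa> x \<le> 1" and \<kappa>0: "\<And>x. x \<le> x1 \<or> x2 \<le> x \<Longrightarrow> \<kappa> x = 0"
    and c0: "\<And>x. x \<le> x1 \<Longrightarrow> c x = 0" and cm: "\<And>x. x \<ge> x2 \<Longrightarrow> c x = m"
    using exists_primitive_of_trapezoid[OF \<eta>(1,2)] unfolding m_def by blast
  have cmono: "x \<le> y \<Longrightarrow> c x \<le> c y" for x y
    by (rule DERIV_nonneg_imp_nondecreasing) (use dc \<kappa>01 in blast)+
  have crange: "0 \<le> c x" "c x \<le> m" for x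
    using cmono[of x1 x] c0[of x1] c0[of x] cmono[of x x2] cm[of x2] cm[of x] m by linarith+
  have in12: "x1 \<in> {lo..hi}" "x2 \<in> {lo..hi}" unfolding x1_def x2_def by (rule quant_in)+
  have cc: "continuous_on UNIV c" using dc by (meson DERIV_isCont continuous_at_imp_continuous_on)
  have [measurable]: "c \<in> borel_measurable borel" "\<kappa> \<in> borel_measurable borel" "u1 \<in> borel_measurable borel"
    using cc \<kappa>c cont1 by (auto intro: borel_measurable_continuous_onI)
  have id: "(\<integral>\<theta>. \<kappa> (u \<theta>) * (u1 \<theta>)\<^sup>2 \<partial>circ) = - (\<integral>\<theta>. u2 \<theta> * c (u \<theta>) \<partial>circ)"
    and tv: "m / pi \<le> (\<integral>\<theta>. \<kappa> (u \<theta>) * \<bar>u1 \<theta>\<bar> \<partial>circ)"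
    using trapezoid_identities[OF dc \<kappa>c \<kappa>01(1), of m] c0[of lo] cm[of hi] in12 by auto
  note intc = integrable_circ_continuous
  have \<kappa>u: "continuous_on UNIV (\<lambda>\<theta>. \<kappa> (u \<theta>))" "continuous_on UNIV (\<lambda>\<theta>. c (u \<theta>))"
    using continuous_on_compose2[OF \<kappa>c cont] continuous_on_compose2[OF cc cont] by auto
  have "(\<integral>\<theta>. \<kappa> (u \<theta>) \<partial>circ) \<le> (\<integral>\<theta>. ?I \<theta> \<partial>circ)"
  proof (rule integral_mono)
    show "integrable circ (\<lambda>\<theta>. \<kappa> (u \<theta>))" by (intro intc \<kappa>u)
    show "integrable circ (?I)"
      by (intro integrable_circ_bounded[where B=1]) (auto simp: indicator_def)
    fix \<theta>
    show "\<kappa> (u \<theta>) \<le> ?I \<theta>"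
      using \<kappa>0[of "u \<theta>"] \<kappa>01[of "u \<theta>"] rank_le_iff[of s \<theta>] rank_le_iff[of t \<theta>] st
      by (auto simp: indicator_def x1_def x2_def)
  qed
  also have "\<dots> = (t - s) / pi" using measure_rank_between[of s t] st by simp
  finally have \<kappa>le: "(\<integral>\<theta>. \<kappa> (u \<theta>) \<partial>circ) \<le> (t - s) / pi" .
  \<comment> \<open>Cauchy-Schwarz in the form
    \<open>2 * \<mu> * x - \<mu>\<^sup>2 \<le> x\<^sup>2\<close>. This \<open>\<mu>\<close> is the
    quotient of the bounds m / pi and (t - s) / pi and hence the optimal parameter.\<close>
  define \<mu> where "\<mu> = m / (t - s)"
  have \<mu>: "\<mu> > 0" using m st by (simp add: \<mu>_def)
  have "2 * \<mu> * (\<integral>\<theta>. \<kappa> (u \<theta>) * \<bar>u1 \<theta>\<bar> \<partial>circ) - \<mu>\<^sup>2 * (\<integral>\<theta>. \<kappa> (u \<theta>) \<partial>circ)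
      = (\<integral>\<theta>. 2 * \<mu> * (\<kappa> (u \<theta>) * \<bar>u1 \<theta>\<bar>) - \<mu>\<^sup>2 * \<kappa> (u \<theta>) \<partial>circ)"
    by (subst Bochner_Integration.integral_diff) (auto intro!: intc continuous_intros \<kappa>u cont1)
  also have "\<dots> \<le> (\<integral>\<theta>. \<kappa> (u \<theta>) * (u1 \<theta>)\<^sup>2 \<partial>circ)"
  proof (intro integral_mono intc continuous_intros \<kappa>u cont1)
    fix \<theta>
    have "0 \<le> \<kappa> (u \<theta>) * (\<bar>u1 \<theta>\<bar> - \<mu>)\<^sup>2" using \<kappa>01 by simp
    then show "2 * \<mu> * (\<kappa> (u \<theta>) * \<bar>u1 \<theta>\<bar>) - \<mu>\<^sup>2 * \<kappa> (u \<theta>) \<le> \<kappa> (u \<theta>) * (u1 \<theta>)\<^sup>2"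
      by (simp add: power2_diff distrib_left right_diff_distrib mult.assoc mult.left_commute mult.commute)
  qed
  \<comment> \<open>Adding m times the vanishing mean of \<open>u2\<close> turns the weight
    \<open>- c (u \<theta>)\<close> into \<open>m - c (u \<theta>)\<close>. This is m on the
    sublevel set of x1 and 0 above x2, so only the thin band between them is left as an
    error.\<close>
  also have "\<dots> = (\<integral>\<theta>. m * u2 \<theta> \<partial>circ) - (\<integral>\<theta>. u2 \<theta> * c (u \<theta>) \<partial>circ)"
    using id integral_u2 by simp
  also have "\<dots> = (\<integral>\<theta>. m * u2 \<theta> - u2 \<theta> * c (u \<theta>) \<partial>circ)"
    by (subst Bochner_Integration.integral_diff) (auto intro!: intc continuous_intros \<kappa>u cont2)
  also have "\<dots> \<le> (\<integral>\<theta>. m * (?S \<theta> * u2 \<theta>)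
       + m * C * ?I \<theta> \<partial>circ)"
  proof (intro integral_mono_AE AE_circ)
    show "integrable circ (\<lambda>\<theta>. m * u2 \<theta> - u2 \<theta> * c (u \<theta>))"
      by (intro intc continuous_intros \<kappa>u cont2)
    show "integrable circ (\<lambda>\<theta>. m * (?S \<theta> * u2 \<theta>)
       + m * C * ?I \<theta>)"
      by (intro Bochner_Integration.integrable_add integrable_mult_right u2_integrable[where B=1]
          integrable_circ_bounded[where B="1"]) (auto simp: indicator_def)
    fix \<theta> assume \<theta>: "\<theta> \<in> {0..2*pi}"
    consider "rank \<theta> \<le> s" | "s < rank \<theta>" "rank \<theta> \<le> t" | "t < rank \<theta>" by linarith
    then show "m * u2 \<theta> - u2 \<theta> * c (u \<theta>) \<le> m * (?S \<theta> * u2 \<theta>)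
       + m * C * ?I \<theta>"
    proof cases
      case 1
      then have "c (u \<theta>) = 0" using rank_le_iff[of s \<theta>] st c0 by (simp add: x1_def)
      then show ?thesis using 1 st by simp
    next
      case 2
      have "u2 \<theta> * (m - c (u \<theta>)) \<le> C * m"
      proof -
        have "u2 \<theta> * (m - c (u \<theta>)) \<le> C * (m - c (u \<theta>))"
          using C[OF \<theta>] crange[of "u \<theta>"] by (intro mult_right_mono) auto
        also have "\<dots> \<le> C * m" using C0 crange[of "u \<theta>"] by (intro mult_left_mono) auto
        finally show ?thesis .
      qed
      then show ?thesis using 2 by (simp add: algebra_simps)
    next
      case 3
      then have "c (u \<theta>) = m" using rank_le_iff[of t \<theta>] st cm by (simp add: x2_def)
      then show ?thesis using 3 st by simp
    qed
  qed
  also have "\<dots> = m * (\<integral>\<theta>. ?S \<theta> * u2 \<theta> \<partial>circ) + m * C * ((t - s) / pi)"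
  proof (subst Bochner_Integration.integral_add)
    show "integrable circ (\<lambda>\<theta>. m * (?S \<theta> * u2 \<theta>))"
      by (intro integrable_mult_right u2_integrable[where B=1]) auto
    show "integrable circ (\<lambda>\<theta>. m * C * ?I \<theta>)"
      by (intro integrable_mult_right integrable_circ_bounded[where B="1"]) (auto simp: indicator_def)
  qed (use measure_rank_between[of s t] st in simp)
  also have "\<dots> = m / pi * (w s + C * (t - s))"
    unfolding w_def by (simp add: distrib_left)
  finally have "2 * \<mu> * (\<integral>\<theta>. \<kappa> (u \<theta>) * \<bar>u1 \<theta>\<bar> \<partial>circ) - \<mu>\<^sup>2 * (\<integral>\<theta>. \<kappa> (u \<theta>) \<partial>circ) \<le> m / pi * (w s + C * (t - s))" .
  moreover have "2 * \<mu> * (m / pi) \<le> 2 * \<mu> * (\<integral>\<theta>. \<kappa> (u \<theta>) * \<bar>u1 \<theta>\<bar> \<partial>circ)"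
    using tv \<mu> by (intro mult_left_mono) auto
  moreover have "\<mu>\<^sup>2 * (\<integral>\<theta>. \<kappa> (u \<theta>) \<partial>circ) \<le> \<mu>\<^sup>2 * ((t - s) / pi)"
    using \<kappa>le by (intro mult_left_mono) auto
  ultimately have "2 * \<mu> * (m / pi) - \<mu>\<^sup>2 * ((t - s) / pi) \<le> m / pi * (w s + C * (t - s))"
    by linarith
  moreover have "2 * \<mu> * (m / pi) - \<mu>\<^sup>2 * ((t - s) / pi) = m / pi * (m / (t - s))"
    using st by (simp add: \<mu>_def power2_eq_square)
  ultimately have "m / pi * (m / (t - s)) \<le> m / pi * (w s + C * (t - s))"
    by linarith
  moreover have "0 < m / pi" using m by simp
  ultimately have "m / (t - s) \<le> w s + C * (t - s)"
    by (meson mult_le_cancel_left_pos)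
  then have "m \<le> (t - s) * (w s + C * (t - s))"
    using st by (simp add: field_simps)
  then show "quant t - quant s \<le> (t - s) * (w s + C * (t - s)) + e"
    using \<eta> by (simp add: m_def x1_def x2_def)
qed

lemma w_cont: "continuous_on {0..pi} w"
proof -
  obtain C where C: "\<And>\<theta>. \<theta> \<in> {0..2*pi} \<Longrightarrow> \<bar>u2 \<theta>\<bar> \<le> C"
    using exists_u2_bound by blast
  have "C-lipschitz_on {0..pi} w"
  proof (rule lipschitz_onI)
    fix s t :: real assume "s \<in> {0..pi}" "t \<in> {0..pi}"
    then show "dist (w s) (w t) \<le> C * dist s t"
      using w_lipschitz[OF C, of s t] w_lipschitz[OF C, of t s]
      by (cases "s \<le> t") (auto simp: dist_real_def abs_minus_commute)
  qed (use C[of 0] in auto)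
  then show ?thesis by (rule lipschitz_on_continuous_on)
qed

text \<open>Layer-cake formula: \<open>1 + cos (rank \<theta>)\<close> is the integral of the sine
  from \<open>rank \<theta>\<close> to pi. Fubini applies to this, and the summand 1 drops out
  because \<open>u2\<close> has mean 0.\<close>

lemma integral_u2_cos_rank: "pi * (\<integral>\<theta>. u2 \<theta> * cos (rank \<theta>) \<partial>circ) = integral {0..pi} (\<lambda>t. sin t * w t)"
proof -
  define M where "M = uniform_measure lborel {0..pi}"
  interpret M: prob_space M unfolding M_def by (rule prob_space_uniform_measure) auto
  have [measurable_cong, simp]: "sets M = sets borel" by (simp add: M_def)
  interpret P: pair_prob_space circ M ..
  obtain C where C: "\<And>\<theta>. \<theta> \<in> {0..2*pi} \<Longrightarrow> \<bar>u2 \<theta>\<bar> \<le> C"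
    using exists_u2_bound by blast
  have C0: "0 \<le> C" using C[of 0] by auto
  define h where "h \<theta> t = sin t * (indicator {r. r \<le> t} (rank \<theta>) * u2 \<theta>)" for \<theta> t :: real
  have [measurable]: "(\<lambda>(\<theta>, t). h \<theta> t) \<in> borel_measurable (circ \<Otimes>\<^sub>M M)"
    unfolding h_def by measurable
  have hint: "integrable (circ \<Otimes>\<^sub>M M) (\<lambda>(\<theta>, t). h \<theta> t)"
  proof (rule P.integrable_const_bound[where B=C])
    have "AE \<theta> in circ. AE t in M. norm (h \<theta> t) \<le> C"
    proof (rule AE_circ)
      fix \<theta> assume "\<theta> \<in> {0..2*pi}"
      then have "norm (h \<theta> t) \<le> 1 * C" for t
        using C[of \<theta>] C0 unfolding h_def norm_mult
        by (intro mult_mono) (auto simp: indicator_def)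
      then show "AE t in M. norm (h \<theta> t) \<le> C" by simp
    qed
    moreover have "{x \<in> space (circ \<Otimes>\<^sub>M M). norm (case x of (\<theta>, t) \<Rightarrow> h \<theta> t) \<le> C} \<in> sets (circ \<Otimes>\<^sub>M M)"
      by measurable
    ultimately show "AE x in circ \<Otimes>\<^sub>M M. norm (case x of (\<theta>, t) \<Rightarrow> h \<theta> t) \<le> C"
      by (intro P.AE_pair_measure) (auto simp del: sets_circ \<open>sets M = sets borel\<close>)
  qed simp
  have Mint: "(\<integral>t. g t \<partial>M) = (LINT t:{0..pi}|lborel. g t) / pi" if "g \<in> borel_measurable borel" for g
    unfolding M_def using integral_uniform_interval_measurable[OF that, of 0 pi] by simp
  have inner: "(\<integral>t. h \<theta> t \<partial>M) = (1 + cos (rank \<theta>)) * u2 \<theta> / pi" for \<theta>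
  proof -
    have "(\<integral>t. sin t * indicator {r. r \<le> t} (rank \<theta>) \<partial>M) = (LINT t:{0..pi}|lborel. sin t * indicator {r. r \<le> t} (rank \<theta>)) / pi"
      by (rule Mint) measurable
    also have "(LINT t:{0..pi}|lborel. sin t * indicator {r. r \<le> t} (rank \<theta>)) = (LINT t:{rank \<theta>..pi}|lborel. sin t)"
      unfolding set_lebesgue_integral_def using rank_range[of \<theta>]
      by (intro Bochner_Integration.integral_cong) (auto simp: indicator_def)
    also have "\<dots> = integral {rank \<theta>..pi} sin"
      by (intro set_borel_integral_eq_integral borel_integrable_atLeastAtMost' continuous_intros)
    also have "\<dots> = - cos pi - (- cos (rank \<theta>))"
      using rank_range[of \<theta>]
      by (intro integral_unique fundamental_theorem_of_calculus)
         (auto simp flip: has_real_derivative_iff_has_vector_derivative intro!: derivative_eq_intros)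
    finally show ?thesis
      unfolding h_def by (simp add: mult.assoc[symmetric])
  qed
  have wm [measurable]: "w \<in> borel_measurable borel"
    unfolding w_def by measurable
  have "pi * (\<integral>\<theta>. u2 \<theta> * cos (rank \<theta>) \<partial>circ) = pi * ((\<integral>\<theta>. u2 \<theta> \<partial>circ) + (\<integral>\<theta>. cos (rank \<theta>) * u2 \<theta> \<partial>circ))"
    by (simp add: integral_u2 mult.commute)
  also have "(\<integral>\<theta>. u2 \<theta> \<partial>circ) + (\<integral>\<theta>. cos (rank \<theta>) * u2 \<theta> \<partial>circ) = (\<integral>\<theta>. u2 \<theta> + cos (rank \<theta>) * u2 \<theta> \<partial>circ)"
    using u2_integrable[of "\<lambda>_. 1" 1]
    by (intro Bochner_Integration.integral_add[symmetric] u2_integrable[where B=1]) auto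
  also have "\<dots> = (\<integral>\<theta>. pi * (\<integral>t. h \<theta> t \<partial>M) \<partial>circ)"
    unfolding inner by (intro Bochner_Integration.integral_cong) (simp_all add: distrib_right)
  also have "\<dots> = pi * (\<integral>\<theta>. (\<integral>t. h \<theta> t \<partial>M) \<partial>circ)" by simp
  also have "(\<integral>\<theta>. (\<integral>t. h \<theta> t \<partial>M) \<partial>circ) = (\<integral>t. (\<integral>\<theta>. h \<theta> t \<partial>circ) \<partial>M)"
    by (rule P.Fubini_integral[OF hint, symmetric])
  also have "(\<lambda>t. \<integral>\<theta>. h \<theta> t \<partial>circ) = (\<lambda>t. sin t * w t / pi)"
    by (auto simp: h_def w_def indicator_def)
  also have "(\<integral>t. sin t * w t / pi \<partial>M) = (LINT t:{0..pi}|lborel. sin t * w t / pi) / pi"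
    by (rule Mint) measurable
  also have "(LINT t:{0..pi}|lborel. sin t * w t / pi) = integral {0..pi} (\<lambda>t. sin t * w t / pi)"
    by (intro set_borel_integral_eq_integral borel_integrable_atLeastAtMost' continuous_intros w_cont) auto
  finally show ?thesis by simp
qed

text \<open>With V a primitive of \<open>w\<close>, the difference \<open>V - quant\<close> is
  nondecreasing, because \<open>quant\<close> grows no faster than \<open>w\<close> allows. Its
  integral against the cosine is therefore nonpositive, and integration by parts converts the V term
  into \<open>integral_u2_cos_rank\<close>. For \<open>u = cos\<close> both sides agree.\<close>

lemma polya_szego:
  "(\<integral>\<theta>. - u \<theta> * cos (rank \<theta>) \<partial>circ) \<le> (\<integral>\<theta>. u2 \<theta> * cos (rank \<theta>) \<partial>circ)"
proof -
  obtain C where C: "\<And>\<theta>. \<theta> \<in> {0..2*pi} \<Longrightarrow> \<bar>u2 \<theta>\<bar> \<le> C"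
    using exists_u2_bound by blast
  have C0: "0 \<le> C" using C[of 0] by auto
  note wc = w_cont
  have wi: "w integrable_on {a..b}" if "0 \<le> a" "b \<le> pi" for a b
    using that by (intro integrable_continuous_interval continuous_on_subset[OF wc]) auto
  define V where "V t = integral {0..t} w" for t
  have dV: "(V has_real_derivative w t) (at t within {0..pi})" if "t \<in> {0..pi}" for t
    unfolding V_def by (rule integral_has_real_derivative[OF wc that])
  have Vc: "continuous_on {0..pi} V"
    using dV by (meson DERIV_continuous continuous_on_eq_continuous_within)
  define D where "D t = V t - quant t" for t
  have qc: "continuous_on S quant" for S using quant_cont continuous_on_subset by blast
  \<comment> \<open>One C is the error term of \<open>quant_increment\<close>, the other bounds the
    variation of \<open>w\<close> on {s..t} in the increment of V.\<close>
  have D: "D s \<le> D t" if "0 \<le> s" "s \<le> t" "t \<le> pi" for s t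
  proof (rule nondecreasing_if_quadratic_lower_bound[OF _ that, of "2 * C"])
    fix s t assume st: "0 \<le> s" "s \<le> t" "t \<le> pi"
    show "- (2 * C) * (t - s)\<^sup>2 \<le> D t - D s"
    proof (cases "s = t")
      case False
      have "V s + integral {s..t} w = V t"
        unfolding V_def using st by (intro Henstock_Kurzweil_Integration.integral_combine wi) auto
      moreover have "integral {s..t} (\<lambda>_. w s - C * (t - s)) \<le> integral {s..t} w"
      proof (intro integral_le wi)
        fix r assume r: "r \<in> {s..t}"
        have "w s - w r \<le> C * (r - s)" using w_lipschitz[OF C, of s r] r st by auto
        also have "\<dots> \<le> C * (t - s)" using r C0 by (intro mult_left_mono) auto
        finally show "w s - C * (t - s) \<le> w r" by simp
      qed (use st in auto)
      ultimately show ?thesis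
        using quant_increment[OF C, of s t] st False
        by (simp add: D_def power2_eq_square algebra_simps)
    qed simp
  qed
  have "integral {0..pi} (\<lambda>t. cos t * D t) \<le> 0"
    by (rule integral_cos_mult_nondecreasing) (auto simp: D_def intro!: continuous_intros Vc qc D[unfolded D_def])
  also have "integral {0..pi} (\<lambda>t. cos t * D t)
     = integral {0..pi} (\<lambda>t. cos t * V t) - integral {0..pi} (\<lambda>t. quant t * cos t)"
    unfolding D_def right_diff_distrib
    by (subst Henstock_Kurzweil_Integration.integral_diff)
       (auto intro!: integrable_continuous_interval continuous_intros Vc qc simp: mult.commute)
  finally have 1: "integral {0..pi} (\<lambda>t. cos t * V t) \<le> integral {0..pi} (\<lambda>t. quant t * cos t)" by simp
  \<comment> \<open>The sine vanishes at both ends, so moving the derivative from the sine to V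
    leaves no boundary terms.\<close>
  have "((\<lambda>t. cos t * V t + sin t * w t) has_integral (sin pi * V pi - sin 0 * V 0)) {0..pi}"
    by (rule fundamental_theorem_of_calculus)
       (auto simp flip: has_real_derivative_iff_has_vector_derivative intro!: derivative_eq_intros dV)
  then have "integral {0..pi} (\<lambda>t. cos t * V t + sin t * w t) = 0" by (simp add: integral_unique)
  moreover have "integral {0..pi} (\<lambda>t. cos t * V t + sin t * w t) =
     integral {0..pi} (\<lambda>t. cos t * V t) + integral {0..pi} (\<lambda>t. sin t * w t)"
    by (intro Henstock_Kurzweil_Integration.integral_add integrable_continuous_interval continuous_intros Vc wc)
  ultimately have "- integral {0..pi} (\<lambda>t. quant t * cos t) \<le> pi * (\<integral>\<theta>. u2 \<theta> * cos (rank \<theta>) \<partial>circ)"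
    using 1 integral_u2_cos_rank by linarith
  then show ?thesis unfolding integral_rank by (simp add: field_simps)
qed

end

section \<open>Change of variables for holomorphic maps\<close>

text \<open>Identifies the complex plane with \<open>real^2\<close>, where the Jacobian is the
  determinant of a matrix.\<close>

definition complex_of_vec :: "real^2 \<Rightarrow> complex" where "complex_of_vec v = Complex (v$1) (v$2)"
definition vec_of_complex :: "complex \<Rightarrow> real^2" where "vec_of_complex z = vector [Re z, Im z]"

lemma complex_of_vec_inverse [simp]: "complex_of_vec (vec_of_complex z) = z" "vec_of_complex (complex_of_vec v) = v"
  by (simp_all add: complex_of_vec_def vec_of_complex_def vec_eq_iff forall_2 vector_2)

lemma bounded_linear_complex_of_vec: "bounded_linear complex_of_vec"
  unfolding complex_of_vec_def
  by (rule linear_conv_bounded_linear[THEN iffD1]) (rule linearI, auto simp: complex_eq_iff)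

lemma bounded_linear_vec_of_complex: "bounded_linear vec_of_complex"
  unfolding vec_of_complex_def
  by (rule linear_conv_bounded_linear[THEN iffD1])
     (rule linearI, auto simp: vec_eq_iff forall_2 vector_2)

lemma complex_of_vec_measurable [measurable]: "complex_of_vec \<in> borel_measurable borel"
  by (intro borel_measurable_continuous_onI bounded_linear.continuous_on[OF bounded_linear_complex_of_vec]
      continuous_on_id)

lemma lborel_complex_of_vec: "(lborel :: complex measure) = distr lborel borel complex_of_vec"
proof (rule lborel_eqI)
  fix l u :: complex assume lu: "\<And>b. b \<in> Basis \<Longrightarrow> l \<bullet> b \<le> u \<bullet> b"
  have lu': "Re l \<le> Re u" "Im l \<le> Im u" using lu[of 1] lu[of \<i>] by (auto simp: Basis_complex_def)
  have "complex_of_vec -` box l u = box (vec_of_complex l) (vec_of_complex u)"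
    by (auto simp: complex_of_vec_def vec_of_complex_def box_def Basis_complex_def Basis_vec_def UNIV_2 inner_axis vector_2 inner_complex_def)
  moreover have "emeasure lborel (box (vec_of_complex l) (vec_of_complex u)) = ennreal (\<Prod>b\<in>Basis. (u - l) \<bullet> b)"
  proof -
    have "(\<Prod>b\<in>Basis. (vec_of_complex u - vec_of_complex l) \<bullet> b) = (\<Prod>b\<in>Basis. (u - l) \<bullet> b)"
    proof -
      have B: "(Basis :: (real^2) set) = {axis 1 1, axis 2 1}"
        by (auto simp: Basis_vec_def UNIV_2)
      have "axis 1 1 \<noteq> (axis 2 1 :: real^2)" by (simp add: axis_eq_axis)
      then have "prod h Basis = h (axis 1 1) * h (axis 2 1)" for h :: "real^2 \<Rightarrow> real"
        unfolding B by simp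
      then show ?thesis
        by (simp add: Basis_complex_def inner_axis vec_of_complex_def)
    qed
    then show ?thesis
      using lu' by (subst emeasure_lborel_box)
        (auto simp: Basis_vec_def UNIV_2 inner_axis vec_of_complex_def vector_2)
  qed
  ultimately show "emeasure (distr lborel borel complex_of_vec) (box l u) = ennreal (\<Prod>b\<in>Basis. (u - l) \<bullet> b)"
    by (simp add: emeasure_distr)
qed simp

text \<open>The product form of planar measure, used for iterated integrals over rectangles.\<close>

lemma lborel_complex_of_pair: "(lborel :: complex measure) = distr lborel borel (\<lambda>(x, y). Complex x y)"
proof (rule lborel_eqI)
  have [measurable]: "(\<lambda>(x, y). Complex x y) \<in> borel_measurable borel"
    by (intro borel_measurable_continuous_onI) (auto simp: split_beta Complex_eq intro!: continuous_intros)
  fix l u :: complex assume lu: "\<And>b. b \<in> Basis \<Longrightarrow> l \<bullet> b \<le> u \<bullet> b"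
  have lu': "Re l \<le> Re u" "Im l \<le> Im u" using lu[of 1] lu[of \<i>] by (auto simp: Basis_complex_def)
  have "(\<lambda>(x, y). Complex x y) -` box l u = box (Re l, Im l) (Re u, Im u)"
    by (auto simp: box_def Basis_complex_def Basis_prod_def inner_complex_def)
  moreover have "emeasure lborel (box (Re l, Im l) (Re u, Im u)) = ennreal (\<Prod>b\<in>Basis. (u - l) \<bullet> b)"
    using lu' by (subst emeasure_lborel_box)
      (auto simp: Basis_prod_def Basis_complex_def)
  ultimately show "emeasure (distr lborel borel (\<lambda>(x, y). Complex x y)) (box l u) = ennreal (\<Prod>b\<in>Basis. (u - l) \<bullet> b)"
    by (simp add: emeasure_distr)
qed simp

text \<open>Finiteness of the left side is what makes the nonnegative integrand absolutely
  integrable, so that the substitution theorem for gauge integrals applies. Real values are viewed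
  in \<open>real^1\<close> for that purpose.\<close>

lemma nn_integral_change_of_variables_real2:
  fixes g :: "real^2 \<Rightarrow> real^2" and f :: "real^2 \<Rightarrow> real"
  assumes [measurable]: "S \<in> sets borel" "g ` S \<in> sets borel" "f \<in> borel_measurable borel"
    and [measurable]: "(\<lambda>x. indicator S x * \<bar>det (matrix (g' x))\<bar> * f (g x)) \<in> borel_measurable borel"
    and der: "\<And>x. x \<in> S \<Longrightarrow> (g has_derivative g' x) (at x within S)"
    and inj: "inj_on g S" and f0: "\<And>x. 0 \<le> f x"
    and fin: "(\<integral>\<^sup>+x. ennreal (indicator S x * \<bar>det (matrix (g' x))\<bar> * f (g x)) \<partial>lborel) < \<infinity>"
  shows "(\<integral>\<^sup>+x. ennreal (indicator S x * \<bar>det (matrix (g' x))\<bar> * f (g x)) \<partial>lborel)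
       = (\<integral>\<^sup>+y. ennreal (indicator (g ` S) y * f y) \<partial>lborel)"
proof -
  define F :: "real^2 \<Rightarrow> real^1" where "F y = vec (f y)" for y
  define J where "J x = \<bar>det (matrix (g' x))\<bar> * f (g x)" for x
  have J0: "0 \<le> indicator S x * J x" for x using f0 by (simp add: J_def)
  have Jm [measurable]: "(\<lambda>x. indicator S x * J x) \<in> borel_measurable borel"
    unfolding J_def using assms(4) by (simp add: mult.assoc)
  have int: "integrable lborel (\<lambda>x. indicator S x * J x)"
    using fin J0 by (intro integrableI_nonneg) (auto simp: J_def mult.assoc intro: Jm[unfolded J_def])
  then have intl: "integrable lebesgue (\<lambda>x. indicator S x *\<^sub>R J x)"
    by (subst integrable_completion) auto
  then have Jabs: "J absolutely_integrable_on S"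
    by (simp add: set_integrable_def)
  have SL: "S \<in> sets lebesgue" by (simp add: assms)
  have eqv: "(\<lambda>x. (\<bar>det (matrix (g' x))\<bar> *\<^sub>R F (g x))) = (\<lambda>x. vec (J x))"
    by (auto simp: F_def J_def vec_eq_iff)
  have "(\<lambda>x. \<bar>det (matrix (g' x))\<bar> *\<^sub>R F (g x)) absolutely_integrable_on S \<and>
     integral S (\<lambda>x. \<bar>det (matrix (g' x))\<bar> *\<^sub>R F (g x)) = vec (integral S J)"
    using Jabs unfolding eqv by (simp add: absolutely_integrable_on_1_iff integral_on_1_eq)
  then have "F absolutely_integrable_on (g ` S) \<and> integral (g ` S) F = vec (integral S J)"
    using has_absolute_integral_change_of_variables[OF SL der inj, of F "vec (integral S J)"] by blast
  then have fabs: "f absolutely_integrable_on (g ` S)" and feq: "integral (g ` S) f = integral S J"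
    by (auto simp: F_def absolutely_integrable_on_1_iff integral_on_1_eq vec_eq_iff)
  have fint: "integrable lborel (\<lambda>y. indicator (g ` S) y * f y)"
    using fabs unfolding set_integrable_def by (subst (asm) integrable_completion) auto
  have "(\<integral>\<^sup>+x. ennreal (indicator S x * J x) \<partial>lborel) = ennreal (\<integral>x. indicator S x * J x \<partial>lborel)"
    by (intro nn_integral_eq_integral int) (use J0 in auto)
  also have "(\<integral>x. indicator S x * J x \<partial>lborel) = integral S J"
    using set_lebesgue_integral_eq_integral(2)[OF Jabs] int
    by (simp add: set_lebesgue_integral_def integral_completion)
  also have "\<dots> = (\<integral>y. indicator (g ` S) y * f y \<partial>lborel)"
    using set_lebesgue_integral_eq_integral(2)[OF fabs] fint
    by (simp add: set_lebesgue_integral_def integral_completion feq)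
  also have "ennreal \<dots> = (\<integral>\<^sup>+y. ennreal (indicator (g ` S) y * f y) \<partial>lborel)"
    by (intro nn_integral_eq_integral[symmetric] fint) (use f0 in auto)
  finally show ?thesis by (simp add: J_def mult.assoc)
qed

text \<open>The matrix of multiplication by x + iy has rows (x, -y) and (y, x).\<close>

lemma det_complex_mult:
  "det (matrix (\<lambda>v. vec_of_complex (a * complex_of_vec v))) = (cmod a)\<^sup>2"
  by (simp add: det_2 matrix_def axis_def vec_of_complex_def complex_of_vec_def cmod_power2)
     (simp add: power2_eq_square)

lemma nn_integral_change_of_variables_complex:
  fixes G G' :: "complex \<Rightarrow> complex" and q :: "complex \<Rightarrow> real"
  assumes [measurable]: "S \<in> sets borel" "G ` S \<in> sets borel" "q \<in> borel_measurable borel"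
    and [measurable]: "(\<lambda>z. indicator S z * (cmod (G' z))\<^sup>2 * q (G z)) \<in> borel_measurable borel"
    and der: "\<And>z. z \<in> S \<Longrightarrow> (G has_field_derivative G' z) (at z)"
    and inj: "inj_on G S" and q0: "\<And>z. 0 \<le> q z"
    and fin: "(\<integral>\<^sup>+z. ennreal (indicator S z * (cmod (G' z))\<^sup>2 * q (G z)) \<partial>lborel) < \<infinity>"
  shows "(\<integral>\<^sup>+z. ennreal (indicator S z * (cmod (G' z))\<^sup>2 * q (G z)) \<partial>lborel)
       = (\<integral>\<^sup>+w. ennreal (indicator (G ` S) w * q w) \<partial>lborel)"
proof -
  define g where "g v = vec_of_complex (G (complex_of_vec v))" for v
  define g' where "g' v = (\<lambda>d. vec_of_complex (G' (complex_of_vec v) * complex_of_vec d))" for v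
  define T where "T = complex_of_vec -` S"
  have Tm [measurable]: "T \<in> sets borel"
    unfolding T_def using measurable_sets_borel[OF complex_of_vec_measurable assms(1)] by simp
  have gT: "g ` T = complex_of_vec -` (G ` S)"
  proof (intro equalityI subsetI)
    fix v assume "v \<in> complex_of_vec -` (G ` S)"
    then obtain z where z: "z \<in> S" "complex_of_vec v = G z" by auto
    have "v = g (vec_of_complex z)" using z(2) by (metis complex_of_vec_inverse g_def)
    moreover have "vec_of_complex z \<in> T" using z by (simp add: T_def)
    ultimately show "v \<in> g ` T" by blast
  qed (auto simp: g_def T_def)
  have [measurable]: "g ` T \<in> sets borel"
    unfolding gT using measurable_sets_borel[OF complex_of_vec_measurable assms(2)] by simp
  have ind: "indicator S (complex_of_vec v) = (indicator T v :: real)"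
    "indicator (G ` S) (complex_of_vec v) = (indicator (g ` T) v :: real)" for v
    by (simp_all only: gT) (auto simp: T_def indicator_def)
  have eq: "indicator T v * \<bar>det (matrix (g' v))\<bar> * (q \<circ> complex_of_vec) (g v) =
     indicator S (complex_of_vec v) * (cmod (G' (complex_of_vec v)))\<^sup>2 * q (G (complex_of_vec v))" for v
    unfolding g'_def det_complex_mult by (simp add: ind g_def)
  have nn: "(\<integral>\<^sup>+z. ennreal (h z) \<partial>lborel) = (\<integral>\<^sup>+v. ennreal (h (complex_of_vec v)) \<partial>lborel)"
    if [measurable]: "h \<in> borel_measurable borel" for h :: "complex \<Rightarrow> real"
    by (subst lborel_complex_of_vec, subst nn_integral_distr) auto
  have "(\<integral>\<^sup>+z. ennreal (indicator S z * (cmod (G' z))\<^sup>2 * q (G z)) \<partial>lborel) =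
     (\<integral>\<^sup>+v. ennreal (indicator T v * \<bar>det (matrix (g' v))\<bar> * (q \<circ> complex_of_vec) (g v)) \<partial>lborel)"
    unfolding eq by (subst nn) auto
  also have "\<dots> = (\<integral>\<^sup>+v. ennreal (indicator (g ` T) v * (q \<circ> complex_of_vec) v) \<partial>lborel)"
  proof (rule nn_integral_change_of_variables_real2)
    show "(\<lambda>x. indicat_real T x * \<bar>det (matrix (g' x))\<bar> * (q \<circ> complex_of_vec) (g x)) \<in> borel_measurable borel"
      unfolding eq using measurable_compose[OF complex_of_vec_measurable assms(4)] by simp
    show "(g has_derivative g' x) (at x within T)" if "x \<in> T" for x
    proof -
      have "(G has_derivative (*) (G' (complex_of_vec x))) (at (complex_of_vec x))"
        using der[of "complex_of_vec x"] that by (simp add: T_def has_field_derivative_def)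
      then have "((\<lambda>v. G (complex_of_vec v)) has_derivative (\<lambda>d. G' (complex_of_vec x) * complex_of_vec d)) (at x)"
        using has_derivative_compose[OF bounded_linear_imp_has_derivative[OF bounded_linear_complex_of_vec]] by blast
      then have "(g has_derivative g' x) (at x)"
        unfolding g_def g'_def by (rule bounded_linear.has_derivative[OF bounded_linear_vec_of_complex])
      then show ?thesis by (rule has_derivative_at_withinI)
    qed
    show "inj_on g T"
    proof (rule inj_onI)
      fix x y assume "x \<in> T" "y \<in> T" "g x = g y"
      then have "complex_of_vec x = complex_of_vec y"
        using inj by (auto simp: T_def g_def dest: inj_onD) (metis complex_of_vec_inverse(1) inj_onD)
      then show "x = y" by (metis complex_of_vec_inverse(2))
    qed
    show "(\<integral>\<^sup>+x. ennreal (indicat_real T x * \<bar>det (matrix (g' x))\<bar> * (q \<circ> complex_of_vec) (g x)) \<partial>lborel) < \<infinity>"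
      using fin unfolding eq by (subst (asm) nn) auto
  qed (use q0 in auto)
  also have "\<dots> = (\<integral>\<^sup>+w. ennreal (indicator (G ` S) w * q w) \<partial>lborel)"
    by (subst nn) (auto simp: ind)
  finally show ?thesis .
qed


text \<open>Critical points contribute nothing, because the integrand vanishes there. The rest of Q
  lies in countably many open sets on which G is injective; made disjoint, these pieces can be
  transformed one by one, and a value w lies in the images of at most p of them.\<close>

lemma nn_integral_valence_le:
  fixes G :: "complex \<Rightarrow> complex" and q :: "complex \<Rightarrow> real"
  assumes holo: "G holomorphic_on U" and U: "open U" "Q \<subseteq> U"
    and [measurable]: "Q \<in> sets borel" "T \<in> sets borel" "q \<in> borel_measurable borel"
    and q0: "\<And>z. 0 \<le> q z"
    and val: "\<And>c. finite {z\<in>Q. G z = c} \<and> card {z\<in>Q. G z = c} \<le> p"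
    and GQ: "G ` Q \<subseteq> T"
    and fin: "(\<integral>\<^sup>+z. ennreal (indicator Q z * (cmod (deriv G z))\<^sup>2 * q (G z)) \<partial>lborel) < \<infinity>"
  shows "(\<integral>\<^sup>+z. ennreal (indicator Q z * (cmod (deriv G z))\<^sup>2 * q (G z)) \<partial>lborel)
       \<le> of_nat p * (\<integral>\<^sup>+w. ennreal (indicator T w * q w) \<partial>lborel)"
proof -
  have Ub: "U \<in> sets borel" using U by simp
  define H where "H z = (if z \<in> U then G z else 0)" for z
  define H' where "H' z = (if z \<in> U then deriv G z else 0)" for z
  have [measurable]: "H \<in> borel_measurable borel" "H' \<in> borel_measurable borel"
    unfolding H_def[abs_def] H'_def[abs_def]
    by (intro borel_measurable_continuous_on_if Ub continuous_on_const holomorphic_on_imp_continuous_on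
        holo holomorphic_deriv U)+
  have GH: "indicator A z * (cmod (deriv G z))\<^sup>2 * q (G z) = indicator A z * (cmod (H' z))\<^sup>2 * q (H z)"
    if "A \<subseteq> Q" for A z
    using that U by (auto simp: H_def H'_def indicator_def)
  define D where "D = {z\<in>U. deriv G z \<noteq> 0}"
  have oD: "open D"
  proof -
    have "open (U \<inter> deriv G -` (- {0}))"
      by (intro continuous_open_preimage holomorphic_on_imp_continuous_on holomorphic_deriv holo U) auto
    moreover have "D = U \<inter> deriv G -` (- {0})" by (auto simp: D_def)
    ultimately show ?thesis by simp
  qed
  define \<F> where "\<F> = {B. open B \<and> B \<subseteq> D \<and> inj_on G B}"
  have UF: "\<Union>\<F> = D"
  proof (intro equalityI subsetI)
    fix z assume z: "z \<in> D"
    obtain r where r: "r > 0" "ball z r \<subseteq> U" "inj_on G (ball z r)"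
      using has_complex_derivative_locally_injective[OF holo _ U(1), of z] z by (auto simp: D_def)
    then have "ball z r \<inter> D \<in> \<F>" using oD by (auto simp: \<F>_def intro: inj_on_subset)
    then show "z \<in> \<Union>\<F>" using z r centre_in_ball[of z r] by blast
  qed (auto simp: \<F>_def)
  obtain \<F>' where F': "\<F>' \<subseteq> \<F>" "countable \<F>'" "\<Union>\<F>' = D"
    using Lindelof[of \<F>] UF by (auto simp: \<F>_def)
  define B where "B = from_nat_into (insert {} \<F>')"
  have rB: "range B = insert {} \<F>'" unfolding B_def using F' by (intro range_from_nat_into) auto
  have B: "open (B i)" "B i \<subseteq> D" "inj_on G (B i)" for i
    using rB F'(1) by (metis (no_types, lifting) \<F>_def insertE mem_Collect_eq open_empty empty_subsetI inj_on_empty rangeI subsetD)+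
  have UB: "(\<Union>i. B i) = D" using rB F'(3) by simp
  define A where "A i = Q \<inter> disjointed B i" for i
  have AB: "A i \<subseteq> B i" "A i \<subseteq> Q" for i using disjointed_subset[of B i] by (auto simp: A_def)
  have [measurable]: "disjointed B i \<in> sets borel" for i
    using B(1) by (simp add: disjointed_def sets.Diff sets.finite_UN)
  have Am [measurable]: "A i \<in> sets borel" for i by (simp add: A_def sets.Int)
  have disj: "disjoint_family A"
    using disjoint_family_disjointed[of B] by (auto simp: disjoint_family_on_def A_def)
  have UA: "(\<Union>i. A i) = Q \<inter> D" using UN_disjointed_eq[of B] UB by (auto simp: A_def)
  have GA [measurable]: "G ` A i \<in> sets borel" for i
  proof -
    have holB: "G holomorphic_on B i" using holo B(2)[of i] by (auto simp: D_def intro: holomorphic_on_subset)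
    obtain g where g: "g holomorphic_on G ` B i" "\<And>z. z \<in> B i \<Longrightarrow> g (G z) = z"
      using holomorphic_has_inverse[OF holB B(1) B(3)] by metis
    have oGB: "open (G ` B i)"
      using open_mapping_thm3[OF holB B(1) B(3)] .
    \<comment> \<open>A Borel extension of the inverse of G on \<open>B i\<close>: the image of a
      Borel set under G becomes a preimage under k and is therefore Borel.\<close>
    define k where "k w = (if w \<in> G ` B i then g w else 0)" for w
    have [measurable]: "k \<in> borel_measurable borel"
      unfolding k_def[abs_def]
      by (intro borel_measurable_continuous_on_if continuous_on_const holomorphic_on_imp_continuous_on g)
         (use oGB in auto)
    have "G ` A i = G ` B i \<inter> k -` A i"
      using AB(1)[of i] g(2) by (auto simp: k_def)
    moreover have "k -` A i \<in> sets borel" using measurable_sets_borel[of k borel "A i"] by simp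
    ultimately show ?thesis using oGB by (simp add: sets.Int)
  qed
  have piece: "(\<integral>\<^sup>+z. ennreal (indicator (A i) z * (cmod (deriv G z))\<^sup>2 * q (G z)) \<partial>lborel)
     = (\<integral>\<^sup>+w. ennreal (indicator (G ` A i) w * q w) \<partial>lborel)" for i
  proof (rule nn_integral_change_of_variables_complex)
    show "(\<lambda>z. indicat_real (A i) z * (cmod (deriv G z))\<^sup>2 * q (G z)) \<in> borel_measurable borel"
      unfolding GH[OF AB(2)] by measurable
    show "(G has_field_derivative deriv G z) (at z)" if "z \<in> A i" for z
      using that AB(2)[of i] U holo by (intro holomorphic_derivI[OF holo U(1)]) auto
    show "inj_on G (A i)" using B(3) AB(1) inj_on_subset by blast
    have "(\<integral>\<^sup>+z. ennreal (indicator (A i) z * (cmod (deriv G z))\<^sup>2 * q (G z)) \<partial>lborel)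
      \<le> (\<integral>\<^sup>+z. ennreal (indicator Q z * (cmod (deriv G z))\<^sup>2 * q (G z)) \<partial>lborel)"
      using AB(2)[of i] q0 by (intro nn_integral_mono ennreal_leI) (auto simp: indicator_def)
    then show "(\<integral>\<^sup>+z. ennreal (indicator (A i) z * (cmod (deriv G z))\<^sup>2 * q (G z)) \<partial>lborel) < \<infinity>"
      using fin by (rule le_less_trans)
  qed (use q0 in auto)
  have "(\<integral>\<^sup>+z. ennreal (indicator Q z * (cmod (deriv G z))\<^sup>2 * q (G z)) \<partial>lborel)
    = (\<integral>\<^sup>+z. ennreal ((cmod (H' z))\<^sup>2 * q (H z)) * indicator (\<Union>i. A i) z \<partial>lborel)"
    unfolding UA using U(2)
    by (intro nn_integral_cong) (auto simp: indicator_def D_def H_def H'_def)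
  also have "\<dots> = (\<Sum>i. \<integral>\<^sup>+z. ennreal ((cmod (H' z))\<^sup>2 * q (H z)) * indicator (A i) z \<partial>lborel)"
    by (intro nn_integral_disjoint_family disj) auto
  also have "\<dots> = (\<Sum>i. \<integral>\<^sup>+w. ennreal (indicator (G ` A i) w * q w) \<partial>lborel)"
    unfolding piece[symmetric] GH[OF AB(2)]
    by (intro suminf_cong nn_integral_cong) (auto simp: indicator_def)
  also have "\<dots> = (\<integral>\<^sup>+w. (\<Sum>i. ennreal (indicator (G ` A i) w * q w)) \<partial>lborel)"
    by (intro nn_integral_suminf[symmetric]) measurable
  also have "\<dots> \<le> (\<integral>\<^sup>+w. of_nat p * ennreal (indicator T w * q w) \<partial>lborel)"
  proof (intro nn_integral_mono)
    fix w
    have part: "(\<Sum>i<n. ennreal (indicator (G ` A i) w * q w)) \<le> of_nat p * ennreal (indicator T w * q w)" for n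
    proof -
      define N where "N = {i. i < n \<and> w \<in> G ` A i}"
      have "\<forall>i\<in>N. \<exists>z. z \<in> A i \<and> G z = w" by (auto simp: N_def)
      then obtain z where z: "\<And>i. i \<in> N \<Longrightarrow> z i \<in> A i \<and> G (z i) = w" by metis
      have "inj_on z N"
      proof (rule inj_onI)
        fix i j assume ij: "i \<in> N" "j \<in> N" "z i = z j"
        then have "z i \<in> A i \<inter> A j" using z by fastforce
        then show "i = j" using disj by (auto simp: disjoint_family_on_def)
      qed
      moreover have "z ` N \<subseteq> {z\<in>Q. G z = w}" using z AB(2) by fastforce
      ultimately have "card N \<le> p" using val[of w] by (meson card_inj_on_le le_trans)
      have "(\<Sum>i<n. ennreal (indicator (G ` A i) w * q w)) = (\<Sum>i<n. if w \<in> G ` A i then ennreal (q w) else 0)"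
        by (intro sum.cong) (auto simp: indicator_def)
      also have "\<dots> = of_nat (card N) * ennreal (q w)"
        by (simp add: sum.If_cases N_def Collect_conj_eq lessThan_def)
      finally have eq: "(\<Sum>i<n. ennreal (indicator (G ` A i) w * q w)) = of_nat (card N) * ennreal (q w)" .
      show ?thesis
      proof (cases "w \<in> T")
        case True
        then show ?thesis unfolding eq using \<open>card N \<le> p\<close> by (auto intro!: mult_right_mono)
      next
        case False
        then have "N = {}" using GQ AB(2) by (auto simp: N_def)
        then show ?thesis unfolding eq by simp
      qed
    qed
    show "(\<Sum>i. ennreal (indicator (G ` A i) w * q w)) \<le> of_nat p * ennreal (indicator T w * q w)"
      by (intro suminf_le_const summableI part)
  qed
  also have "\<dots> = of_nat p * (\<integral>\<^sup>+w. ennreal (indicator T w * q w) \<partial>lborel)"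
    by (rule nn_integral_cmult) measurable
  finally show ?thesis .
qed

text \<open>The rectangle is half-open in the imaginary direction so that for c = 0 and d = 2 * pi
  the exponential is injective on it; the omitted side is a null set.\<close>

lemma nn_integral_complex_rectangle:
  fixes h :: "complex \<Rightarrow> real"
  assumes h: "continuous_on (cbox (Complex a c) (Complex b d)) h" "\<And>z. z \<in> cbox (Complex a c) (Complex b d) \<Longrightarrow> 0 \<le> h z"
    and ab: "a \<le> b" "c \<le> d"
  shows "(\<integral>\<^sup>+z. ennreal (indicator ({z. Re z \<in> {a..b} \<and> Im z \<in> {c..<d}}) z * h z) \<partial>lborel)
     = ennreal (integral {a..b} (\<lambda>x. integral {c..d} (\<lambda>y. h (Complex x y))))"
proof -
  let ?S = "{z. Re z \<in> {a..b} \<and> Im z \<in> {c..<d}}" and ?R = "cbox (Complex a c) (Complex b d)"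
  let ?I = "\<lambda>x. integral {c..d} (\<lambda>y. h (Complex x y))"
  define R where "R = ?R"
  have R: "Complex x y \<in> R \<longleftrightarrow> x \<in> {a..b} \<and> y \<in> {c..d}" for x y
    by (auto simp: R_def in_cbox_complex_iff)
  \<comment> \<open>Extension by zero, since h is only known to be continuous on the closed
    rectangle and measurability is needed globally.\<close>
  define k where "k z = (if z \<in> R then h z else 0)" for z
  have Rb: "R \<in> sets borel" by (simp add: R_def)
  have [measurable]: "k \<in> borel_measurable borel"
    unfolding k_def[abs_def] by (intro borel_measurable_continuous_on_if Rb continuous_on_const h[folded R_def])
  have [measurable]: "(\<lambda>p. Complex (fst p) (snd p)) \<in> borel_measurable borel"
    by (intro borel_measurable_continuous_onI) (auto simp: Complex_eq intro!: continuous_intros)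
  have k0: "0 \<le> k z" for z using h by (auto simp: k_def R_def)
  have [measurable]: "?S \<in> sets borel" by measurable
  have cx: "continuous_on {c..d} (\<lambda>y. h (Complex x y))" if "x \<in> {a..b}" for x
    by (rule continuous_on_compose2[OF h(1)[folded R_def]])
       (use that in \<open>auto simp: R Complex_eq intro!: continuous_intros\<close>, auto simp: R Complex_eq[symmetric])
  have c2: "continuous_on (cbox (a,c) (b,d)) (\<lambda>p. h (Complex (fst p) (snd p)))"
    by (rule continuous_on_compose2[OF h(1)[folded R_def]])
       (auto simp: R  cbox_Pair_eq Complex_eq[symmetric] intro!: continuous_intros) 
  have cint: "continuous_on {a..b} (\<lambda>x. ?I x)"
    using integral_continuous_on_param[of "{a..b}" c d "\<lambda>x y. h (Complex x y)"] c2
    by (simp add: split_beta cbox_Pair_eq)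
  have inner: "(\<integral>\<^sup>+y. ennreal (indicator ?S (Complex x y) * k (Complex x y)) \<partial>lborel)
     = ennreal (?I x) * indicator {a..b} x" for x
  proof (cases "x \<in> {a..b}")
    case True
    have "(\<integral>\<^sup>+y. ennreal (indicator ?S (Complex x y) * k (Complex x y)) \<partial>lborel)
       = (\<integral>\<^sup>+y. ennreal (indicator {c..d} y * h (Complex x y)) \<partial>lborel)"
      using AE_lborel_singleton[of d] True
      by (intro nn_integral_cong_AE) (auto simp: indicator_def k_def R elim!: eventually_mono)
    also have "\<dots> = ennreal (LINT y:{c..d}|lborel. h (Complex x y))"
      unfolding set_lebesgue_integral_def real_scaleR_def
      using borel_integrable_atLeastAtMost'[OF cx[OF True]] True
      by (intro nn_integral_eq_integral)
         (auto simp: set_integrable_def indicator_def intro!: h(2)[folded R_def] simp: R)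
    also have "(LINT y:{c..d}|lborel. h (Complex x y)) = ?I x"
      by (intro set_borel_integral_eq_integral borel_integrable_atLeastAtMost' cx True)
    finally show ?thesis using True by simp
  next
    case False
    then have "indicator ?S (Complex x y) = (0::real)" for y
      by (auto simp: indicator_def)
    then show ?thesis using False by simp
  qed
  have nonneg: "0 \<le> ?I x" if "x \<in> {a..b}" for x
    using that by (intro integral_nonneg integrable_continuous_interval cx) (auto intro!: h(2)[folded R_def] simp: R)
  have "(\<integral>\<^sup>+z. ennreal (indicator ?S z * h z) \<partial>lborel)
      = (\<integral>\<^sup>+z. ennreal (indicator ?S z * k z) \<partial>lborel)"
  proof (intro nn_integral_cong)
    fix z :: complex
    show "ennreal (indicator ?S z * h z) = ennreal (indicator ?S z * k z)"
      using R[of "Re z" "Im z"] by (auto simp: k_def indicator_def)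
  qed
  also have "\<dots> = (\<integral>\<^sup>+p. ennreal (indicator ?S (Complex (fst p) (snd p)) * k (Complex (fst p) (snd p))) \<partial>lborel)"
    by (subst lborel_complex_of_pair, subst nn_integral_distr) (auto simp: split_beta)
  also have "\<dots> = (\<integral>\<^sup>+x. \<integral>\<^sup>+y. ennreal (indicator ?S (Complex x y) * k (Complex x y)) \<partial>lborel \<partial>lborel)"
    unfolding lborel_prod[symmetric] by (subst lborel.nn_integral_fst[symmetric]) (auto simp: lborel_prod)
  also have "\<dots> = (\<integral>\<^sup>+x. ennreal (indicator {a..b} x * ?I x) \<partial>lborel)"
    unfolding inner by (intro nn_integral_cong) (auto simp: indicator_def)
  also have "\<dots> = ennreal (LINT x:{a..b}|lborel. ?I x)"
    unfolding set_lebesgue_integral_def real_scaleR_def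
    using borel_integrable_atLeastAtMost'[OF cint] nonneg
    by (intro nn_integral_eq_integral) (auto simp: set_integrable_def indicator_def)
  also have "(LINT x:{a..b}|lborel. ?I x) = integral {a..b} (\<lambda>x. ?I x)"
    by (intro set_borel_integral_eq_integral borel_integrable_atLeastAtMost' cint)
  finally show ?thesis .
qed

section \<open>Polar coordinates and weighted area under a valence bound\<close>

lemma image_exp_strip:
  "exp ` {w. Re w \<in> {x1..x2} \<and> Im w \<in> {0..<2*pi}} = {c. exp x1 \<le> cmod c \<and> cmod c \<le> exp x2}"
proof (intro equalityI subsetI)
  fix c :: complex assume "c \<in> {c. exp x1 \<le> cmod c \<and> cmod c \<le> exp x2}"
  then have c: "exp x1 \<le> cmod c" "cmod c \<le> exp x2" by auto
  have c0: "cmod c > 0" using c(1) exp_gt_zero less_le_trans by blast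
  have "exp (Complex (ln (cmod c)) (Arg2pi c)) = of_real (exp (ln (cmod c))) * exp (\<i> * of_real (Arg2pi c))"
    by (simp only: Complex_eq exp_add exp_of_real)
  then have "c = exp (Complex (ln (cmod c)) (Arg2pi c))"
    using c0 Arg2pi_eq[of c] by simp
  moreover have "Arg2pi c \<in> {0..<2*pi}" using Arg2pi[of c] by auto
  moreover have "ln (cmod c) \<in> {x1..x2}" using c c0 ln_le_cancel_iff[of "cmod c" "exp x2"] by (simp add: ln_ge_iff)
  ultimately show "c \<in> exp ` {w. Re w \<in> {x1..x2} \<and> Im w \<in> {0..<2*pi}}"
    by (intro image_eqI[of _ _ "Complex (ln (cmod c)) (Arg2pi c)"]) auto
qed auto

lemma inj_on_exp_strip: "inj_on exp {w. Re w \<in> A \<and> Im w \<in> {0..<2*pi}}"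
proof (rule inj_onI)
  fix v w :: complex assume v: "v \<in> {w. Re w \<in> A \<and> Im w \<in> {0..<2*pi}}" and w: "w \<in> {w. Re w \<in> A \<and> Im w \<in> {0..<2*pi}}"
    and "exp v = exp w"
  then obtain n :: int where n: "v = w + of_int (2*n) * pi * \<i>" by (auto simp: exp_eq)
  then have "Im v = Im w + 2 * of_int n * pi" by simp
  then have "2*pi * \<bar>of_int n\<bar> = \<bar>Im v - Im w\<bar>" by (simp add: abs_mult)
  also have "\<dots> < 2*pi * 1" using v w by auto
  finally have "\<bar>real_of_int n\<bar> < 1" using mult_less_cancel_left_pos[of "2*pi" "\<bar>of_int n\<bar>" 1] pi_gt_zero by simp
  then have "n = 0" by linarith
  with n show "v = w" by simp
qed

text \<open>Valence is known for \<open>exp \<circ> \<phi>\<close> and not for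
  \<open>\<phi>\<close>, so the area is measured after a further exponential. It then lies over an
  annulus that \<open>exp\<close> parametrizes by a strip of height 2 * pi, which is where the
  factor 2 * pi comes from.\<close>

lemma area_le_valence:
  fixes \<phi> :: "complex \<Rightarrow> complex" and k :: "real \<Rightarrow> real"
  assumes holo: "\<phi> holomorphic_on ball 0 1"
    and val: "\<And>c. finite {z\<in>ball 0 1. exp (\<phi> z) = c} \<and> card {z\<in>ball 0 1. exp (\<phi> z) = c} \<le> p"
    and k: "continuous_on UNIV k" "\<And>x. 0 \<le> k x"
    and ab: "a \<le> b" "b < 0"
    and x12: "x1 \<le> x2" "\<And>\<zeta>. Re \<zeta> \<in> {a..b} \<Longrightarrow> Re (\<phi> (exp \<zeta>)) \<in> {x1..x2}"
  shows "integral {a..b} (\<lambda>\<rho>. integral {0..2*pi} (\<lambda>\<theta>. k (Re (\<phi> (exp (Complex \<rho> \<theta>)))) *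
           (cmod (deriv (\<lambda>\<zeta>. \<phi> (exp \<zeta>)) (Complex \<rho> \<theta>)))\<^sup>2)) \<le> 2 * pi * p * integral {x1..x2} k"
proof -
  define \<psi> where "\<psi> = (\<lambda>\<zeta>. \<phi> (exp \<zeta>))"
  define U where "U = {\<zeta>::complex. Re \<zeta> < 0}"
  have U: "open U" by (simp add: U_def open_halfspace_Re_lt)
  have \<psi>h: "\<psi> holomorphic_on U"
    unfolding \<psi>_def by (rule holomorphic_on_compose_gen[OF _ holo, unfolded o_def]) (auto simp: U_def intro!: holomorphic_intros)
  define G where "G \<zeta> = exp (\<psi> \<zeta>)" for \<zeta>
  have Gh: "G holomorphic_on U" unfolding G_def by (intro holomorphic_intros \<psi>h)
  have dG: "deriv G \<zeta> = exp (\<psi> \<zeta>) * deriv \<psi> \<zeta>" if "\<zeta> \<in> U" for \<zeta>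
    unfolding G_def
    by (rule DERIV_imp_deriv) (use holomorphic_derivI[OF \<psi>h U that] in \<open>auto intro!: derivative_eq_intros\<close>)
  define Q where "Q = {z::complex. Re z \<in> {a..b} \<and> Im z \<in> {0..<2*pi}}"
  define S where "S = {z::complex. Re z \<in> {x1..x2} \<and> Im z \<in> {0..<2*pi}}"
  have QU: "Q \<subseteq> U" using ab by (auto simp: Q_def U_def)
  have [measurable]: "Q \<in> sets borel" "S \<in> sets borel" unfolding Q_def S_def by measurable
  \<comment> \<open>The density whose pullback under \<open>exp\<close> is \<open>k (Re w)\<close>:
    the Jacobian of \<open>exp\<close> at w is the square of \<open>cmod (exp w)\<close>.\<close>
  define q where "q c = k (ln (cmod c)) / (cmod c)\<^sup>2" for c
  have [measurable]: "k \<in> borel_measurable borel" using k(1) by (rule borel_measurable_continuous_onI)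
  have [measurable]: "q \<in> borel_measurable borel" unfolding q_def by measurable
  have q0: "0 \<le> q c" for c using k by (simp add: q_def)
  define h where "h \<zeta> = k (Re (\<psi> \<zeta>)) * (cmod (deriv \<psi> \<zeta>))\<^sup>2" for \<zeta>
  have hG: "(cmod (deriv G \<zeta>))\<^sup>2 * q (G \<zeta>) = h \<zeta>" if "\<zeta> \<in> U" for \<zeta>
    using dG[OF that] by (simp add: G_def q_def h_def norm_mult power_mult_distrib)
  have rect: "(\<integral>\<^sup>+z. ennreal (indicator Q z * h z) \<partial>lborel) =
      ennreal (integral {a..b} (\<lambda>x. integral {0..2*pi} (\<lambda>y. h (Complex x y))))"
    unfolding Q_def
  proof (rule nn_integral_complex_rectangle)
    have sub: "cbox (Complex a 0) (Complex b (2 * pi)) \<subseteq> U" using ab by (auto simp: U_def in_cbox_complex_iff)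
    have c\<psi>: "continuous_on (cbox (Complex a 0) (Complex b (2 * pi))) \<psi>" "continuous_on (cbox (Complex a 0) (Complex b (2 * pi))) (deriv \<psi>)"
      using \<psi>h holomorphic_deriv[OF \<psi>h U] sub by (meson continuous_on_subset holomorphic_on_imp_continuous_on)+
    show "continuous_on (cbox (Complex a 0) (Complex b (2 * pi))) h"
      unfolding h_def
      by (intro continuous_intros continuous_on_compose2[OF k(1)] c\<psi>) auto
  qed (use ab k in \<open>auto simp: h_def\<close>)
  have eq: "(\<integral>\<^sup>+z. ennreal (indicator Q z * (cmod (deriv G z))\<^sup>2 * q (G z)) \<partial>lborel)
     = (\<integral>\<^sup>+z. ennreal (indicator Q z * h z) \<partial>lborel)"
    using hG QU by (intro nn_integral_cong) (auto simp: indicator_def mult.assoc)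
  define T where "T = {c::complex. exp x1 \<le> cmod c \<and> cmod c \<le> exp x2}"
  have TS: "T = exp ` S" unfolding T_def S_def image_exp_strip ..
  have [measurable]: "T \<in> sets borel" unfolding T_def by measurable
  have "(\<integral>\<^sup>+z. ennreal (indicator Q z * (cmod (deriv G z))\<^sup>2 * q (G z)) \<partial>lborel)
     \<le> of_nat p * (\<integral>\<^sup>+w. ennreal (indicator T w * q w) \<partial>lborel)"
  proof (rule nn_integral_valence_le[OF Gh U QU])
    fix c
    \<comment> \<open>Q has height 2 * pi, so \<open>exp\<close> maps the solutions in Q injectively
      to solutions in the disc and the bound p carries over.\<close>
    have "exp ` {z\<in>Q. G z = c} \<subseteq> {z\<in>ball 0 1. exp (\<phi> z) = c}"
      using ab by (auto simp: Q_def G_def \<psi>_def)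
    moreover have "inj_on exp {z\<in>Q. G z = c}"
      using inj_on_exp_strip[of "{a..b}"] by (rule inj_on_subset) (auto simp: Q_def)
    ultimately show "finite {z\<in>Q. G z = c} \<and> card {z\<in>Q. G z = c} \<le> p"
      using val[of c] by (meson card_inj_on_le finite_imageD finite_subset le_trans)
  next
    show "G ` Q \<subseteq> T" using x12(2) by (auto simp: Q_def T_def G_def \<psi>_def)
    show "(\<integral>\<^sup>+z. ennreal (indicator Q z * (cmod (deriv G z))\<^sup>2 * q (G z)) \<partial>lborel) < \<infinity>"
      unfolding eq rect by simp
  qed (use q0 in auto)
  also have "(\<integral>\<^sup>+w. ennreal (indicator T w * q w) \<partial>lborel) = ennreal (2 * pi * integral {x1..x2} k)"
  proof -
    have e: "indicator S w * (cmod (exp w))\<^sup>2 * q (exp w) = indicator S w * k (Re w)" for w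
      by (simp add: q_def)
    have r: "(\<integral>\<^sup>+w. ennreal (indicator S w * k (Re w)) \<partial>lborel) = ennreal (integral {x1..x2} (\<lambda>x. integral {0..2*pi} (\<lambda>y. k x)))"
      unfolding S_def
      by (subst nn_integral_complex_rectangle)
         (use x12 k in \<open>auto intro!: continuous_on_compose2[OF k(1)] continuous_intros\<close>)
    have "(\<integral>\<^sup>+z. ennreal (indicator S z * (cmod (exp z))\<^sup>2 * q (exp z)) \<partial>lborel) = (\<integral>\<^sup>+w. ennreal (indicator (exp ` S) w * q w) \<partial>lborel)"
    proof (rule nn_integral_change_of_variables_complex)
      show "exp ` S \<in> sets borel" by (simp flip: TS)
      show "(\<lambda>z. indicat_real S z * (cmod (exp z))\<^sup>2 * q (exp z)) \<in> borel_measurable borel"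
        unfolding e by measurable
      show "inj_on exp S" unfolding S_def by (rule inj_on_exp_strip)
      show "(\<integral>\<^sup>+z. ennreal (indicat_real S z * (cmod (exp z))\<^sup>2 * q (exp z)) \<partial>lborel) < \<infinity>"
        unfolding e r by simp
    qed (use q0 in \<open>auto intro: DERIV_exp\<close>)
    then show ?thesis unfolding e r by (simp add: TS)
  qed
  also have "of_nat p * ennreal (2 * pi * integral {x1..x2} k) = ennreal (2 * pi * p * integral {x1..x2} k)"
    by (simp add: ennreal_mult[symmetric] ennreal_of_nat_eq_real_of_nat ennreal_mult' mult_ac)
  finally show ?thesis
    unfolding eq rect using k integrable_continuous_interval[OF continuous_on_subset[OF k(1)], of x1 x2]
    by (subst (asm) ennreal_le_iff) (auto simp: h_def \<psi>_def intro!: mult_nonneg_nonneg integral_nonneg)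
qed

section \<open>The logarithm of a zero-free p-valent function\<close>

lemma exists_primitive_continuous:
  fixes f :: "real \<Rightarrow> real"
  assumes "continuous_on UNIV f"
  shows "\<exists>\<Phi>. \<forall>x. (\<Phi> has_real_derivative f x) (at x)"
proof -
  have int: "f integrable_on {a..b}" for a b
    using assms continuous_on_subset by (intro integrable_continuous_interval) blast
  \<comment> \<open>For x other than 0 one of the two intervals is empty and contributes 0; the
    difference is the oriented integral from 0 to x.\<close>
  define \<Phi> where "\<Phi> x = integral {0..x} f - integral {x..0} f" for x
  have "(\<Phi> has_real_derivative f x) (at x)" for x
  proof -
    define L where "L = min x 0 - 1"
    have eq: "\<Phi> y = integral {L..y} f - integral {L..0} f" if "y \<ge> L" for y
    proof (cases "y \<ge> 0")
      case True
      have "integral {L..0} f + integral {0..y} f = integral {L..y} f"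
        using True by (intro Henstock_Kurzweil_Integration.integral_combine int) (auto simp: L_def)
      moreover have "integral {y..0} f = 0" using True by (cases "y = 0") auto
      ultimately show ?thesis by (simp add: \<Phi>_def)
    next
      case False
      have "integral {L..y} f + integral {y..0} f = integral {L..0} f"
        using False that by (intro Henstock_Kurzweil_Integration.integral_combine int) auto
      then show ?thesis using False by (simp add: \<Phi>_def)
    qed
    have "((\<lambda>y. integral {L..y} f) has_real_derivative f x) (at x within {L..x+1})"
      using assms continuous_on_subset
      by (intro integral_has_real_derivative) (auto simp: L_def)
    then have "((\<lambda>y. integral {L..y} f) has_real_derivative f x) (at x)"
      by (subst (asm) at_within_interior) (auto simp: L_def)
    then have "((\<lambda>y. integral {L..y} f - integral {L..0} f) has_real_derivative f x) (at x)"
      by (auto intro!: derivative_eq_intros)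
    then show ?thesis
      by (rule has_field_derivative_transform_within_open[of _ _ _ "{L<..}"]) (auto simp: eq L_def)
  qed
  then show ?thesis by blast
qed

text \<open>The Cauchy-Riemann equations: moving vertically multiplies the complex derivative by the
  imaginary unit.\<close>

lemma
  assumes "f holomorphic_on U" "open U" "Complex r t \<in> U"
  shows DERIV_Re_vertical: "((\<lambda>t. Re (f (Complex r t))) has_real_derivative - Im (deriv f (Complex r t))) (at t)"
    and DERIV_Im_vertical: "((\<lambda>t. Im (f (Complex r t))) has_real_derivative Re (deriv f (Complex r t))) (at t)"
    and DERIV_Re_horizontal: "((\<lambda>r. Re (f (Complex r t))) has_real_derivative Re (deriv f (Complex r t))) (at r)"
proof -
  have f: "(f has_derivative (\<lambda>h. deriv f (Complex r t) * h)) (at (Complex r t))"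
    using holomorphic_derivI[OF assms] by (simp add: has_field_derivative_def)
  have v: "((\<lambda>t. Complex r t) has_derivative (\<lambda>h. Complex 0 h)) (at t)"
    unfolding Complex_eq by (auto intro!: derivative_eq_intros)
  have h: "((\<lambda>r. Complex r t) has_derivative (\<lambda>h. Complex h 0)) (at r)"
    unfolding Complex_eq by (auto intro!: derivative_eq_intros)
  have fv: "((\<lambda>t. f (Complex r t)) has_derivative (\<lambda>h. deriv f (Complex r t) * Complex 0 h)) (at t)"
    using has_derivative_compose[OF v f] by simp
  have fh: "((\<lambda>r. f (Complex r t)) has_derivative (\<lambda>h. deriv f (Complex r t) * Complex h 0)) (at r)"
    using has_derivative_compose[OF h f] by simp
  show "((\<lambda>t. Re (f (Complex r t))) has_real_derivative - Im (deriv f (Complex r t))) (at t)"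
    unfolding has_field_derivative_def
    by (rule has_derivative_eq_rhs[OF bounded_linear.has_derivative[OF bounded_linear_Re fv]]) (auto simp: fun_eq_iff)
  show "((\<lambda>t. Im (f (Complex r t))) has_real_derivative Re (deriv f (Complex r t))) (at t)"
    unfolding has_field_derivative_def
    by (rule has_derivative_eq_rhs[OF bounded_linear.has_derivative[OF bounded_linear_Im fv]]) (auto simp: fun_eq_iff)
  show "((\<lambda>r. Re (f (Complex r t))) has_real_derivative Re (deriv f (Complex r t))) (at r)"
    unfolding has_field_derivative_def
    by (rule has_derivative_eq_rhs[OF bounded_linear.has_derivative[OF bounded_linear_Re fh]]) (auto simp: fun_eq_iff)
qed

locale valent_log =
  fixes \<phi> :: "complex \<Rightarrow> complex" and p :: nat and a :: real
  assumes holo: "\<phi> holomorphic_on ball 0 1"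
    and val: "finite {z\<in>ball 0 1. exp (\<phi> z) = c} \<and> card {z\<in>ball 0 1. exp (\<phi> z) = c} \<le> p"
    and zero: "\<phi> 0 = 0" and deriv_zero: "deriv \<phi> 0 = of_real a" and a_pos: "0 < a"
begin

text \<open>Logarithmic coordinates on the punctured disc. Circles about 0 become vertical lines of
  period 2 * pi, and the Laplacian in r and t has constant coefficients.\<close>

definition \<psi> :: "complex \<Rightarrow> complex" where "\<psi> = (\<lambda>\<zeta>. \<phi> (exp \<zeta>))"
definition H :: "complex set" where "H = {\<zeta>. Re \<zeta> < 0}"
definition X :: "real \<Rightarrow> real \<Rightarrow> real" where "X r t = Re (\<psi> (Complex r t))"
definition X' :: "real \<Rightarrow> real \<Rightarrow> real" where "X' r t = Re (deriv \<psi> (Complex r t))"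
definition X'' :: "real \<Rightarrow> real \<Rightarrow> real" where "X'' r t = Re (deriv (deriv \<psi>) (Complex r t))"

lemma open_H: "open H" by (simp add: H_def open_halfspace_Re_lt)

lemma \<psi>_holo: "\<psi> holomorphic_on H"
  unfolding \<psi>_def by (rule holomorphic_on_compose_gen[OF _ holo, unfolded o_def]) (auto simp: H_def intro!: holomorphic_intros)

lemmas \<psi>'_holo = holomorphic_deriv[OF \<psi>_holo open_H]
lemmas \<psi>''_holo = holomorphic_deriv[OF \<psi>'_holo open_H]

lemma in_H [simp]: "Complex r t \<in> H \<longleftrightarrow> r < 0" by (simp add: H_def)

lemma \<psi>_eq: "deriv \<psi> \<zeta> = exp \<zeta> * deriv \<phi> (exp \<zeta>)" if "\<zeta> \<in> H" for \<zeta>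
  unfolding \<psi>_def
proof (rule DERIV_imp_deriv)
  have "(\<phi> has_field_derivative deriv \<phi> (exp \<zeta>)) (at (exp \<zeta>))"
    using that by (intro holomorphic_derivI[OF holo]) (auto simp: H_def)
  then show "((\<lambda>\<zeta>. \<phi> (exp \<zeta>)) has_field_derivative exp \<zeta> * deriv \<phi> (exp \<zeta>)) (at \<zeta>)"
    using DERIV_chain2[OF _ DERIV_exp, of \<phi> "deriv \<phi> (exp \<zeta>)" \<zeta>] by (simp only: mult.commute)
qed

lemma cont_line:
  assumes "f holomorphic_on H" "r < 0"
  shows "continuous_on S (\<lambda>t. f (Complex r t))"
  by (rule continuous_on_compose2[OF holomorphic_on_imp_continuous_on[OF assms(1)]])
     (use assms(2) in \<open>auto simp: Complex_eq[symmetric] H_def intro!: continuous_intros\<close>)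

lemma cont_pair:
  assumes "f holomorphic_on H" "S \<subseteq> {..<0}"
  shows "continuous_on (S \<times> T) (\<lambda>x. f (Complex (fst x) (snd x)))"
  by (rule continuous_on_compose2[OF holomorphic_on_imp_continuous_on[OF assms(1)]])
     (use assms(2) in \<open>auto simp: Complex_eq[symmetric] H_def intro!: continuous_intros\<close>)

lemma X_cont [continuous_intros]: "r < 0 \<Longrightarrow> continuous_on S (X r)" "r < 0 \<Longrightarrow> continuous_on S (X' r)" "r < 0 \<Longrightarrow> continuous_on S (X'' r)"
  unfolding X_def[abs_def] X'_def[abs_def] X''_def[abs_def]
  by (intro continuous_intros cont_line \<psi>_holo \<psi>'_holo \<psi>''_holo; simp)+

lemma periodic_f: "\<psi> (\<zeta> + 2 * pi * \<i>) = \<psi> \<zeta>"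
  by (simp add: \<psi>_def exp_add exp_two_pi_i' mult.commute mult.left_commute)

lemma deriv_periodic:
  assumes "f holomorphic_on H" "\<And>\<zeta>. \<zeta> \<in> H \<Longrightarrow> f (\<zeta> + 2 * pi * \<i>) = f \<zeta>" "\<zeta> \<in> H"
  shows "deriv f (\<zeta> + 2 * pi * \<i>) = deriv f \<zeta>"
proof -
  have "\<zeta> + 2 * pi * \<i> \<in> H" using assms(3) by (simp add: H_def)
  then have "(f has_field_derivative deriv f (\<zeta> + 2 * pi * \<i>)) (at (\<zeta> + 2 * pi * \<i>))"
    by (rule holomorphic_derivI[OF assms(1) open_H])
  then have "((\<lambda>\<zeta>. f (\<zeta> + 2 * pi * \<i>)) has_field_derivative deriv f (\<zeta> + 2 * pi * \<i>)) (at \<zeta>)"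
    by (simp add: DERIV_shift)
  then have "(f has_field_derivative deriv f (\<zeta> + 2 * pi * \<i>)) (at \<zeta>)"
    by (rule has_field_derivative_transform_within_open[OF _ open_H assms(3)]) (use assms(2) in auto)
  then show ?thesis using DERIV_imp_deriv by metis
qed

lemma \<psi>'_periodic: "\<zeta> \<in> H \<Longrightarrow> deriv \<psi> (\<zeta> + 2 * pi * \<i>) = deriv \<psi> \<zeta>"
  by (rule deriv_periodic[OF \<psi>_holo]) (use periodic_f in auto)

lemma Complex_shift: "Complex r (t + 2 * pi) = Complex r t + 2 * pi * \<i>"
  by (simp add: complex_eq_iff)

text \<open>Otherwise \<open>Re (\<phi> z)\<close> would be constant on a circle, hence by the
  maximum modulus principle on the disc inside it, contradicting the nonzero derivative at
  0.\<close>

lemma X_nonconstant: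
  assumes "r < 0" shows "\<not> (\<forall>t. X r t = c)"
proof
  assume X: "\<forall>t. X r t = c"
  define s where "s = exp r"
  have s: "0 < s" "s < 1" using assms by (auto simp: s_def)
  have sub: "cball 0 s \<subseteq> ball (0::complex) 1" using s by auto
  have bd: "Re (\<phi> z) = c" if "z \<in> sphere 0 s" for z
  proof -
    have "z = exp (Complex r (Arg2pi z))"
      using Arg2pi_eq[of z] that by (simp add: Complex_eq exp_add exp_of_real s_def)
    then show ?thesis using X[rule_format, of "Arg2pi z"] by (simp add: X_def \<psi>_def)
  qed
  \<comment> \<open>The sign e = 1 bounds the real part from above and e = -1 from below.\<close>
  have bound: "norm (exp (e * \<phi> z)) \<le> exp (Re (e * of_real c))" if z: "z \<in> cball 0 s" and e: "e = 1 \<or> e = -1" for z e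
  proof (rule maximum_modulus_frontier[where S="cball 0 s" and f="\<lambda>z. exp (e * \<phi> z)"])
    show "(\<lambda>z. exp (e * \<phi> z)) holomorphic_on interior (cball 0 s)"
      by (intro holomorphic_intros holomorphic_on_subset[OF holo]) (use s in auto)
    show "continuous_on (closure (cball 0 s)) (\<lambda>z. exp (e * \<phi> z))"
      by (intro holomorphic_on_imp_continuous_on holomorphic_intros holomorphic_on_subset[OF holo]) (use sub in auto)
    show "norm (exp (e * \<phi> z)) \<le> exp (Re (e * of_real c))" if "z \<in> frontier (cball 0 s)" for z
      using bd[of z] that e s by auto
  qed (use z in auto)
  have const: "Re (\<phi> z) = c" if "z \<in> cball 0 s" for z
    using bound[OF that, of 1] bound[OF that, of "-1"] by auto
  have "((\<lambda>t. Re (\<phi> (Complex t 0))) has_real_derivative Re (deriv \<phi> (Complex 0 0))) (at 0)"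
    by (rule DERIV_Re_horizontal[OF holo]) (auto simp: Complex_eq)
  moreover have "((\<lambda>t. Re (\<phi> (Complex t 0))) has_real_derivative 0) (at 0)"
  proof (rule has_field_derivative_transform_within_open[of "\<lambda>_. c" _ _ "ball 0 s"])
    show "c = Re (\<phi> (Complex t 0))" if "t \<in> ball 0 s" for t
      using that by (subst const) (auto simp: Complex_eq)
  qed (use s in auto)
  ultimately have "Re (deriv \<phi> 0) = 0"
    using DERIV_unique by (metis Complex_eq_0)
  then show False using deriv_zero a_pos by simp
qed

text \<open>\<open>X r\<close> is real analytic. Adding to f its reflection
  \<open>cnj \<circ> f \<circ> cnj\<close> gives a holomorphic function that equals
  \<open>2 * (X r t - x)\<close> at real t. It is not constant, so its zeros are countable.\<close>

lemma X_null_levels: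
  assumes "r < 0" shows "measure circ {t. X r t = x} = 0"
proof -
  \<comment> \<open>The condition \<open>r < Im \<zeta>\<close> keeps
    \<open>of_real r + \<i> * \<zeta>\<close> in the left half-plane; the other one makes S
    invariant under conjugation.\<close>
  define S where "S = {\<zeta>::complex. r < Im \<zeta> \<and> Im \<zeta> < - r}"
  have S: "open S" "convex S"
  proof -
    have e: "S = {\<zeta>. r < Im \<zeta>} \<inter> {\<zeta>. Im \<zeta> < - r}" by (auto simp: S_def)
    show "open S" unfolding e by (intro open_Int open_halfspace_Im_gt open_halfspace_Im_lt)
    show "convex S" unfolding e by (intro convex_Int convex_halfspace_Im_gt convex_halfspace_Im_lt)
  qed
  define f where "f \<zeta> = \<psi> (of_real r + \<i> * \<zeta>)" for \<zeta>
  have fh: "f holomorphic_on S"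
    unfolding f_def by (rule holomorphic_on_compose_gen[OF _ \<psi>_holo, unfolded o_def])
      (auto simp: S_def H_def intro!: holomorphic_intros)
  have cS: "cnj ` S = S"
  proof (intro equalityI subsetI)
    fix z assume "z \<in> S"
    then show "z \<in> cnj ` S" by (intro image_eqI[of _ _ "cnj z"]) (auto simp: S_def)
  qed (auto simp: S_def)
  define g where "g \<zeta> = f \<zeta> + (cnj \<circ> f \<circ> cnj) \<zeta> - of_real (2 * x)" for \<zeta>
  have gh: "g holomorphic_on S"
    unfolding g_def by (intro holomorphic_intros fh holomorphic_on_compose_cnj_cnj S) (use fh cS in auto)
  have greal: "g (of_real t) = of_real (2 * (X r t - x))" for t
    by (simp add: g_def f_def X_def complex_eq_iff Complex_eq)
  have "\<not> g constant_on S"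
  proof
    assume "g constant_on S"
    then obtain k where k: "\<And>\<zeta>. \<zeta> \<in> S \<Longrightarrow> g \<zeta> = k" by (auto simp: constant_on_def)
    have "of_real (2 * (X r t - x)) = k" for t
      using k[of "of_real t"] greal[of t] assms by (auto simp: S_def)
    then have "2 * (X r t - x) = 2 * (X r 0 - x)" for t by (metis of_real_eq_iff)
    then have "\<forall>t. X r t = X r 0" by simp
    then show False using X_nonconstant[OF assms] by blast
  qed
  moreover obtain K where K: "\<And>n. compact (K n)" "\<And>n. K n \<subseteq> S" "\<And>n. K n \<subseteq> interior (K (Suc n))"
      "\<Union>(range K) = S" "\<And>C. compact C \<Longrightarrow> C \<subseteq> S \<Longrightarrow> \<exists>N. \<forall>n\<ge>N. C \<subseteq> K n"
    by (rule open_Union_compact_subsets[OF S(1)]) (rule that)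
  have "fsigma S" unfolding fsigma_Union_compact by (intro exI[of _ K]) (use K(1,4) in auto)
  ultimately have cnt: "countable {\<zeta>\<in>S. g \<zeta> = 0}"
    using S gh by (intro holomorphic_countable_zeros convex_connected)
  have "of_real ` {t. X r t = x} \<subseteq> {\<zeta>\<in>S. g \<zeta> = 0}"
    using greal assms by (auto simp: S_def)
  then have "countable (complex_of_real ` {t. X r t = x})" using cnt countable_subset by blast
  then have c: "countable {t. X r t = x}"
    by (rule countable_image_inj_on) (auto simp: inj_on_def)
  then have "emeasure lborel {t. X r t = x} = 0" by (rule emeasure_lborel_countable)
  moreover have "{t. X r t = x} \<in> sets borel" using c by (rule sets.countable[rotated]) auto
  ultimately have "emeasure lborel ({0..2*pi} \<inter> {t. X r t = x}) = 0"
    by (metis emeasure_mono inf.cobounded2 le_zero_eq sets_lborel)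
  then show ?thesis
    using \<open>{t. X r t = x} \<in> sets borel\<close> by (simp add: circ_def measure_def)
qed

text \<open>Harmonicity enters here: the second derivative in the angle is minus the second
  derivative in r.\<close>

lemma smooth_profile_X:
  assumes "r < 0"
  shows "smooth_profile (X r) (\<lambda>t. - Im (deriv \<psi> (Complex r t))) (\<lambda>t. - X'' r t)"
proof (unfold_locales)
  show "continuous_on UNIV (X r)" using assms by (rule X_cont)
  show "X r (t + 2*pi) = X r t" for t
    unfolding X_def Complex_shift periodic_f ..
  show "measure circ {t. X r t = x} = 0" for x by (rule X_null_levels[OF assms])
  show "(X r has_real_derivative - Im (deriv \<psi> (Complex r t))) (at t)" for t
    unfolding X_def[abs_def] by (rule DERIV_Re_vertical[OF \<psi>_holo open_H]) (use assms in simp)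
  show "((\<lambda>t. - Im (deriv \<psi> (Complex r t))) has_real_derivative - X'' r t) (at t)" for t
    unfolding X''_def by (intro DERIV_minus DERIV_Im_vertical[OF \<psi>'_holo open_H]) (use assms in simp)
  show "continuous_on UNIV (\<lambda>t. - X'' r t)" using assms by (intro continuous_intros)
  show "- Im (deriv \<psi> (Complex r (t + 2*pi))) = - Im (deriv \<psi> (Complex r t))" for t
    unfolding Complex_shift using \<psi>'_periodic[of "Complex r t"] assms by simp
qed

end

section \<open>Growth of the maximal pairing\<close>

lemma not_local_max_if_second_deriv_pos:
  fixes f :: "real \<Rightarrow> real"
  assumes d1: "\<And>s. s \<in> {l<..<u} \<Longrightarrow> (f has_real_derivative f' s) (at s)" and d2: "(f' has_real_derivative D) (at s0)"
    and s0: "s0 \<in> {l<..<u}" and D: "D > 0" and max: "\<And>s. s \<in> {l<..<u} \<Longrightarrow> f s \<le> f s0"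
  shows False
proof -
  define e where "e = min (s0 - l) (u - s0)"
  have e: "e > 0" using s0 by (auto simp: e_def)
  have "f' s0 = 0"
    by (rule DERIV_local_max[OF d1[OF s0] e]) (auto intro!: max simp: e_def)
  moreover obtain d where d: "d > 0" "\<And>h. 0 < h \<Longrightarrow> h < d \<Longrightarrow> f' s0 < f' (s0 + h)"
    using DERIV_pos_inc_right[OF d2 D] by blast
  ultimately have pos: "f' x > 0" if "s0 < x" "x < s0 + d" for x
    using d(2)[of "x - s0"] that by simp
  define h where "h = min d e / 2"
  have h: "0 < h" "h < d" "h < e" using d(1) e by (auto simp: h_def min_def)
  have "f s0 < f (s0 + h)"
  proof (rule DERIV_pos_imp_increasing_open[of s0 "s0 + h" f])
    show "\<exists>y. (f has_real_derivative y) (at x) \<and> 0 < y" if "s0 < x" "x < s0 + h" for x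
      using d1[of x] pos[of x] that h s0 by (intro exI[of _ "f' x"]) (auto simp: e_def)
    show "continuous_on {s0..s0 + h} f"
      using h s0 by (intro continuous_at_imp_continuous_on ballI DERIV_isCont[OF d1]) (auto simp: e_def)
  qed (use h in auto)
  moreover have "s0 + h \<in> {l<..<u}" using h s0 by (auto simp: e_def)
  ultimately show False using max[of "s0 + h"] by simp
qed

context valent_log
begin

text \<open>The rank increases with \<open>X r\<close> while the cosine decreases on {0..pi}; the
  minus sign makes \<open>F r\<close> increase with \<open>X r\<close>.\<close>

definition F :: "real \<Rightarrow> real \<Rightarrow> real" where "F r t = - cos (profile.rank (X r) t)"
definition A :: "real \<Rightarrow> real" where "A r = (\<integral>t. X r t * F r t \<partial>circ)"

lemma profile_X: "r < 0 \<Longrightarrow> profile (X r)"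
  using smooth_profile_X smooth_profile.axioms(1) by blast

lemma F_cont: "r < 0 \<Longrightarrow> continuous_on S (F r)"
  unfolding F_def[abs_def]
  by (intro continuous_intros continuous_on_subset[OF profile.rank_cont[OF profile_X]]) auto

lemma F_bound: "\<bar>F r t\<bar> \<le> 1" by (simp add: F_def)

lemma pairing_le_A: "r < 0 \<Longrightarrow> s < 0 \<Longrightarrow> (\<integral>t. X s t * F r t \<partial>circ) \<le> A s"
  using profile.hardy_littlewood[OF profile_X profile.rank_equidist[OF profile_X], of s r]
    profile.rank_range[OF profile_X, of r]
  by (simp add: A_def F_def)

lemma A_le_pairing_X2: "r < 0 \<Longrightarrow> A r \<le> (\<integral>t. X'' r t * F r t \<partial>circ)"
  using smooth_profile.polya_szego[OF smooth_profile_X, of r] by (simp add: A_def F_def)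

lemma A_ge_cos: "r < 0 \<Longrightarrow> (\<integral>t. X r t * cos t \<partial>circ) \<le> A r"
  using profile.hardy_littlewood[OF profile_X equidist_abs, of r]
  by (simp add: A_def F_def cos_diff abs_le_iff)

lemma leibniz:
  assumes f: "f holomorphic_on H" and g: "continuous_on UNIV g" and s: "s < 0"
  shows "((\<lambda>s. \<integral>t. Re (f (Complex s t)) * g t \<partial>circ) has_real_derivative
     (\<integral>t. Re (deriv f (Complex s t)) * g t \<partial>circ)) (at s)"
proof -
  have gS: "continuous_on S g" for S using g continuous_on_subset by blast
  have f': "deriv f holomorphic_on H" by (rule holomorphic_deriv[OF f open_H])
  have "((\<lambda>s. integral (cbox 0 (2*pi)) (\<lambda>t. Re (f (Complex s t)) * g t)) has_field_derivative
     integral (cbox 0 (2*pi)) (\<lambda>t. Re (deriv f (Complex s t)) * g t)) (at s within {..<0})"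
  proof (rule leibniz_rule_field_derivative)
    fix s t :: real assume "s \<in> {..<0}"
    then show "((\<lambda>s. Re (f (Complex s t)) * g t) has_real_derivative Re (deriv f (Complex s t)) * g t) (at s within {..<0})"
      by (intro DERIV_cmult_right has_field_derivative_at_within[OF DERIV_Re_horizontal[OF f open_H]]) auto
  next
    fix s :: real assume "s \<in> {..<0}"
    then show "(\<lambda>t. Re (f (Complex s t)) * g t) integrable_on cbox 0 (2*pi)"
      by (intro integrable_continuous continuous_intros cont_line f gS) auto
  next
    show "continuous_on ({..<0} \<times> cbox 0 (2*pi)) (\<lambda>(s, t). Re (deriv f (Complex s t)) * g t)"
      unfolding split_beta
      by (intro continuous_intros cont_pair f' continuous_on_compose2[OF g]) auto
  qed (use s in auto)
  then have "((\<lambda>s. integral {0..2*pi} (\<lambda>t. Re (f (Complex s t)) * g t)) has_field_derivative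
     integral {0..2*pi} (\<lambda>t. Re (deriv f (Complex s t)) * g t)) (at s)"
    using s by (subst (asm) at_within_open) auto
  then have "((\<lambda>s. integral {0..2*pi} (\<lambda>t. Re (f (Complex s t)) * g t) / (2*pi)) has_field_derivative
     integral {0..2*pi} (\<lambda>t. Re (deriv f (Complex s t)) * g t) / (2*pi)) (at s)"
    by (rule DERIV_cdivide)
  moreover have "integral {0..2*pi} (\<lambda>t. Re (deriv f (Complex s t)) * g t) / (2*pi) = (\<integral>t. Re (deriv f (Complex s t)) * g t \<partial>circ)"
    using s by (intro integral_circ[symmetric] continuous_intros cont_line f' g)
  ultimately have "((\<lambda>s. integral {0..2*pi} (\<lambda>t. Re (f (Complex s t)) * g t) / (2*pi)) has_field_derivative
     (\<integral>t. Re (deriv f (Complex s t)) * g t \<partial>circ)) (at s)" by simp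
  then show ?thesis
  proof (rule has_field_derivative_transform_within_open[of _ _ _ "{..<0}"])
    show "integral {0..2*pi} (\<lambda>t. Re (f (Complex s t)) * g t) / (2*pi) = (\<integral>t. Re (f (Complex s t)) * g t \<partial>circ)"
      if "s \<in> {..<0}" for s
      using that by (intro integral_circ[symmetric] continuous_intros cont_line f g) auto
  qed (use s in auto)
qed

lemma DERIV_pairing_X: "r < 0 \<Longrightarrow> s < 0 \<Longrightarrow> ((\<lambda>s. \<integral>t. X s t * F r t \<partial>circ) has_real_derivative (\<integral>t. X' s t * F r t \<partial>circ)) (at s)"
  unfolding X_def X'_def by (rule leibniz[OF \<psi>_holo F_cont])

lemma DERIV_pairing_X1: "r < 0 \<Longrightarrow> s < 0 \<Longrightarrow> ((\<lambda>s. \<integral>t. X' s t * F r t \<partial>circ) has_real_derivative (\<integral>t. X'' s t * F r t \<partial>circ)) (at s)"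
  unfolding X'_def X''_def by (rule leibniz[OF \<psi>'_holo F_cont])

text \<open>\<open>A\<close> is a maximum of pairings with functions bounded by 1, and these are
  Lipschitz in the radius with a common constant, the bound on \<open>X'\<close> over a compact set.
  The maximum inherits that constant.\<close>

lemma A_cont: "isCont A r" if r: "r < 0" for r
proof -
  define I where "I = {2*r..r/2}"
  have I: "I \<subseteq> {..<0}" "r \<in> {2*r<..<r/2}" using r by (auto simp: I_def)
  have "compact ((\<lambda>x. X' (fst x) (snd x)) ` (I \<times> {0..2*pi}))"
    unfolding X'_def using I(1)
    by (intro compact_continuous_image compact_Times continuous_intros cont_pair \<psi>'_holo) (auto simp: I_def)
  then have "bounded ((\<lambda>x. X' (fst x) (snd x)) ` (I \<times> {0..2*pi}))" by (rule compact_imp_bounded)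
  then obtain C where "\<forall>y\<in>(\<lambda>x. X' (fst x) (snd x)) ` (I \<times> {0..2*pi}). norm y \<le> C"
    unfolding bounded_iff by blast
  then have C: "\<bar>X' s t\<bar> \<le> C" if "s \<in> I" "t \<in> {0..2*pi}" for s t
    using that by force
  have lipX: "\<bar>X s t - X s' t\<bar> \<le> C * \<bar>s - s'\<bar>" if "s \<in> I" "s' \<in> I" "t \<in> {0..2*pi}" for s s' t
  proof -
    have d: "((\<lambda>s. X s t) has_real_derivative X' s t) (at s within I)" if "s \<in> I" for s
      unfolding X_def X'_def using that I(1)
      by (intro has_field_derivative_at_within[OF DERIV_Re_horizontal[OF \<psi>_holo open_H]]) auto
    have "convex I" by (simp add: I_def)
    then show ?thesis
      using field_differentiable_bound[of I "\<lambda>s. X s t" "\<lambda>s. X' s t" C s s'] that C d by auto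
  qed
  have one: "A s - A s' \<le> C * \<bar>s - s'\<bar>" if ss: "s \<in> I" "s' \<in> I" for s s'
  proof -
    have neg: "s < 0" "s' < 0" using ss I by auto
    have "A s - A s' \<le> (\<integral>t. X s t * F s t \<partial>circ) - (\<integral>t. X s' t * F s t \<partial>circ)"
      using pairing_le_A[OF neg] by (simp add: A_def)
    also have "\<dots> = (\<integral>t. (X s t - X s' t) * F s t \<partial>circ)"
      unfolding left_diff_distrib using neg
      by (intro Bochner_Integration.integral_diff[symmetric] integrable_circ_continuous continuous_intros F_cont)
    also have "\<dots> \<le> \<bar>\<dots>\<bar>" by simp
    also have "\<dots> \<le> C * \<bar>s - s'\<bar>"
    proof (rule abs_integral_circ_le)
      show "continuous_on UNIV (\<lambda>t. (X s t - X s' t) * F s t)" using neg by (intro continuous_intros F_cont)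
      fix t :: real assume t: "t \<in> {0..2*pi}"
      have "\<bar>(X s t - X s' t) * F s t\<bar> \<le> \<bar>X s t - X s' t\<bar> * 1"
        unfolding abs_mult by (intro mult_left_mono F_bound) auto
      then show "\<bar>(X s t - X s' t) * F s t\<bar> \<le> C * \<bar>s - s'\<bar>" using lipX[OF ss t] by simp
    qed
    finally show ?thesis .
  qed
  have C0: "0 \<le> C" using C[of r 0] I by (auto simp: I_def)
  have "C-lipschitz_on I A"
  proof (rule lipschitz_onI[OF _ C0])
    fix s s' assume "s \<in> I" "s' \<in> I"
    then show "dist (A s) (A s') \<le> C * dist s s'"
      using one[of s s'] one[of s' s] by (auto simp: dist_real_def abs_minus_commute)
  qed
  then have "continuous_on I A" by (rule lipschitz_on_continuous_on)
  then have "continuous_on {2*r<..<r/2} A" by (rule continuous_on_subset) (auto simp: I_def)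
  then show ?thesis using I(2) by (simp add: continuous_on_eq_continuous_at)
qed

lemma phi_asymp:
  assumes "e > 0"
  shows "\<exists>L<0. \<forall>s\<le>L. \<forall>t. cmod (\<psi> (Complex s t) - of_real a * exp (Complex s t)) \<le> e * exp s"
proof -
  have "(\<phi> has_field_derivative of_real a) (at 0)"
    using holomorphic_derivI[OF holo, of 0] deriv_zero by simp
  then have "(\<phi> has_derivative (\<lambda>h. of_real a * h)) (at 0)" by (simp add: has_field_derivative_def)
  then obtain d where d: "d > 0" "\<And>z. cmod z < d \<Longrightarrow> cmod (\<phi> z - of_real a * z) \<le> e * cmod z"
    using assms unfolding has_derivative_at_alt by (auto simp: zero)
  define L where "L = min (-1) (ln (d / 2))"
  show ?thesis
  proof (intro exI[of _ L] conjI allI impI)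
    show "L < 0" by (auto simp: L_def)
    fix s t assume s: "s \<le> L"
    have "exp s \<le> exp (ln (d/2))" using s by (simp add: L_def)
    then have "exp s < d" using d(1) by simp
    then show "cmod (\<psi> (Complex s t) - of_real a * exp (Complex s t)) \<le> e * exp s"
      using d(2)[of "exp (Complex s t)"] by (simp add: \<psi>_def)
  qed
qed

text \<open>Testing with the cosine suffices: to first order \<open>X s t\<close> is
  \<open>a * exp s * cos t\<close>, and the mean of the squared cosine is 1/2.\<close>

lemma A_lower:
  assumes "e > 0"
  shows "\<exists>L<0. \<forall>s\<le>L. exp s * (a / 2 - e) \<le> A s"
proof -
  obtain L where L: "L < 0" "\<And>s t. s \<le> L \<Longrightarrow> cmod (\<psi> (Complex s t) - of_real a * exp (Complex s t)) \<le> e * exp s"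
    using phi_asymp[OF assms] by blast
  have cos2: "(\<integral>t. (cos t)\<^sup>2 \<partial>circ) = 1 / 2"
  proof -
    have "((\<lambda>t. (cos t)\<^sup>2) has_integral ((2*pi + sin (2*pi) * cos (2*pi)) / 2 - (0 + sin 0 * cos 0) / 2)) {0..2*pi}"
    proof (rule fundamental_theorem_of_calculus)
      fix t :: real
      have "((\<lambda>t. (t + sin t * cos t) / 2) has_real_derivative (cos t)\<^sup>2) (at t)"
        using sin_cos_squared_add[of t]
        by (auto intro!: derivative_eq_intros simp: power2_eq_square)
      then show "((\<lambda>t. (t + sin t * cos t) / 2) has_vector_derivative (cos t)\<^sup>2) (at t within {0..2*pi})"
        by (simp flip: has_real_derivative_iff_has_vector_derivative add: has_field_derivative_at_within)
    qed simp
    then show ?thesis by (subst integral_circ) (auto intro!: continuous_intros simp: integral_unique)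
  qed
  show ?thesis
  proof (intro exI[of _ L] conjI allI impI L(1))
    fix s assume s: "s \<le> L"
    then have s0: "s < 0" using L by simp
    have "exp s * (a / 2 - e) = (\<integral>t. exp s * a * (cos t)\<^sup>2 - e * exp s \<partial>circ)"
      by (subst Bochner_Integration.integral_diff)
         (auto intro!: integrable_circ_continuous continuous_intros simp: cos2 circ.prob_space[simplified] algebra_simps)
    also have "\<dots> \<le> (\<integral>t. X s t * cos t \<partial>circ)"
    proof (intro integral_mono integrable_circ_continuous continuous_intros s0)
      fix t
      have "\<bar>Re (\<psi> (Complex s t) - of_real a * exp (Complex s t))\<bar> \<le> e * exp s"
        using abs_Re_le_cmod L(2)[OF s] order_trans by blast
      then have "\<bar>X s t - a * (exp s * cos t)\<bar> \<le> e * exp s"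
        by (simp add: X_def Re_exp)
      then have "\<bar>X s t - a * (exp s * cos t)\<bar> * \<bar>cos t\<bar> \<le> e * exp s * 1"
        using assms by (intro mult_mono) auto
      then have "\<bar>(X s t - a * (exp s * cos t)) * cos t\<bar> \<le> e * exp s" by (simp add: abs_mult)
      then show "exp s * a * (cos t)\<^sup>2 - e * exp s \<le> X s t * cos t"
        by (simp add: power2_eq_square algebra_simps abs_le_iff)
    qed
    also have "\<dots> \<le> A s" by (rule A_ge_cos[OF s0])
    finally show "exp s * (a / 2 - e) \<le> A s" .
  qed
qed

text \<open>Boundedness near minus infinity is what lets the barrier in the comparison argument
  dominate there.\<close>

lemma A_upper: "\<exists>L<0. \<forall>s\<le>L. A s \<le> a + 1"
proof -
  obtain L where L: "L < 0" "\<And>s t. s \<le> L \<Longrightarrow> cmod (\<psi> (Complex s t) - of_real a * exp (Complex s t)) \<le> 1 * exp s"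
    using phi_asymp[of 1] by auto
  show ?thesis
  proof (intro exI[of _ L] conjI allI impI L(1))
    fix s assume s: "s \<le> L"
    then have s0: "s < 0" using L by simp
    have "\<bar>A s\<bar> \<le> a + 1"
      unfolding A_def
    proof (rule abs_integral_circ_le)
      show "continuous_on UNIV (\<lambda>t. X s t * F s t)" by (intro continuous_intros F_cont s0)
      fix t :: real
      have "cmod (\<psi> (Complex s t)) \<le> cmod (of_real a * exp (Complex s t)) + 1 * exp s"
        using L(2)[OF s, of t] norm_triangle_sub[of "\<psi> (Complex s t)" "of_real a * exp (Complex s t)"] by linarith
      also have "\<dots> \<le> a * 1 + 1 * 1"
        using a_pos s0 by (auto simp: norm_mult intro!: add_mono mult_left_le)
      finally have "\<bar>X s t\<bar> \<le> a + 1"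
        using abs_Re_le_cmod[of "\<psi> (Complex s t)"] by (simp add: X_def)
      then have "\<bar>X s t\<bar> * \<bar>F s t\<bar> \<le> (a + 1) * 1" using F_bound a_pos by (intro mult_mono) auto
      then show "\<bar>X s t * F s t\<bar> \<le> a + 1" by (simp add: abs_mult)
    qed
    then show "A s \<le> a + 1" by simp
  qed
qed

text \<open>Comparison with \<open>v\<close>, a solution of v'' = v that exceeds \<open>A\<close> at
  r2 and, by its decaying summand \<open>e * exp (- s)\<close>, far to the left. A positive maximum
  of \<open>A - v\<close> in between would also be a local maximum of the smooth function touching
  it from below, whose second derivative there is at least \<open>A - v\<close> and hence
  positive.\<close>

lemma A_exp_mono:
  assumes r2: "r2 < 0" and r: "r \<le> r2"
  shows "A r \<le> A r2 * exp (r - r2)"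
proof (rule ccontr)
  assume "\<not> ?thesis"
  then have gap: "A r - A r2 * exp (r - r2) > 0" by simp
  \<comment> \<open>Half of the assumed gap: \<open>e * exp (- r)\<close> equals
    \<open>(A r - A r2 * exp (r - r2)) / 2\<close>, so \<open>v r\<close> stays below
    \<open>A r\<close>.\<close>
  define e where "e = (A r - A r2 * exp (r - r2)) / (2 * exp (- r))"
  have e: "e > 0" using gap by (simp add: e_def)
  define v where "v s = A r2 * exp (s - r2) + e * exp (- s)" for s
  have vr: "A r - v r > 0"
    using gap by (simp add: v_def e_def field_simps)
  obtain L0 where L0: "L0 < 0" "\<And>s. s \<le> L0 \<Longrightarrow> A s \<le> a + 1" using A_upper by blast
  define K where "K = a + 1 + \<bar>A r2\<bar>"
  have K: "K > 0" using a_pos by (simp add: K_def)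
  \<comment> \<open>So far left that \<open>e * exp (- L)\<close> exceeds the bound a + 1 for
    \<open>A L\<close> together with the possible negative part of the other summand of
    \<open>v\<close>.\<close>
  define L where "L = Min {L0, r - 1, - ln (K / e)}"
  have L: "L \<le> L0" "L < r" "L \<le> - ln (K / e)" by (auto simp: L_def min_def)
  have neg: "A L - v L \<le> 0"
  proof -
    have "exp (ln (K / e)) \<le> exp (- L)" using L(3) by simp
    then have "K \<le> e * exp (- L)" using K e by (simp add: field_simps)
    moreover have "- (A r2 * exp (L - r2)) \<le> \<bar>A r2\<bar> * 1"
    proof -
      have "- (A r2 * exp (L - r2)) \<le> \<bar>A r2\<bar> * exp (L - r2)"
        by (metis abs_ge_minus_self abs_mult abs_exp_cancel)
      also have "\<dots> \<le> \<bar>A r2\<bar> * 1" using L r by (intro mult_left_mono) auto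
      finally show ?thesis .
    qed
    ultimately show ?thesis using L0(2)[OF L(1)] by (simp add: v_def K_def)
  qed
  have "continuous_on {L..r2} A"
    using r2 by (intro continuous_at_imp_continuous_on ballI A_cont) auto
  then have "continuous_on {L..r2} (\<lambda>s. A s - v s)"
    unfolding v_def by (intro continuous_intros)
  then obtain s0 where s0: "s0 \<in> {L..r2}" "\<And>s. s \<in> {L..r2} \<Longrightarrow> A s - v s \<le> A s0 - v s0"
    using continuous_attains_sup[of "{L..r2}" "\<lambda>s. A s - v s"] L r by fastforce
  have pos: "A s0 - v s0 > 0" using s0(2)[of r] L r vr by auto
  have "A r2 - v r2 < 0" using e by (simp add: v_def)
  then have s0in: "s0 \<in> {L<..<r2}" using s0(1) pos neg by (cases "s0 = L"; cases "s0 = r2") auto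
  have s00: "s0 < 0" using s0in r2 by auto
  \<comment> \<open>The rearrangement is frozen at s0: f is at most \<open>A - v\<close>, with
    equality at s0, and is twice differentiable there.\<close>
  define f where "f s = (\<integral>t. X s t * F s0 t \<partial>circ) - v s" for s
  define f' where "f' s = (\<integral>t. X' s t * F s0 t \<partial>circ) - (A r2 * exp (s - r2) - e * exp (- s))" for s
  show False
  proof (rule not_local_max_if_second_deriv_pos[OF _ _ s0in, of f f' "(\<integral>t. X'' s0 t * F s0 t \<partial>circ) - v s0"])
    show "(f has_real_derivative f' s) (at s)" if "s \<in> {L<..<r2}" for s
      unfolding f_def f'_def v_def using that r2
      by (intro DERIV_diff DERIV_pairing_X s00) (auto intro!: derivative_eq_intros)
    show "(f' has_real_derivative (\<integral>t. X'' s0 t * F s0 t \<partial>circ) - v s0) (at s0)"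
      unfolding f'_def v_def
      by (intro DERIV_diff DERIV_pairing_X1 s00) (auto intro!: derivative_eq_intros)
    show "0 < (\<integral>t. X'' s0 t * F s0 t \<partial>circ) - v s0"
      using A_le_pairing_X2[OF s00] pos by simp
    show "f s \<le> f s0" if "s \<in> {L<..<r2}" for s
      using pairing_le_A[OF s00, of s] s0(2)[of s] that r2 by (simp add: f_def A_def[of s0])
  qed
qed

lemma A_le_flux:
  assumes r: "r < 0"
  shows "A r \<le> (\<integral>t. X' r t * F r t \<partial>circ)"
proof (rule ccontr)
  assume "\<not> ?thesis"
  then have pos: "0 < A r - (\<integral>t. X' r t * F r t \<partial>circ)" by simp
  define E where "E s = A r * exp (s - r) - (\<integral>t. X s t * F r t \<partial>circ)" for s
  have "(E has_real_derivative A r - (\<integral>t. X' r t * F r t \<partial>circ)) (at r)"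
    unfolding E_def by (intro DERIV_diff DERIV_pairing_X r) (auto intro!: derivative_eq_intros)
  then obtain d where d: "d > 0" "\<And>h. 0 < h \<Longrightarrow> h < d \<Longrightarrow> E (r - h) < E r"
    using DERIV_pos_inc_left[OF _ pos] by blast
  have "E r = 0" by (simp add: E_def A_def)
  moreover have "0 \<le> E (r - d/2)"
    using A_exp_mono[OF r, of "r - d/2"] pairing_le_A[OF r, of "r - d/2"] d(1) r by (simp add: E_def)
  ultimately show False using d(2)[of "d/2"] d(1) by simp
qed

section \<open>Flux through circles and covered area\<close>

lemma circle_image_bound:
  assumes "r < 0"
  shows "\<exists>B. \<forall>\<zeta>. Re \<zeta> \<le> r \<longrightarrow> cmod (\<psi> \<zeta>) \<le> B \<and> cmod (deriv \<psi> \<zeta>) \<le> B * exp (Re \<zeta>)"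
proof -
  have sub: "cball 0 (exp r) \<subseteq> ball (0::complex) 1"
  proof
    fix z :: complex assume "z \<in> cball 0 (exp r)"
    then have "cmod z \<le> exp r" by simp
    also have "exp r < 1" using assms by simp
    finally show "z \<in> ball 0 1" by simp
  qed
  have "compact (\<phi> ` cball 0 (exp r))" "compact (deriv \<phi> ` cball 0 (exp r))"
    using holo holomorphic_deriv[OF holo] sub
    by (auto intro!: compact_continuous_image continuous_on_subset[OF _ sub] holomorphic_on_imp_continuous_on)
  then obtain B1 B2 where B: "\<And>z. z \<in> cball 0 (exp r) \<Longrightarrow> cmod (\<phi> z) \<le> B1" "\<And>z. z \<in> cball 0 (exp r) \<Longrightarrow> cmod (deriv \<phi> z) \<le> B2"
    by (fastforce dest!: compact_imp_bounded simp: bounded_iff)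
  show ?thesis
  proof (intro exI[of _ "max B1 B2"] allI impI)
    fix \<zeta> assume \<zeta>: "Re \<zeta> \<le> r"
    have "cmod (deriv \<psi> \<zeta>) = cmod (deriv \<phi> (exp \<zeta>)) * exp (Re \<zeta>)"
      using \<psi>_eq[of \<zeta>] \<zeta> assms by (simp add: H_def norm_mult)
    also have "\<dots> \<le> max B1 B2 * exp (Re \<zeta>)"
      using B(2)[of "exp \<zeta>"] \<zeta> by (intro mult_right_mono) auto
    finally show "cmod (\<psi> \<zeta>) \<le> max B1 B2 \<and> cmod (deriv \<psi> \<zeta>) \<le> max B1 B2 * exp (Re \<zeta>)"
      using B(1)[of "exp \<zeta>"] \<zeta> by (auto simp: \<psi>_def)
  qed
qed

text \<open>By the divergence theorem the flux of \<open>f (X) * grad X\<close> through a circle is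
  the integral of \<open>k (X) * \<bar>grad X\<bar>\<^sup>2\<close> inside. This is the area
  weighted by k, at most 2 * pi * p times the total increase of f, and that increase is at most
  2.\<close>

lemma flux_smooth:
  assumes r: "r < 0" and f: "\<And>x. (f has_real_derivative k x) (at x)" and k: "continuous_on UNIV k" "\<And>x. 0 \<le> k x"
    and f1: "\<And>x. \<bar>f x\<bar> \<le> 1"
  shows "integral {0..2*pi} (\<lambda>t. X' r t * f (X r t)) \<le> 4 * pi * p"
proof -
  obtain B where B: "\<And>\<zeta>. Re \<zeta> \<le> r \<Longrightarrow> cmod (\<psi> \<zeta>) \<le> B" "\<And>\<zeta>. Re \<zeta> \<le> r \<Longrightarrow> cmod (deriv \<psi> \<zeta>) \<le> B * exp (Re \<zeta>)"
    using circle_image_bound[OF r] by blast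
  have B0: "0 \<le> B" using order_trans[OF norm_ge_zero B(1)[of "of_real r"]] by simp
  have fc: "continuous_on UNIV f" using f by (meson DERIV_isCont continuous_at_imp_continuous_on)
  define Y where "Y s t = Im (deriv \<psi> (Complex s t))" for s t
  have comp: "continuous_on S (\<lambda>t. h (X s t))" if "continuous_on UNIV h" "s < 0" for h :: "real \<Rightarrow> real" and s S
    using that by (intro continuous_on_compose2[OF that(1)] X_cont) auto
  have Yc: "continuous_on S (Y s)" if "s < 0" for s S
    unfolding Y_def[abs_def] by (intro continuous_intros cont_line \<psi>'_holo that)
  define J where "J s = integral {0..2*pi} (\<lambda>t. X' s t * f (X s t))" for s
  define Q where "Q s = integral {0..2*pi} (\<lambda>t. k (X s t) * (cmod (deriv \<psi> (Complex s t)))\<^sup>2)" for s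
  have dJ: "(J has_real_derivative Q s) (at s)" if s: "s < 0" for s
  proof -
    have "((\<lambda>s. integral (cbox 0 (2*pi)) (\<lambda>t. X' s t * f (X s t))) has_field_derivative
       integral (cbox 0 (2*pi)) (\<lambda>t. X'' s t * f (X s t) + X' s t * (k (X s t) * X' s t))) (at s within {..<0})"
    proof (rule leibniz_rule_field_derivative)
      fix s t :: real assume s: "s \<in> {..<0}"
      have 1: "((\<lambda>s. X s t) has_real_derivative X' s t) (at s)" "((\<lambda>s. X' s t) has_real_derivative X'' s t) (at s)"
        unfolding X_def X'_def X''_def using s
        by (auto intro!: DERIV_Re_horizontal[OF \<psi>_holo open_H] DERIV_Re_horizontal[OF \<psi>'_holo open_H])
      have "((\<lambda>s. f (X s t)) has_real_derivative k (X s t) * X' s t) (at s)"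
        by (rule DERIV_chain2[OF f 1(1)])
      from DERIV_mult[OF 1(2) this]
      show "((\<lambda>s. X' s t * f (X s t)) has_real_derivative X'' s t * f (X s t) + X' s t * (k (X s t) * X' s t)) (at s within {..<0})"
        by (rule has_field_derivative_at_within[OF DERIV_cong]) (simp add: algebra_simps)
    next
      fix s :: real assume "s \<in> {..<0}"
      then show "(\<lambda>t. X' s t * f (X s t)) integrable_on cbox 0 (2*pi)"
        by (intro integrable_continuous continuous_intros comp fc) auto
    next
      show "continuous_on ({..<0} \<times> cbox 0 (2*pi)) (\<lambda>(s, t). X'' s t * f (X s t) + X' s t * (k (X s t) * X' s t))"
        unfolding split_beta X_def X'_def X''_def
        by (intro continuous_intros cont_pair \<psi>_holo \<psi>'_holo \<psi>''_holo continuous_on_compose2[OF fc] continuous_on_compose2[OF k(1)]) auto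
    qed (use s in auto)
    then have 1: "(J has_real_derivative
       integral {0..2*pi} (\<lambda>t. X'' s t * f (X s t) + X' s t * (k (X s t) * X' s t))) (at s)"
      unfolding J_def using s by (subst (asm) at_within_open) auto
    \<comment> \<open>A total angular derivative, with integral 0 over the period. Subtracting it
      removes \<open>X''\<close> and completes \<open>(X')\<^sup>2\<close> to the squared modulus of
      \<open>deriv \<psi>\<close>.\<close>
    have "((\<lambda>t. X'' s t * f (X s t) - Y s t * (k (X s t) * Y s t)) has_integral (Y s (2*pi) * f (X s (2*pi)) - Y s 0 * f (X s 0))) {0..2*pi}"
    proof (rule fundamental_theorem_of_calculus)
      fix t :: real
      have "(X s has_real_derivative - Y s t) (at t)"
        unfolding X_def[abs_def] Y_def by (rule DERIV_Re_vertical[OF \<psi>_holo open_H]) (use s in simp)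
      then have 2: "((\<lambda>t. f (X s t)) has_real_derivative k (X s t) * (- Y s t)) (at t)"
        by (rule DERIV_chain2[OF f])
      have "(Y s has_real_derivative X'' s t) (at t)"
        unfolding X''_def Y_def[abs_def] by (rule DERIV_Im_vertical[OF \<psi>'_holo open_H]) (use s in simp)
      from DERIV_mult[OF this 2]
      have "((\<lambda>t. Y s t * f (X s t)) has_real_derivative X'' s t * f (X s t) - Y s t * (k (X s t) * Y s t)) (at t)"
        by (simp add: algebra_simps)
      then show "((\<lambda>t. Y s t * f (X s t)) has_vector_derivative X'' s t * f (X s t) - Y s t * (k (X s t) * Y s t)) (at t within {0..2*pi})"
        by (simp flip: has_real_derivative_iff_has_vector_derivative add: has_field_derivative_at_within)
    qed simp
    moreover have "Y s (2*pi) = Y s 0" "X s (2*pi) = X s 0"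
      using Complex_shift[of s 0] \<psi>'_periodic[of "Complex s 0"] periodic_f[of "Complex s 0"] s by (auto simp: Y_def X_def)
    ultimately have "integral {0..2*pi} (\<lambda>t. X'' s t * f (X s t) - Y s t * (k (X s t) * Y s t)) = 0"
      by (simp add: integral_unique)
    moreover have "Q s = integral {0..2*pi} (\<lambda>t. (X'' s t * f (X s t) + X' s t * (k (X s t) * X' s t)) - (X'' s t * f (X s t) - Y s t * (k (X s t) * Y s t)))"
      unfolding Q_def
      by (intro Henstock_Kurzweil_Integration.integral_cong, simp only: cmod_power2 X'_def Y_def) (simp add: power2_eq_square algebra_simps)
    moreover have "\<dots> = integral {0..2*pi} (\<lambda>t. X'' s t * f (X s t) + X' s t * (k (X s t) * X' s t)) - integral {0..2*pi} (\<lambda>t. X'' s t * f (X s t) - Y s t * (k (X s t) * Y s t))"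
      using s by (intro Henstock_Kurzweil_Integration.integral_diff integrable_continuous_interval continuous_intros comp fc k Yc)
    ultimately show ?thesis using 1 by simp
  qed
  have main: "J r \<le> 4 * pi * p + 2 * pi * (B * exp s)" if s: "s \<le> r" for s
  proof -
    have "(Q has_integral (J r - J s)) {s..r}"
      using s r by (intro fundamental_theorem_of_calculus)
        (auto simp flip: has_real_derivative_iff_has_vector_derivative intro!: has_field_derivative_at_within[OF dJ])
    then have "J r - J s = integral {s..r} Q" by (simp add: integral_unique)
    also have "\<dots> \<le> 2 * pi * p * integral {- B..B} k"
      unfolding Q_def X_def \<psi>_def
    proof (rule area_le_valence[OF holo val k s r])
      fix \<zeta> :: complex assume "Re \<zeta> \<in> {s..r}"
      then show "Re (\<phi> (exp \<zeta>)) \<in> {- B..B}"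
        using B(1)[of \<zeta>] abs_Re_le_cmod[of "\<psi> \<zeta>"] by (auto simp: \<psi>_def)
    qed (use B0 in auto)
    also have "integral {- B..B} k = f B - f (- B)"
      using B0 by (intro integral_unique fundamental_theorem_of_calculus)
        (auto simp flip: has_real_derivative_iff_has_vector_derivative intro!: has_field_derivative_at_within[OF f])
    also have "2 * pi * p * (f B - f (- B)) \<le> 2 * pi * p * 2"
      using f1[of B] f1[of "- B"] by (intro mult_left_mono) (auto simp: abs_le_iff)
    finally have "J r \<le> 4 * pi * p + J s" by simp
    \<comment> \<open>The inner boundary term tends to 0 at minus infinity, because
      \<open>deriv \<psi>\<close> carries the factor exp s from the chain rule.\<close>
    moreover have "J s \<le> 2 * pi * (B * exp s)"
    proof -
      have "J s \<le> integral {0..2*pi} (\<lambda>t. B * exp s)"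
        unfolding J_def
      proof (intro integral_le integrable_continuous_interval continuous_intros comp fc)
        fix t :: real
        have "\<bar>X' s t\<bar> \<le> B * exp s"
          using B(2)[of "Complex s t"] abs_Re_le_cmod[of "deriv \<psi> (Complex s t)"] s by (simp add: X'_def)
        then have "\<bar>X' s t\<bar> * \<bar>f (X s t)\<bar> \<le> B * exp s * 1" using f1 B0 by (intro mult_mono) auto
        then show "X' s t * f (X s t) \<le> B * exp s" by (simp add: abs_mult[symmetric])
      qed (use s r in auto)
      then show ?thesis by (simp add: mult.commute mult.left_commute)
    qed
    ultimately show ?thesis by linarith
  qed
  have "((\<lambda>s. 4 * pi * p + 2 * pi * (B * exp s)) \<longlongrightarrow> 4 * pi * p + 2 * pi * (B * 0)) at_bot"
    by (intro tendsto_intros exp_at_bot)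
  then have "J r \<le> 4 * pi * p + 2 * pi * (B * 0)"
  proof (rule tendsto_lowerbound)
    show "\<forall>\<^sub>F s in at_bot. J r \<le> 4 * pi * p + 2 * pi * (B * exp s)"
      using eventually_le_at_bot[of r] by eventually_elim (rule main)
  qed simp
  then show ?thesis by (simp add: J_def)
qed

text \<open>\<open>F r\<close> is a nondecreasing function of \<open>X r\<close>, namely
  \<open>- cos (pi * G x)\<close> at x = \<open>X r t\<close>, but only a continuous one; it is
  approximated by smooth nondecreasing functions of \<open>X r\<close>. Averaging turns 4 * pi * p
  into 2 * p.\<close>

lemma flux:
  assumes r: "r < 0"
  shows "(\<integral>t. X' r t * F r t \<partial>circ) \<le> 2 * p"
proof -
  interpret P: profile "X r" by (rule profile_X[OF r])
  define f where "f x = - cos (pi * P.G x)" for x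
  have F: "F r t = f (X r t)" for t by (simp add: F_def f_def P.rank_def)
  have fc: "continuous_on UNIV f" unfolding f_def by (intro continuous_intros P.G_cont)
  have fm: "f x \<le> f y" if "x \<le> y" for x y
    unfolding f_def using P.G_mono[OF that] P.G_range[of x] P.G_range[of y]
    by (auto intro!: cos_monotone_0_pi_le)
  have f1: "\<bar>f x\<bar> \<le> 1" for x by (simp add: f_def)
  obtain \<Phi> where \<Phi>: "\<And>x. (\<Phi> has_real_derivative f x) (at x)"
    using exists_primitive_continuous[OF fc] by blast
  have \<Phi>c: "continuous_on UNIV \<Phi>"
    using \<Phi> by (meson DERIV_isCont continuous_at_imp_continuous_on)
  obtain C where C: "\<And>t. t \<in> {0..2*pi} \<Longrightarrow> \<bar>X' r t\<bar> \<le> C"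
    using compact_imp_bounded[OF compact_continuous_image[OF X_cont(2)[OF r, of "{0..2*pi}"]]] compact_Icc
    by (auto simp: bounded_iff) (metis atLeastAtMost_iff)
  have C0: "0 \<le> C" using C[of 0] by auto
  have le: "integral {0..2*pi} (\<lambda>t. X' r t * F r t) \<le> 4 * pi * p + e" if e: "e > 0" for e
  proof -
    define e' where "e' = e / (2 * pi * (C + 1))"
    have e': "e' > 0" using e C0 by (simp add: e'_def)
    have "uniformly_continuous_on {P.lo..P.hi+1} f"
      using fc continuous_on_subset by (intro compact_uniformly_continuous) blast+
    then obtain d where d: "d > 0" "\<And>x y. x \<in> {P.lo..P.hi+1} \<Longrightarrow> y \<in> {P.lo..P.hi+1} \<Longrightarrow> dist y x < d \<Longrightarrow> dist (f y) (f x) < e'"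
      unfolding uniformly_continuous_on_def using e' by metis
    define \<eta> where "\<eta> = min (d/2) 1"
    have \<eta>: "0 < \<eta>" "\<eta> < d" "\<eta> \<le> 1" using d(1) by (auto simp: \<eta>_def)
    \<comment> \<open>The mean of f over {x..x + \<open>\<eta>\<close>}: continuously
      differentiable, still nondecreasing and bounded by 1, and uniformly close to f on the range of
      \<open>X r\<close>.\<close>
    define g where "g x = (\<Phi> (x + \<eta>) - \<Phi> x) / \<eta>" for x
    have gc: "continuous_on UNIV g"
      unfolding g_def
      using \<eta> by (intro continuous_intros continuous_on_compose2[OF \<Phi>c]) auto
    have between: "f x \<le> g x \<and> g x \<le> f (x + \<eta>)" for x
    proof -
      obtain z where z: "x < z" "z < x + \<eta>" "\<Phi> (x + \<eta>) - \<Phi> x = (x + \<eta> - x) * f z"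
        using MVT2[of x "x + \<eta>" \<Phi> f] \<Phi> \<eta> by auto
      then have "g x = f z" using \<eta> by (simp add: g_def)
      then show ?thesis using fm[of x z] fm[of z "x + \<eta>"] z by simp
    qed
    have "integral {0..2*pi} (\<lambda>t. X' r t * g (X r t)) \<le> 4 * pi * p"
    proof (rule flux_smooth[OF r, of g "\<lambda>x. (f (x + \<eta>) - f x) / \<eta>"])
      show "(g has_real_derivative (f (x + \<eta>) - f x) / \<eta>) (at x)" for x
        unfolding g_def using \<Phi>[of "x + \<eta>"] \<Phi>[of x]
        by (intro DERIV_cdivide DERIV_diff) (simp_all add: DERIV_shift)
      show "continuous_on UNIV (\<lambda>x. (f (x + \<eta>) - f x) / \<eta>)"
        using \<eta> by (intro continuous_intros continuous_on_compose2[OF fc]) auto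
      show "0 \<le> (f (x + \<eta>) - f x) / \<eta>" for x using fm[of x "x + \<eta>"] \<eta> by simp
      show "\<bar>g x\<bar> \<le> 1" for x
        using between[of x] f1[of x] f1[of "x + \<eta>"] by (auto simp: abs_le_iff)
    qed
    moreover have "integral {0..2*pi} (\<lambda>t. X' r t * F r t) \<le> integral {0..2*pi} (\<lambda>t. X' r t * g (X r t) + C * e')"
    proof (rule integral_le)
      show "(\<lambda>t. X' r t * F r t) integrable_on {0..2*pi}"
        by (intro integrable_continuous_interval continuous_intros F_cont r)
      show "(\<lambda>t. X' r t * g (X r t) + C * e') integrable_on {0..2*pi}"
        by (intro integrable_continuous_interval continuous_intros continuous_on_compose2[OF gc] r) auto
      fix t assume t: "t \<in> {0..2*pi}"
      have "X r t \<in> {P.lo..P.hi}" by (rule P.range_attained)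
      then have "dist (f (X r t + \<eta>)) (f (X r t)) < e'"
        using \<eta> by (intro d(2)) (auto simp: dist_real_def)
      then have "\<bar>f (X r t) - g (X r t)\<bar> \<le> e'"
        using between[of "X r t"] by (auto simp: dist_real_def)
      then have "\<bar>X' r t\<bar> * \<bar>f (X r t) - g (X r t)\<bar> \<le> C * e'"
        using C[OF t] C0 by (intro mult_mono) auto
      then have "X' r t * (f (X r t) - g (X r t)) \<le> C * e'" by (simp add: abs_mult[symmetric])
      then show "X' r t * F r t \<le> X' r t * g (X r t) + C * e'" by (simp add: F algebra_simps)
    qed
    moreover have "integral {0..2*pi} (\<lambda>t. X' r t * g (X r t) + C * e') = integral {0..2*pi} (\<lambda>t. X' r t * g (X r t)) + 2 * pi * (C * e')"
    proof -
      have "(\<lambda>t. X' r t * g (X r t)) integrable_on {0..2*pi}"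
        by (intro integrable_continuous_interval continuous_intros continuous_on_compose2[OF gc] r) auto
      then show ?thesis by (subst Henstock_Kurzweil_Integration.integral_add) auto
    qed
    moreover have "2 * pi * (C * e') \<le> e"
    proof -
      have "2 * pi * (C * e') = C / (C + 1) * e" using C0 by (simp add: e'_def)
      also have "\<dots> \<le> 1 * e" using C0 e by (intro mult_right_mono) auto
      finally show ?thesis by simp
    qed
    ultimately show ?thesis by linarith
  qed
  have "integral {0..2*pi} (\<lambda>t. X' r t * F r t) \<le> 4 * pi * p"
    by (rule field_le_epsilon) (rule le)
  moreover have "(\<integral>t. X' r t * F r t \<partial>circ) = integral {0..2*pi} (\<lambda>t. X' r t * F r t) / (2*pi)"
    by (intro integral_circ continuous_intros F_cont r)
  moreover have "4 * pi * p / (2*pi) = 2 * p" by simp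
  ultimately show ?thesis
    using divide_right_mono[of "integral {0..2*pi} (\<lambda>t. X' r t * F r t)" "4 * pi * p" "2*pi"] by simp
qed

text \<open>The factor exp s cancels between the asymptotic lower bound for \<open>A s\<close> and
  the growth estimate from s to r. What remains is sharp only as r tends to 0 from the left.\<close>

theorem deriv_bound: "a \<le> 4 * p"
proof -
  have *: "a / 2 \<le> 2 * p * exp (- r)" if r: "r < 0" for r
  proof (rule field_le_epsilon)
    fix e :: real assume e: "e > 0"
    obtain L where L: "L < 0" "\<And>s. s \<le> L \<Longrightarrow> exp s * (a / 2 - e) \<le> A s" using A_lower[OF e] by blast
    define s where "s = min L r"
    have "exp s * (a / 2 - e) \<le> A s" by (rule L(2)) (simp add: s_def)
    also have "\<dots> \<le> A r * exp (s - r)" by (rule A_exp_mono[OF r]) (simp add: s_def)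
    also have "\<dots> \<le> 2 * p * exp (s - r)"
      using A_le_flux[OF r] flux[OF r] by (intro mult_right_mono) auto
    also have "\<dots> = exp s * (2 * p * exp (- r))" by (simp add: exp_diff exp_minus field_simps)
    finally show "a / 2 \<le> 2 * p * exp (- r) + e" by simp
  qed
  have "((\<lambda>r. 2 * p * exp (- r)) \<longlongrightarrow> 2 * p * exp (- 0)) (at_left (0::real))"
    by (intro tendsto_intros)
  then have "a / 2 \<le> 2 * p * exp (- 0)"
    by (rule tendsto_lowerbound) (use * in \<open>auto simp: eventually_at_left_field intro!: exI[of _ "-1"]\<close>)
  then show ?thesis by simp
qed

end

section \<open>Distortion of zero-free p-valent functions\<close>

lemma valent_deriv_bound_at_0:
  assumes holo: "g holomorphic_on ball 0 1" and nz: "\<And>z. z \<in> ball 0 1 \<Longrightarrow> g z \<noteq> 0"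
    and val: "\<And>c. finite {z\<in>ball 0 1. g z = c} \<and> card {z\<in>ball 0 1. g z = c} \<le> p"
  shows "cmod (deriv g 0) \<le> 4 * real p * cmod (g 0)"
proof (cases "deriv g 0 = 0")
  case False
  obtain \<phi> where \<phi>: "\<phi> holomorphic_on ball 0 1" "\<And>z. z \<in> ball 0 1 \<Longrightarrow> g z = exp (\<phi> z)"
    using contractible_imp_holomorphic_log[OF holo convex_imp_contractible[OF convex_ball] nz] by metis
  have "(\<phi> has_field_derivative deriv \<phi> 0) (at 0)"
    by (rule holomorphic_derivI[OF \<phi>(1)]) auto
  then have "((\<lambda>z. exp (\<phi> z)) has_field_derivative exp (\<phi> 0) * deriv \<phi> 0) (at 0)"
    by (auto intro!: derivative_eq_intros)
  then have "(g has_field_derivative exp (\<phi> 0) * deriv \<phi> 0) (at 0)"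
    by (rule has_field_derivative_transform_within_open[where S="ball 0 1"]) (use \<phi>(2) in auto)
  then have dg: "deriv g 0 = g 0 * deriv \<phi> 0" using DERIV_imp_deriv \<phi>(2)[of 0] by fastforce
  define b where "b = deriv \<phi> 0"
  have b: "b \<noteq> 0" using False dg by (auto simp: b_def)
  \<comment> \<open>The rotation that makes the derivative of the logarithm at 0 a positive real, as
    the locale requires.\<close>
  define c where "c = cnj b / of_real (cmod b)"
  have c1: "cmod c = 1" using b by (simp add: c_def norm_divide)
  have c0: "c \<noteq> 0" using c1 by auto
  have cb: "c * b = of_real (cmod b)"
    using b by (simp add: c_def complex_norm_square[symmetric] mult.commute power2_eq_square)
  define \<Phi> where "\<Phi> z = \<phi> (c * z) - \<phi> 0" for z
  have cball: "c * z \<in> ball 0 1 \<longleftrightarrow> z \<in> ball 0 1" for z by (simp add: norm_mult c1)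
  interpret valent_log \<Phi> p "cmod b"
  proof
    show "\<Phi> holomorphic_on ball 0 1"
      unfolding \<Phi>_def
      by (intro holomorphic_intros holomorphic_on_compose_gen[OF _ \<phi>(1), unfolded o_def]) (use cball in auto)
    show "\<Phi> 0 = 0" by (simp add: \<Phi>_def)
    show "0 < cmod b" using b by simp
    have "((\<lambda>z. c * z) has_field_derivative c) (at 0)" by (auto intro!: derivative_eq_intros)
    moreover have "(\<phi> has_field_derivative b) (at (c * 0))"
      unfolding b_def using holomorphic_derivI[OF \<phi>(1), of 0] by simp
    ultimately have "((\<lambda>z. \<phi> (c * z)) has_field_derivative b * c) (at 0)" by (rule DERIV_chain2[rotated])
    then have "(\<Phi> has_field_derivative b * c) (at 0)"
      unfolding \<Phi>_def by (auto intro!: derivative_eq_intros)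
    then show "deriv \<Phi> 0 = of_real (cmod b)" using cb DERIV_imp_deriv by (metis mult.commute)
    fix w
    have "(\<lambda>z. c * z) ` {z\<in>ball 0 1. exp (\<Phi> z) = w} \<subseteq> {z\<in>ball 0 1. g z = w * g 0}"
    proof safe
      fix z :: complex assume z: "z \<in> ball 0 1"
      then show "c * z \<in> ball 0 1" by (simp only: cball)
      have "exp (\<Phi> z) * g 0 = g (c * z)"
        using \<phi>(2)[of 0] \<phi>(2)[of "c * z"] z cball[of z] by (simp add: \<Phi>_def exp_diff)
      then show "g (c * z) = exp (\<Phi> z) * g 0" by simp
    qed
    moreover have "inj_on (\<lambda>z. c * z) {z\<in>ball 0 1. exp (\<Phi> z) = w}" using c0 by (auto simp: inj_on_def)
    ultimately show "finite {z\<in>ball 0 1. exp (\<Phi> z) = w} \<and> card {z\<in>ball 0 1. exp (\<Phi> z) = w} \<le> p"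
      using val[of "w * g 0"] by (meson card_inj_on_le finite_imageD finite_subset le_trans)
  qed
  have "cmod b \<le> 4 * real p" using deriv_bound by simp
  then show ?thesis unfolding dg b_def[symmetric] norm_mult
    by (metis mult.commute mult_right_mono norm_ge_zero)
qed simp

text \<open>Composing with the disc automorphism that takes 0 to w preserves valence and absence of
  zeros, and its derivative at 0 is 1 minus the squared modulus of w.\<close>

lemma valent_deriv_bound:
  assumes holo: "g holomorphic_on ball 0 1" and nz: "\<And>z. z \<in> ball 0 1 \<Longrightarrow> g z \<noteq> 0"
    and val: "\<And>c. finite {z\<in>ball 0 1. g z = c} \<and> card {z\<in>ball 0 1. g z = c} \<le> p"
    and w: "cmod w < 1"
  shows "cmod (deriv g w) * (1 - (cmod w)\<^sup>2) \<le> 4 * real p * cmod (g w)"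
proof -
  define M where "M = Moebius_function 0 (- w)"
  have Mh: "M holomorphic_on ball 0 1" unfolding M_def by (rule Moebius_function_holomorphic) (use w in simp)
  have M1: "M z \<in> ball 0 1" if "z \<in> ball 0 1" for z
    unfolding M_def using Moebius_function_norm_lt_1[of "- w" z 0] w that by simp
  have Minj: "inj_on M (ball 0 1)"
  proof (rule inj_on_inverseI[of _ "Moebius_function 0 w"])
    show "Moebius_function 0 w (M z) = z" if "z \<in> ball 0 1" for z
      unfolding M_def using that w by (intro Moebius_function_compose) auto
  qed
  have M0: "M 0 = w" by (simp add: M_def Moebius_function_simple)
  have "((\<lambda>z. (z + w) / (1 + cnj w * z)) has_field_derivative 1 - w * cnj w) (at 0)"
    by (auto intro!: derivative_eq_intros)
  then have dM: "(M has_field_derivative of_real (1 - (cmod w)\<^sup>2)) (at 0)"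
    by (simp add: M_def Moebius_function_simple[abs_def] complex_norm_square[symmetric])
  have "(g has_field_derivative deriv g w) (at (M 0))"
    unfolding M0 by (rule holomorphic_derivI[OF holo]) (use w in auto)
  then have "((\<lambda>z. g (M z)) has_field_derivative deriv g w * of_real (1 - (cmod w)\<^sup>2)) (at 0)"
    by (rule DERIV_chain2[OF _ dM])
  then have d: "deriv (\<lambda>z. g (M z)) 0 = deriv g w * of_real (1 - (cmod w)\<^sup>2)" by (rule DERIV_imp_deriv)
  have "cmod (deriv (\<lambda>z. g (M z)) 0) \<le> 4 * real p * cmod (g (M 0))"
  proof (rule valent_deriv_bound_at_0[where g="\<lambda>z. g (M z)" and p=p])
    show "(\<lambda>z. g (M z)) holomorphic_on ball 0 1"
      using holomorphic_on_compose_gen[OF Mh holo] M1 unfolding o_def by blast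
    show "g (M z) \<noteq> 0" if "z \<in> ball 0 1" for z using nz M1 that by blast
    fix c
    have "M ` {z\<in>ball 0 1. g (M z) = c} \<subseteq> {z\<in>ball 0 1. g z = c}" using M1 by auto
    moreover have "inj_on M {z\<in>ball 0 1. g (M z) = c}" using Minj by (rule inj_on_subset) auto
    ultimately show "finite {z\<in>ball 0 1. g (M z) = c} \<and> card {z\<in>ball 0 1. g (M z) = c} \<le> p"
      using val[of c] by (meson card_inj_on_le finite_imageD finite_subset le_trans)
  qed
  moreover have "(cmod w)\<^sup>2 \<le> 1" using w by (simp add: power_le_one)
  then have "cmod (deriv (\<lambda>z. g (M z)) 0) = cmod (deriv g w) * (1 - (cmod w)\<^sup>2)"
    unfolding d norm_mult norm_of_real by simp
  ultimately show ?thesis by (simp add: M0)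
qed

text \<open>The derivative of \<open>ln g\<close> is bounded by 4 * p over 1 minus the squared
  modulus, for either sign; integrating along the radius bounds \<open>ln \<bar>g\<bar>\<close> on
  both sides.\<close>

theorem valent_distortion:
  assumes holo: "g holomorphic_on ball 0 1" and nz: "\<And>z. z \<in> ball 0 1 \<Longrightarrow> g z \<noteq> 0"
    and val: "\<And>c. finite {z\<in>ball 0 1. g z = c} \<and> card {z\<in>ball 0 1. g z = c} \<le> p"
    and z: "cmod z < 1"
  shows "cmod (g z) \<le> ((1 + cmod z) / (1 - cmod z)) ^ (2 * p) * cmod (g 0)"
    and "cmod (g 0) \<le> ((1 + cmod z) / (1 - cmod z)) ^ (2 * p) * cmod (g z)"
proof -
  obtain \<phi> where \<phi>: "\<phi> holomorphic_on ball 0 1" "\<And>z. z \<in> ball 0 1 \<Longrightarrow> g z = exp (\<phi> z)"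
    using contractible_imp_holomorphic_log[OF holo convex_imp_contractible[OF convex_ball] nz] by metis
  have d\<phi>: "cmod (deriv \<phi> w) * (1 - (cmod w)\<^sup>2) \<le> 4 * real p" if w: "w \<in> ball 0 1" for w
  proof -
    have "(\<phi> has_field_derivative deriv \<phi> w) (at w)"
      by (rule holomorphic_derivI[OF \<phi>(1)]) (use w in auto)
    then have "((\<lambda>z. exp (\<phi> z)) has_field_derivative exp (\<phi> w) * deriv \<phi> w) (at w)"
      by (auto intro!: derivative_eq_intros)
    then have "(g has_field_derivative exp (\<phi> w) * deriv \<phi> w) (at w)"
      by (rule has_field_derivative_transform_within_open[where S="ball 0 1"]) (use \<phi>(2) w in auto)
    then have dg: "deriv g w = g w * deriv \<phi> w" using DERIV_imp_deriv \<phi>(2)[OF w] by fastforce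
    have "cmod (g w) * (cmod (deriv \<phi> w) * (1 - (cmod w)\<^sup>2)) \<le> cmod (g w) * (4 * real p)"
      using valent_deriv_bound[OF holo nz val, of w] w by (simp add: dg norm_mult mult_ac)
    then show ?thesis using nz[OF w] by (simp add: mult_le_cancel_left)
  qed
  define r where "r = cmod z"
  have r: "0 \<le> r" "r < 1" using z by (auto simp: r_def)
  \<comment> \<open>The primitive of the bound \<open>4 * p * r / (1 - (t * r)\<^sup>2)\<close> that
    vanishes at t = 0.\<close>
  define B where "B t = 2 * real p * (ln (1 + t * r) - ln (1 - t * r))" for t
  define u where "u t = Re (\<phi> (of_real t * z))" for t
  define u' where "u' t = Re (deriv \<phi> (of_real t * z) * z)" for t
  have tr: "0 \<le> t * r" "t * r < 1" if "t \<in> {0..1}" for t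
    using that r mult_left_le_one_le[of r t] by (auto intro: le_less_trans)
  have dB: "(B has_real_derivative 4 * real p * r / (1 - (t * r)\<^sup>2)) (at t)" if t: "t \<in> {0..1}" for t
  proof -
    have "(B has_real_derivative 2 * real p * (r / (1 + t * r) + r / (1 - t * r))) (at t)"
      unfolding B_def using tr[OF t] by (auto intro!: derivative_eq_intros simp: field_simps)
    also have "2 * real p * (r / (1 + t * r) + r / (1 - t * r)) = 4 * real p * r / (1 - (t * r)\<^sup>2)"
    proof -
      have "1 - (t * r)\<^sup>2 = (1 + t * r) * (1 - t * r)" by (simp add: power2_eq_square algebra_simps)
      moreover have "1 + t * r \<noteq> 0" "1 - t * r \<noteq> 0" using tr[OF t] by auto
      ultimately show ?thesis by (simp add: add_frac_eq) (simp add: algebra_simps)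
    qed
    finally show ?thesis .
  qed
  have du: "(u has_real_derivative u' t) (at t)" if t: "t \<in> {0..1}" for t
  proof -
    have in1: "of_real t * z \<in> ball 0 1" using tr[OF t] t by (simp add: norm_mult r_def)
    have "(\<phi> has_derivative (\<lambda>h. deriv \<phi> (of_real t * z) * h)) (at (of_real t * z))"
      using holomorphic_derivI[OF \<phi>(1) _ in1] by (simp add: has_field_derivative_def)
    moreover have "((\<lambda>t. of_real t * z) has_derivative (\<lambda>h. of_real h * z)) (at t)"
      by (auto intro!: derivative_eq_intros)
    ultimately have "((\<lambda>t. \<phi> (of_real t * z)) has_derivative (\<lambda>h. deriv \<phi> (of_real t * z) * (of_real h * z))) (at t)"
      using has_derivative_compose by blast
    from bounded_linear.has_derivative[OF bounded_linear_Re this]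
    show ?thesis unfolding u_def has_field_derivative_def
      by (rule has_derivative_eq_rhs) (auto simp: fun_eq_iff u'_def algebra_simps)
  qed
  have bound: "\<bar>u' t\<bar> \<le> 4 * real p * r / (1 - (t * r)\<^sup>2)" if t: "t \<in> {0..1}" for t
  proof -
    have in1: "of_real t * z \<in> ball 0 1" using tr[OF t] t by (simp add: norm_mult r_def)
    have pos: "0 < 1 - (t * r)\<^sup>2" using tr[OF t] by (simp add: power_less_one_iff)
    have "cmod (of_real t * z) = t * r" using t by (simp add: norm_mult r_def)
    then have "cmod (deriv \<phi> (of_real t * z)) \<le> 4 * real p / (1 - (t * r)\<^sup>2)"
      using d\<phi>[OF in1] pos by (simp add: pos_le_divide_eq)
    then have "cmod (deriv \<phi> (of_real t * z)) * r \<le> 4 * real p / (1 - (t * r)\<^sup>2) * r" using r by (intro mult_right_mono) auto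
    moreover have "\<bar>u' t\<bar> \<le> cmod (deriv \<phi> (of_real t * z)) * r"
      unfolding u'_def r_def using abs_Re_le_cmod[of "deriv \<phi> (of_real t * z) * z"] by (simp add: norm_mult)
    ultimately show ?thesis by simp
  qed
  have "B 0 - u 0 \<le> B 1 - u 1"
  proof (rule DERIV_nonneg_imp_nondecreasing[of 0 1 "\<lambda>t. B t - u t"])
    fix t :: real assume "0 \<le> t" "t \<le> 1"
    then show "\<exists>y. ((\<lambda>t. B t - u t) has_real_derivative y) (at t) \<and> 0 \<le> y"
      using DERIV_diff[OF dB du, of t] bound[of t]
      by (intro exI[of _ "4 * real p * r / (1 - (t * r)\<^sup>2) - u' t"] conjI) (auto simp: abs_le_iff)
  qed simp
  moreover have "B 0 + u 0 \<le> B 1 + u 1"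
  proof (rule DERIV_nonneg_imp_nondecreasing[of 0 1 "\<lambda>t. B t + u t"])
    fix t :: real assume "0 \<le> t" "t \<le> 1"
    then show "\<exists>y. ((\<lambda>t. B t + u t) has_real_derivative y) (at t) \<and> 0 \<le> y"
      using DERIV_add[OF dB du, of t] bound[of t]
      by (intro exI[of _ "4 * real p * r / (1 - (t * r)\<^sup>2) + u' t"] conjI) (auto simp: abs_le_iff)
  qed simp
  ultimately have ub: "u 1 \<le> B 1 + u 0" "u 0 \<le> B 1 + u 1" by (auto simp: B_def)
  have "exp (B 1) = exp (real (2 * p) * ln ((1 + r) / (1 - r)))"
    using r by (simp add: B_def ln_div)
  also have "\<dots> = ((1 + r) / (1 - r)) ^ (2 * p)"
    using r by (subst exp_of_nat_mult) simp
  finally have eB: "exp (B 1) = ((1 + r) / (1 - r)) ^ (2 * p)" .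
  have g: "cmod (g z) = exp (u 1)" "cmod (g 0) = exp (u 0)"
    using \<phi>(2)[of z] \<phi>(2)[of 0] z by (auto simp: u_def)
  show "cmod (g z) \<le> ((1 + cmod z) / (1 - cmod z)) ^ (2 * p) * cmod (g 0)"
    using ub(1) unfolding g r_def[symmetric] eB[symmetric] exp_add[symmetric] by simp
  show "cmod (g 0) \<le> ((1 + cmod z) / (1 - cmod z)) ^ (2 * p) * cmod (g z)"
    using ub(2) unfolding g r_def[symmetric] eB[symmetric] exp_add[symmetric] by simp
qed

section \<open>Cartan's lemma\<close>

text \<open>Greedy selection: take the largest l for which some disc of radius
  \<open>\<rho> l\<close> holds at least l points, remove its points, and recurse. Doubling the
  radius afterwards keeps a point outside the discs far from everything removed.\<close>

lemma exists_disc_cover: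
  fixes M :: "complex multiset" and \<rho> :: "nat \<Rightarrow> real"
  assumes \<rho>: "\<And>k. 1 \<le> k \<Longrightarrow> 0 < \<rho> k" "\<And>k l. k \<le> l \<Longrightarrow> \<rho> k \<le> \<rho> l"
  shows "\<exists>L :: (complex \<times> nat) list. (\<forall>x\<in>set L. 1 \<le> snd x) \<and> sum_list (map snd L) = size M \<and>
    (\<forall>z. (\<forall>x\<in>set L. z \<notin> ball (fst x) (2 * \<rho> (snd x))) \<longrightarrow> (\<forall>k\<ge>1. size (filter_mset (\<lambda>w. dist z w < \<rho> k) M) < k))"
proof (induction "size M" arbitrary: M rule: less_induct)
  case less
  show ?case
  proof (cases "M = {#}")
    case True
    then show ?thesis by (intro exI[of _ "[]"]) auto
  next
    case False
    define S where "S = {l. 1 \<le> l \<and> (\<exists>c. l \<le> size (filter_mset (\<lambda>w. dist c w < \<rho> l) M))}"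
    have Sle: "l \<le> size M" if "l \<in> S" for l
      using that size_filter_mset_lesseq order_trans unfolding S_def by blast
    then have finS: "finite S" by (meson finite_nat_set_iff_bounded_le)
    obtain v where v: "v \<in># M" using False by (metis multiset_nonemptyE)
    have "1 \<in> S"
    proof -
      have "v \<in># filter_mset (\<lambda>w. dist v w < \<rho> 1) M" using v \<rho>(1)[of 1] by simp
      then have "filter_mset (\<lambda>w. dist v w < \<rho> 1) M \<noteq> {#}" by force
      then have "1 \<le> size (filter_mset (\<lambda>w. dist v w < \<rho> 1) M)"
        by (metis One_nat_def Suc_leI nonempty_has_size)
      then show ?thesis by (auto simp: S_def)
    qed
    define l where "l = Max S"
    have lS: "l \<in> S" unfolding l_def using finS \<open>1 \<in> S\<close> by (intro Max_in) auto
    have lmax: "k \<le> l" if "k \<in> S" for k using that finS by (simp add: l_def)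
    obtain c where c: "l \<le> size (filter_mset (\<lambda>w. dist c w < \<rho> l) M)" and l1: "1 \<le> l" using lS by (auto simp: S_def)
    define M1 where "M1 = filter_mset (\<lambda>w. dist c w < \<rho> l) M"
    define M2 where "M2 = filter_mset (\<lambda>w. \<not> dist c w < \<rho> l) M"
    have M12: "M = M1 + M2" unfolding M1_def M2_def by (rule multiset_partition)
    \<comment> \<open>A surplus point would make Suc l admissible as well, since the radii are
      nondecreasing.\<close>
    have "size M1 = l"
    proof (rule ccontr)
      assume "size M1 \<noteq> l"
      then have "Suc l \<le> size M1" using c by (simp add: M1_def)
      also have "M1 = filter_mset (\<lambda>w. dist c w < \<rho> l) (filter_mset (\<lambda>w. dist c w < \<rho> (Suc l)) M)"
        unfolding M1_def filter_filter_mset using \<rho>(2)[of l "Suc l"] by (intro filter_mset_cong) auto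
      also have "size \<dots> \<le> size (filter_mset (\<lambda>w. dist c w < \<rho> (Suc l)) M)" by (rule size_filter_mset_lesseq)
      finally have "Suc l \<in> S" by (auto simp: S_def)
      then show False using lmax by fastforce
    qed
    then have sz: "size M = l + size M2" using M12 by simp
    then obtain L where L: "\<forall>x\<in>set L. 1 \<le> snd x" "sum_list (map snd L) = size M2"
      "\<And>z k. (\<forall>x\<in>set L. z \<notin> ball (fst x) (2 * \<rho> (snd x))) \<Longrightarrow> 1 \<le> k \<Longrightarrow> size (filter_mset (\<lambda>w. dist z w < \<rho> k) M2) < k"
      using less[of M2] l1 by auto
    show ?thesis
    proof (intro exI[of _ "(c, l) # L"] conjI allI impI)
      show "\<forall>x\<in>set ((c, l) # L). 1 \<le> snd x" using L(1) l1 by simp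
      show "sum_list (map snd ((c, l) # L)) = size M" using L(2) sz by simp
      fix z k assume z: "\<forall>x\<in>set ((c, l) # L). z \<notin> ball (fst x) (2 * \<rho> (snd x))" and k: "1 \<le> (k::nat)"
      show "size (filter_mset (\<lambda>w. dist z w < \<rho> k) M) < k"
      proof (rule ccontr)
        assume "\<not> ?thesis"
        then have big: "k \<le> size (filter_mset (\<lambda>w. dist z w < \<rho> k) M)" by simp
        then have "k \<in> S" using k by (auto simp: S_def)
        then have kl: "\<rho> k \<le> \<rho> l" using lmax \<rho>(2) by blast
        have far: "2 * \<rho> l \<le> dist c z" using z by simp
        \<comment> \<open>A removed point is within \<open>\<rho> l\<close> of c while z is at least
          \<open>2 * \<rho> l\<close> away, so it is farther than \<open>\<rho> l\<close>, hence
          than \<open>\<rho> k\<close>, from z.\<close>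
        have "filter_mset (\<lambda>w. dist z w < \<rho> k) M1 = {#}"
        proof -
          have "\<not> dist z w < \<rho> k" if "w \<in># M1" for w
            using that far kl dist_triangle2[of c z w] by (auto simp: M1_def)
          then have "filter_mset (\<lambda>w. dist z w < \<rho> k) M1 = filter_mset (\<lambda>_. False) M1"
            by (intro filter_mset_cong) auto
          then show ?thesis by simp
        qed
        then have "filter_mset (\<lambda>w. dist z w < \<rho> k) M = filter_mset (\<lambda>w. dist z w < \<rho> k) M2"
          by (subst M12) simp
        then show False using L(3)[of z k] z k big by simp
      qed
    qed
  qed
qed

text \<open>When the distances are sorted, the k-th one is at least \<open>\<rho> k\<close>. Instead
  of sorting, the induction removes a point whose distance is at least the last radius.\<close>

lemma prod_le_prod_dist:
  fixes M :: "complex multiset" and \<rho> :: "nat \<Rightarrow> real"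
  assumes \<rho>: "\<And>k. 0 \<le> \<rho> k"
    and M: "\<And>k. 1 \<le> k \<Longrightarrow> k \<le> size M \<Longrightarrow> size (filter_mset (\<lambda>w. dist z w < \<rho> k) M) < k"
  shows "(\<Prod>k=1..size M. \<rho> k) \<le> prod_mset (image_mset (dist z) M)"
  using M
proof (induction "size M" arbitrary: M)
  case 0
  then show ?case by simp
next
  case (Suc n)
  have "\<exists>w. w \<in># M \<and> \<not> dist z w < \<rho> (Suc n)"
  proof (rule ccontr)
    assume "\<not> ?thesis"
    then have "filter_mset (\<lambda>w. dist z w < \<rho> (Suc n)) M = M" by (simp add: filter_mset_eq_conv)
    then show False using Suc.prems[of "Suc n"] Suc.hyps(2) by simp
  qed
  then obtain w where w: "w \<in># M" "\<rho> (Suc n) \<le> dist z w" by auto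
  obtain M' where M': "M = add_mset w M'" using w(1) by (metis multi_member_split)
  have n: "n = size M'" using Suc.hyps(2) M' by simp
  have "(\<Prod>k=1..size M'. \<rho> k) \<le> prod_mset (image_mset (dist z) M')"
  proof (rule Suc.hyps(1)[OF n])
    fix k assume k: "1 \<le> k" "k \<le> size M'"
    have "size (filter_mset (\<lambda>w. dist z w < \<rho> k) M') \<le> size (filter_mset (\<lambda>w. dist z w < \<rho> k) M)"
      unfolding M' by simp
    then show "size (filter_mset (\<lambda>w. dist z w < \<rho> k) M') < k"
      using Suc.prems[of k] k n Suc.hyps(2) by simp
  qed
  moreover have "0 \<le> prod_mset (image_mset (dist z) M')" by (induction M') auto
  ultimately have "(\<Prod>k=1..size M'. \<rho> k) * \<rho> (Suc n) \<le> prod_mset (image_mset (dist z) M') * dist z w"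
    using w(2) \<rho> by (intro mult_mono) (auto intro!: prod_nonneg)
  moreover have "(\<Prod>k=1..size M. \<rho> k) = (\<Prod>k=1..size M'. \<rho> k) * \<rho> (Suc n)"
    using n Suc.hyps(2) by (simp flip: Suc.hyps(2))
  ultimately show ?case by (simp add: M' n mult.commute)
qed

text \<open>A single term of the exponential series of d.\<close>

lemma power_le_exp_fact: "real d ^ d \<le> exp (real d) * fact d"
proof -
  have "real d ^ d / fact d \<le> (\<Sum>k. real d ^ k / fact k)"
    using sum_le_suminf[of "\<lambda>k. real d ^ k / fact k" "{d}"] summable_exp[of "real d"]
    by (simp add: divide_inverse mult.commute)
  also have "\<dots> = exp (real d)" by (simp add: exp_def divide_inverse mult.commute scaleR_conv_of_real)
  finally show ?thesis by (simp add: divide_le_eq)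
qed

text \<open>The discs that must be avoided have total size exactly 2 * h in the sense of
  \<open>cover_const\<close>, too little to cover Z. A point of Z outside them is far from most of
  the points of M.\<close>

lemma cartan:
  fixes M :: "complex multiset"
  assumes d: "size M = d" "1 \<le> d" and \<alpha>: "0 < \<alpha>" and h: "0 < h" "2 * h < cover_const d \<alpha> Z"
  shows "\<exists>z\<in>Z. (h / exp (1 / \<alpha>)) ^ d \<le> prod_mset (image_mset (dist z) M)"
proof -
  \<comment> \<open>Chosen so that \<open>\<rho> k\<close> to the power \<open>\<alpha>\<close> is
    proportional to k. The sum over the discs then depends only on the total number d of points and
    not on how they are grouped.\<close>
  define \<rho> where "\<rho> k = h * (real k / d) powr (1 / \<alpha>)" for k
  have \<rho>0: "0 < \<rho> k" if "1 \<le> k" for k using that d h by (simp add: \<rho>_def)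
  have \<rho>m: "\<rho> k \<le> \<rho> l" if "k \<le> l" for k l
    unfolding \<rho>_def using that h \<alpha> d by (intro mult_left_mono powr_mono2 divide_right_mono) auto
  obtain L :: "(complex \<times> nat) list" where L0: "(\<forall>x\<in>set L. 1 \<le> snd x) \<and> sum_list (map snd L) = size M \<and>
    (\<forall>z. (\<forall>x\<in>set L. z \<notin> ball (fst x) (2 * \<rho> (snd x))) \<longrightarrow> (\<forall>k\<ge>1. size (filter_mset (\<lambda>w. dist z w < \<rho> k) M) < k))"
    using exists_disc_cover[of \<rho> M, OF \<rho>0 \<rho>m] by blast
  then have L: "\<And>x. x \<in> set L \<Longrightarrow> 1 \<le> snd x" "sum_list (map snd L) = d"
    "\<And>z k. (\<forall>x\<in>set L. z \<notin> ball (fst x) (2 * \<rho> (snd x))) \<Longrightarrow> 1 \<le> k \<Longrightarrow> size (filter_mset (\<lambda>w. dist z w < \<rho> k) M) < k"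
    using d(1) by blast+
  define q where "q = length L"
  define c where "c j = fst (L ! j)" for j
  define r where "r j = 2 * \<rho> (snd (L ! j))" for j
  have sumL: "(\<Sum>j<q. snd (L ! j)) = d"
    using L(2) by (simp add: q_def sum_list_sum_nth atLeast0LessThan)
  have nth1: "1 \<le> snd (L ! j)" if "j < q" for j using L(1) that by (auto simp: q_def)
  have "q = (\<Sum>j<q. 1)" by simp
  also have "\<dots> \<le> (\<Sum>j<q. snd (L ! j))" using nth1 by (intro sum_mono) auto
  finally have qd: "q \<le> d" using sumL by simp
  have r0: "\<forall>j<q. r j > 0" using \<rho>0 nth1 by (auto simp: r_def)
  have rp: "r j powr \<alpha> = (2 * h) powr \<alpha> / d * snd (L ! j)" for j
  proof -
    have "r j powr \<alpha> = (2 * h) powr \<alpha> * ((real (snd (L ! j)) / d) powr (1 / \<alpha>)) powr \<alpha>"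
      using h by (simp add: r_def \<rho>_def powr_mult)
    then show ?thesis using \<alpha> by (simp add: powr_powr)
  qed
  have "(\<Sum>j<q. r j powr \<alpha>) = (2 * h) powr \<alpha> / d * (\<Sum>j<q. real (snd (L ! j)))"
    unfolding rp by (rule sum_distrib_left[symmetric])
  also have "\<dots> = (2 * h) powr \<alpha>" using sumL d by (simp flip: of_nat_sum)
  finally have sum: "(\<Sum>j<q. r j powr \<alpha>) powr (1 / \<alpha>) = 2 * h"
    using h \<alpha> by (simp add: powr_powr)
  have "\<not> Z \<subseteq> (\<Union>j<q. ball (c j) (r j))"
  proof
    assume "Z \<subseteq> (\<Union>j<q. ball (c j) (r j))"
    then have mem: "2 * h \<in> {(\<Sum>j<q. r j powr \<alpha>) powr (1/\<alpha>) | q c r.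
       q \<le> d \<and> (\<forall>j<q. r j > 0) \<and> Z \<subseteq> (\<Union>j<q. ball (c j) (r j))}"
      using qd r0 sum by (intro CollectI exI[of _ q] exI[of _ c] exI[of _ r]) auto
    have "cover_const d \<alpha> Z \<le> 2 * h"
      unfolding cover_const_def by (rule cInf_lower[OF mem]) (auto intro!: bdd_belowI[of _ 0])
    then show False using h by simp
  qed
  then obtain z where z: "z \<in> Z" "\<And>j. j < q \<Longrightarrow> z \<notin> ball (c j) (r j)" by blast
  have out: "\<forall>x\<in>set L. z \<notin> ball (fst x) (2 * \<rho> (snd x))"
  proof
    fix x assume "x \<in> set L"
    then obtain j where "j < q" "x = L ! j" by (auto simp: in_set_conv_nth q_def)
    then show "z \<notin> ball (fst x) (2 * \<rho> (snd x))" using z(2)[of j] by (simp add: c_def r_def)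
  qed
  have "(\<Prod>k=1..size M. \<rho> k) \<le> prod_mset (image_mset (dist z) M)"
    using L(3)[OF out] h by (intro prod_le_prod_dist) (auto simp: \<rho>_def)
  moreover have "(h / exp (1 / \<alpha>)) ^ d \<le> (\<Prod>k=1..d. \<rho> k)"
  proof -
    have "(\<Prod>k=1..d. \<rho> k) = h ^ d * (\<Prod>k=1..d. (real k / d) powr (1 / \<alpha>))"
      by (simp add: \<rho>_def prod.distrib)
    also have "(\<Prod>k=1..d. (real k / d) powr (1 / \<alpha>)) = (\<Prod>k=1..d. real k / d) powr (1 / \<alpha>)"
      by (rule prod_powr_distrib[symmetric])
    also have "(\<Prod>k=1..d. real k / d) = fact d / real d ^ d"
      by (simp add: prod_dividef fact_prod)
    finally have e: "(\<Prod>k=1..d. \<rho> k) = h ^ d * (fact d / real d ^ d) powr (1 / \<alpha>)" .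
    have "exp (- real d) \<le> fact d / real d ^ d"
      using power_le_exp_fact[of d] d by (simp add: exp_minus field_simps)
    then have "exp (- real d) powr (1 / \<alpha>) \<le> (fact d / real d ^ d) powr (1 / \<alpha>)"
      using \<alpha> by (intro powr_mono2) auto
    moreover have "exp (- real d) powr (1 / \<alpha>) = (1 / exp (1 / \<alpha>)) ^ d"
    proof -
      have "exp (- real d) powr (1 / \<alpha>) = exp (real d * (- (1 / \<alpha>)))" by (simp add: powr_def)
      also have "\<dots> = exp (- (1 / \<alpha>)) ^ d" by (rule exp_of_nat_mult)
      also have "exp (- (1 / \<alpha>)) = 1 / exp (1 / \<alpha>)" by (simp only: exp_minus inverse_eq_divide)
      finally show ?thesis .
    qed
    ultimately have "h ^ d * (1 / exp (1 / \<alpha>)) ^ d \<le> h ^ d * (fact d / real d ^ d) powr (1 / \<alpha>)"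
      using h by (intro mult_left_mono) auto
    then show ?thesis unfolding e by (simp add: power_divide)
  qed
  ultimately show ?thesis using z(1) d by (intro bexI[of _ z]) auto
qed

section \<open>Factoring out the zeros\<close>

lemma zero_mult_ge_1: "h z = 0 \<Longrightarrow> 1 \<le> zero_mult h z"
proof -
  assume h: "h z = 0"
  show ?thesis
  proof (cases "\<exists>n. (deriv ^^ n) h z \<noteq> 0")
    case True
    then have "(deriv ^^ (LEAST n. (deriv ^^ n) h z \<noteq> 0)) h z \<noteq> 0" by (rule LeastI_ex)
    then have "(LEAST n. (deriv ^^ n) h z \<noteq> 0) \<noteq> 0"
      using h by (metis funpow_0)
    then show ?thesis using True by (simp add: zero_mult_def one_enat_def)
  qed (simp add: zero_mult_def)
qed

text \<open>Each zero counts at least once, and \<open>num_zeros\<close> is a supremum over finite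
  sets, so a finite value limits the size of every finite set of zeros.\<close>

lemma card_zeros_le:
  assumes "num_zeros h A \<le> enat p"
  shows "finite {z\<in>A. h z = 0}" "card {z\<in>A. h z = 0} \<le> p"
proof -
  have le: "card S \<le> p" if S: "finite S" "S \<subseteq> {z\<in>A. h z = 0}" for S
  proof -
    have "enat (card S) = (\<Sum>z\<in>S. 1)" by (simp add: of_nat_eq_enat)
    also have "\<dots> \<le> (\<Sum>z\<in>S. zero_mult h z)"
      using S by (intro sum_mono zero_mult_ge_1) auto
    also have "\<dots> \<le> num_zeros h A" unfolding num_zeros_def using S by (intro SUP_upper) auto
    finally show ?thesis using assms order_trans by fastforce
  qed
  show fin: "finite {z\<in>A. h z = 0}"
  proof (rule ccontr)
    assume "infinite {z\<in>A. h z = 0}"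
    then obtain S where "finite S" "card S = Suc p" "S \<subseteq> {z\<in>A. h z = 0}"
      using infinite_arbitrarily_large by blast
    then show False using le[of S] by simp
  qed
  show "card {z\<in>A. h z = 0} \<le> p" by (rule le[OF fin]) simp
qed

lemma num_zeros_eq_sum:
  assumes "num_zeros h A = enat s"
  shows "(\<Sum>z\<in>{z\<in>A. h z = 0}. zero_mult h z) = enat s"
proof -
  have fin: "finite {z\<in>A. h z = 0}" using card_zeros_le(1)[of h A s] assms by simp
  have "num_zeros h A = (\<Sum>z\<in>{z\<in>A. h z = 0}. zero_mult h z)"
    unfolding num_zeros_def
  proof (rule antisym)
    show "(SUP S\<in>{S. finite S \<and> S \<subseteq> {z\<in>A. h z = 0}}. \<Sum>z\<in>S. zero_mult h z) \<le> (\<Sum>z\<in>{z\<in>A. h z = 0}. zero_mult h z)"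
      using fin by (intro SUP_least sum_mono2) auto
    show "(\<Sum>z\<in>{z\<in>A. h z = 0}. zero_mult h z) \<le> (SUP S\<in>{S. finite S \<and> S \<subseteq> {z\<in>A. h z = 0}}. \<Sum>z\<in>S. zero_mult h z)"
      using fin by (intro SUP_upper) auto
  qed
  then show ?thesis using assms by simp
qed

text \<open>A finite total count excludes zeros of infinite order, so every zero has a local
  factorization. Dividing by the remaining linear factors shows that the quotient extends
  holomorphically without zeros.\<close>

lemma zero_factorization:
  assumes holo: "f holomorphic_on ball 0 1" and s: "num_zeros f (ball 0 1) = enat s"
  obtains N m g where "finite N" "N \<subseteq> ball 0 1" "(\<Sum>w\<in>N. m w) = s" "g holomorphic_on ball 0 1"
    "\<And>z. z \<in> ball 0 1 \<Longrightarrow> g z \<noteq> 0" "\<And>z. z \<in> ball 0 1 \<Longrightarrow> f z = (\<Prod>w\<in>N. (z - w) ^ m w) * g z"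
proof -
  define N where "N = {z\<in>ball 0 1. f z = 0}"
  have fin: "finite N" unfolding N_def using card_zeros_le(1)[of f "ball 0 1" s] s by simp
  have sum: "(\<Sum>z\<in>N. zero_mult f z) = enat s" unfolding N_def by (rule num_zeros_eq_sum[OF s])
  define m where "m w = (LEAST n. (deriv ^^ n) f w \<noteq> 0)" for w
  have ex: "\<exists>n. (deriv ^^ n) f w \<noteq> 0" if "w \<in> N" for w
  proof (rule ccontr)
    assume "\<not> ?thesis"
    then have "zero_mult f w = \<infinity>" by (simp add: zero_mult_def)
    moreover have "zero_mult f w \<le> (\<Sum>z\<in>N. zero_mult f z)"
      using that fin by (intro member_le_sum) auto
    ultimately show False using sum by simp
  qed
  have zm: "zero_mult f w = enat (m w)" if "w \<in> N" for w
    using ex[OF that] by (simp add: zero_mult_def m_def)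
  have ms: "(\<Sum>w\<in>N. m w) = s"
  proof -
    have "enat (\<Sum>w\<in>N. m w) = (\<Sum>w\<in>N. enat (m w))" using fin by induction (auto simp: zero_enat_def plus_enat_simps(1)[symmetric] simp del: plus_enat_simps)
    also have "\<dots> = enat s" using sum zm by simp
    finally show ?thesis by simp
  qed
  have "\<exists>h r. 0 < r \<and> h holomorphic_on ball w r \<and> (\<forall>z\<in>ball w r. f z = (z - w) ^ m w * h z \<and> h z \<noteq> 0)"
    if w: "w \<in> N" for w
  proof -
    have nz: "(deriv ^^ m w) f w \<noteq> 0" unfolding m_def using ex[OF w] by (rule LeastI_ex)
    have f0: "f w = 0" "w \<in> ball 0 1" using w by (auto simp: N_def)
    have "0 < m w" using nz f0(1) by (metis funpow_0 not_gr_zero)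
    moreover have "(deriv ^^ i) f w = 0" if "i < m w" for i
      using that not_less_Least unfolding m_def by blast
    ultimately obtain h r where "0 < r" "h holomorphic_on ball w r"
      "\<And>z. z \<in> ball w r \<Longrightarrow> f z - f w = (z - w) ^ m w * h z" "\<And>z. z \<in> ball w r \<Longrightarrow> h z \<noteq> 0"
      using holomorphic_factor_order_of_zero[OF holo open_ball f0(2), of "m w"] nz by metis
    then show ?thesis using f0(1) by (intro exI[of _ h] exI[of _ r]) auto
  qed
  then obtain h r where hr: "\<And>w. w \<in> N \<Longrightarrow> 0 < r w" "\<And>w. w \<in> N \<Longrightarrow> h w holomorphic_on ball w (r w)"
    "\<And>w z. w \<in> N \<Longrightarrow> z \<in> ball w (r w) \<Longrightarrow> f z = (z - w) ^ m w * h w z"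
    "\<And>w z. w \<in> N \<Longrightarrow> z \<in> ball w (r w) \<Longrightarrow> h w z \<noteq> 0"
    by metis
  define P where "P A z = (\<Prod>w\<in>A. (z - w) ^ m w)" for A z
  have Pnz: "P A z \<noteq> 0" if "A \<subseteq> N" "z \<notin> A" for A z
    using that finite_subset[OF that(1) fin] by (auto simp: P_def prod_zero_iff)
  have Ph: "P A holomorphic_on S" for A S unfolding P_def[abs_def] by (intro holomorphic_intros)
  \<comment> \<open>At a zero the quotient would be 0 / 0; the local factor there supplies the value
    that makes g continue analytically.\<close>
  define g where "g z = (if z \<in> N then h z z / P (N - {z}) z else f z / P N z)" for z
  have near: "g z = h w z / P (N - {w}) z" if w: "w \<in> N" and z: "z \<in> ball w (r w)" "z \<notin> N - {w}" for w z
  proof (cases "z = w")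
    case False
    then have zN: "z \<notin> N" using z by blast
    have "P N z = (z - w) ^ m w * P (N - {w}) z" unfolding P_def using fin w by (simp add: prod.remove)
    then show ?thesis using zN hr(3)[OF w z(1)] False by (simp add: g_def)
  qed (use w in \<open>simp add: g_def\<close>)
  have "g holomorphic_on ball 0 1"
  proof -
    have "g field_differentiable at z" if z: "z \<in> ball 0 1" for z
    proof (cases "z \<in> N")
      case True
      define S where "S = ball z (r z) - (N - {z})"
      have oS: "open S" unfolding S_def using fin by (intro open_Diff finite_imp_closed) auto
      have zS: "z \<in> S" using hr(1)[OF True] by (simp add: S_def)
      have "(\<lambda>x. h z x / P (N - {z}) x) holomorphic_on S"
        by (intro holomorphic_intros holomorphic_on_subset[OF hr(2)[OF True]] Ph Pnz) (auto simp: S_def)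
      then have "g holomorphic_on S"
        by (rule holomorphic_transform) (use near[OF True] in \<open>auto simp: S_def\<close>)
      then show ?thesis using oS zS holomorphic_on_imp_differentiable_at by blast
    next
      case False
      define S where "S = ball 0 1 - N"
      have oS: "open S" unfolding S_def using fin by (intro open_Diff finite_imp_closed) auto
      have "(\<lambda>x. f x / P N x) holomorphic_on S"
        by (intro holomorphic_intros holomorphic_on_subset[OF holo] Ph Pnz) (auto simp: S_def)
      then have "g holomorphic_on S"
        by (rule holomorphic_transform) (auto simp: S_def g_def)
      then show ?thesis using oS z False holomorphic_on_imp_differentiable_at unfolding S_def by blast
    qed
    then show ?thesis by (simp add: holomorphic_on_open field_differentiable_def) 
  qed
  moreover have "g z \<noteq> 0" if z: "z \<in> ball 0 1" for z
  proof (cases "z \<in> N")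
    case True
    then show ?thesis using hr(4)[OF True, of z] hr(1)[OF True] Pnz[of "N - {z}" z] by (auto simp: g_def)
  next
    case False
    then show ?thesis using z Pnz[of N z] by (auto simp: g_def N_def)
  qed
  moreover have "f z = (\<Prod>w\<in>N. (z - w) ^ m w) * g z" if z: "z \<in> ball 0 1" for z
  proof (cases "z \<in> N")
    case True
    then have "f z = 0" by (simp add: N_def)
    moreover have "m z \<noteq> 0"
    proof
      assume "m z = 0"
      then have "1 \<le> (0::enat)" using zero_mult_ge_1[of f z] \<open>f z = 0\<close> zm[OF True] by (simp add: zero_enat_def)
      then show False by simp
    qed
    ultimately show ?thesis using True fin by (auto simp: prod_zero_iff)
  next
    case False
    then show ?thesis using Pnz[of N z] by (simp add: g_def P_def)
  qed
  moreover have "N \<subseteq> ball 0 1" by (auto simp: N_def)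
  ultimately show ?thesis
    using that[OF fin _ ms] by blast
qed

section \<open>Combining distortion and Cartan's lemma\<close>

lemma norm_le_rho:
  assumes "Z \<subseteq> ball 0 1" "z \<in> Z"
  shows "cmod z \<le> rho Z"
  unfolding rho_def by (rule cInf_greatest) (use assms in auto)

text \<open>\<open>\<kappa>\<close> stands for a single finite term of the infimum in
  \<open>K_const\<close>, so the estimate stays within the real numbers. The factor
  \<open>sigma\<close> arises by comparing g at z with g at 0, and g at 0 with g at the point of Z
  found by Cartan's lemma.\<close>

lemma valent_remez:
  assumes holo: "f holomorphic_on ball 0 1"
    and s: "num_zeros f (ball 0 1) = enat s" and sp: "sp_valent s p f (ball 0 1)"
    and Z: "Z \<subseteq> ball 0 1" "rho Z < 1" and B: "\<And>z. z \<in> Z \<Longrightarrow> cmod (f z) \<le> B" "Z \<noteq> {}"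
    and R: "R < 1" "cmod z \<le> R"
    and \<kappa>: "s = 0 \<and> \<kappa> = 1 \<or> s \<ge> 1 \<and> (\<exists>\<alpha>>0. cover_const s \<alpha> Z \<noteq> 0 \<and> \<kappa> = (6 * exp (1 / \<alpha>) / cover_const s \<alpha> Z) ^ s)"
  shows "cmod (f z) \<le> sigma p R (rho Z) * \<kappa> * B"
proof -
  obtain N m g where N: "finite N" "N \<subseteq> ball 0 1" "(\<Sum>w\<in>N. m w) = s" and gh: "g holomorphic_on ball 0 1"
    and gnz: "\<And>z. z \<in> ball 0 1 \<Longrightarrow> g z \<noteq> 0" and fac: "\<And>z. z \<in> ball 0 1 \<Longrightarrow> f z = (\<Prod>w\<in>N. (z - w) ^ m w) * g z"
    using zero_factorization[OF holo s] by metis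
  define P where "P z = (\<Prod>w\<in>N. (z - w) ^ m w)" for z
  have val: "finite {z\<in>ball 0 1. g z = c} \<and> card {z\<in>ball 0 1. g z = c} \<le> p" for c
  proof -
    define Q where "Q = smult c (\<Prod>w\<in>N. [:- w, 1:] ^ m w)"
    have "degree Q \<le> degree (\<Prod>w\<in>N. [:- w, 1:] ^ m w)" unfolding Q_def by (rule degree_smult_le)
    also have "\<dots> \<le> (\<Sum>w\<in>N. degree ([:- w, 1:] ^ m w))" using degree_prod_sum_le[OF N(1)] by (simp add: o_def)
    also have "\<dots> = s" using N(3) by (simp add: degree_linear_power)
    finally have "num_zeros (\<lambda>z. f z - poly Q z) (ball 0 1) \<le> enat p" using sp by (simp add: sp_valent_def)
    note card = card_zeros_le[OF this]
    have sub: "{z\<in>ball 0 1. g z = c} \<subseteq> {z\<in>ball 0 1. f z - poly Q z = 0}"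
      using fac by (auto simp: Q_def poly_prod)
    then show ?thesis using card by (meson card_mono finite_subset le_trans)
  qed
  define q where "q r = ((1 + r) / (1 - r)) ^ (2 * p)" for r :: real
  have q0: "0 \<le> q r" if "0 \<le> r" "r < 1" for r using that by (simp add: q_def)
  have qm: "q r \<le> q r'" if "0 \<le> r" "r \<le> r'" "r' < 1" for r r'
    unfolding q_def using that by (intro power_mono frac_le) auto
  have \<sigma>: "sigma p R (rho Z) = q R * q (rho Z)" unfolding sigma_def q_def by (rule power_mult_distrib)
  have z1: "cmod z < 1" using R by simp
  have R0: "0 \<le> R" using R norm_ge_zero order_trans by blast
  obtain z0 where z0: "z0 \<in> Z" using B(2) by auto
  have \<rho>0: "0 \<le> rho Z" using norm_le_rho[OF Z(1) z0] norm_ge_zero order_trans by blast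
  have B0: "0 \<le> B" using B(1)[OF z0] norm_ge_zero order_trans by blast
  have gz: "cmod (g z) \<le> q R * cmod (g 0)"
  proof -
    have "cmod (g z) \<le> q (cmod z) * cmod (g 0)"
      unfolding q_def using valent_distortion(1)[OF gh gnz val z1] .
    also have "\<dots> \<le> q R * cmod (g 0)" using R by (intro mult_right_mono qm) auto
    finally show ?thesis .
  qed
  have g0: "cmod (g 0) \<le> q (rho Z) * cmod (g w)" if w: "w \<in> Z" for w
  proof -
    have w1: "cmod w < 1" using w Z by auto
    have "cmod (g 0) \<le> q (cmod w) * cmod (g w)"
      unfolding q_def using valent_distortion(2)[OF gh gnz val w1] .
    also have "\<dots> \<le> q (rho Z) * cmod (g w)"
      using norm_le_rho[OF Z(1) w] Z by (intro mult_right_mono qm) auto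
    finally show ?thesis .
  qed
  have Pz: "cmod (P z) \<le> 2 ^ s"
  proof -
    have "cmod (P z) = (\<Prod>w\<in>N. cmod (z - w) ^ m w)" by (simp add: P_def prod_norm[symmetric] norm_power)
    also have "\<dots> \<le> (\<Prod>w\<in>N. 2 ^ m w)"
    proof (rule prod_mono, safe)
      fix w assume "w \<in> N"
      then have "cmod w < 1" using N(2) by auto
      then have "cmod (z - w) \<le> 2" using norm_triangle_ineq4[of z w] z1 by linarith
      then show "cmod (z - w) ^ m w \<le> 2 ^ m w" by (intro power_mono) auto
    qed simp
    also have "\<dots> = 2 ^ s" unfolding N(3)[symmetric] power_sum ..
    finally show ?thesis .
  qed
  have "\<exists>w\<in>Z. 2 ^ s \<le> \<kappa> * cmod (P w)"
  proof (cases "s = 0")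
    case True
    then have "m w = 0" if "w \<in> N" for w using N that by simp
    then have "P w = 1" for w by (simp add: P_def)
    then show ?thesis using True \<kappa> z0 by (intro bexI[of _ z0]) auto
  next
    case False
    then obtain \<alpha> where \<alpha>: "\<alpha> > 0" "cover_const s \<alpha> Z \<noteq> 0" "\<kappa> = (6 * exp (1 / \<alpha>) / cover_const s \<alpha> Z) ^ s"
      using \<kappa> by auto
    define c where "c = cover_const s \<alpha> Z"
    \<comment> \<open>The infimum is over a nonempty set: since s is at least 1, the unit disc alone
      covers Z.\<close>
    have "0 \<le> c"
      unfolding c_def cover_const_def
    proof (rule cInf_greatest)
      have "(\<Sum>j<(1::nat). (\<lambda>_. 1::real) j powr \<alpha>) powr (1/\<alpha>) \<in> {(\<Sum>j<q. r j powr \<alpha>) powr (1/\<alpha>) | q c r.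
         q \<le> s \<and> (\<forall>j<q. r j > 0) \<and> Z \<subseteq> (\<Union>j<q. ball (c j) (r j))}"
        using False Z(1) by (intro CollectI exI[of _ 1] exI[of _ "\<lambda>_. 0"] exI[of _ "\<lambda>_. 1"]) auto
      then show "{(\<Sum>j<q. r j powr \<alpha>) powr (1/\<alpha>) | q c r.
         q \<le> s \<and> (\<forall>j<q. r j > 0) \<and> Z \<subseteq> (\<Union>j<q. ball (c j) (r j))} \<noteq> {}" by blast
    qed auto
    then have c: "c > 0" using \<alpha>(2) by (simp add: c_def)
    define M where "M = (\<Sum>w\<in>N. replicate_mset (m w) w)"
    have M: "size M = s" unfolding M_def using N(3) by (simp add: size_multiset_sum)
    have PM: "prod_mset (image_mset (dist w) M) = cmod (P w)" for w
    proof -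
      have "prod_mset (image_mset (dist w) (\<Sum>v\<in>A. replicate_mset (m v) v)) = (\<Prod>v\<in>A. dist w v ^ m v)" if "finite A" for A
        using that by induction auto
      then show ?thesis using N(1) by (simp add: M_def P_def prod_norm[symmetric] norm_power dist_norm)
    qed
    \<comment> \<open>The 6 in \<open>K_const\<close> is 2 * 3: the 2 comes from the upper bound 2 ^
      s for P, the 3 from h = c / 3, which satisfies the strict inequality 2 * h < c.\<close>
    have "2 * (c / 3) < cover_const s \<alpha> Z" "1 \<le> s" "0 < c / 3" using c False by (simp_all add: c_def[symmetric])
    then obtain w where w: "w \<in> Z" "(c / 3 / exp (1 / \<alpha>)) ^ s \<le> cmod (P w)"
      using cartan[OF M _ \<alpha>(1), of "c / 3" Z] unfolding PM by blast
    have "2 ^ s = \<kappa> * (c / 3 / exp (1 / \<alpha>)) ^ s"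
      using c unfolding \<alpha>(3) c_def[symmetric] power_mult_distrib[symmetric] by simp
    also have "\<dots> \<le> \<kappa> * cmod (P w)"
      using w c unfolding \<alpha>(3) c_def[symmetric] by (intro mult_left_mono) auto
    finally show ?thesis using w by blast
  qed
  then obtain w where w: "w \<in> Z" "2 ^ s \<le> \<kappa> * cmod (P w)" by blast
  have w1: "w \<in> ball 0 1" using w Z by auto
  have \<kappa>0: "0 \<le> \<kappa>"
  proof (rule ccontr)
    assume "\<not> 0 \<le> \<kappa>"
    then have "\<kappa> * cmod (P w) \<le> 0" by (simp add: mult_nonpos_nonneg)
    then show False using w(2) zero_less_power[of "2::real" s] by linarith
  qed
  have "cmod (f z) = cmod (P z) * cmod (g z)" using fac[of z] z1 by (simp add: P_def norm_mult)
  also have "\<dots> \<le> 2 ^ s * (q R * (q (rho Z) * cmod (g w)))"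
  proof (intro mult_mono Pz)
    show "cmod (g z) \<le> q R * (q (rho Z) * cmod (g w))"
      using gz mult_left_mono[OF g0[OF w(1)] q0[OF R0 R(1)]] by linarith
  qed auto
  also have "\<dots> \<le> (\<kappa> * cmod (P w)) * (q R * (q (rho Z) * cmod (g w)))"
    using w(2) q0[OF R0 R(1)] q0[OF \<rho>0 Z(2)] by (intro mult_right_mono) auto
  also have "\<dots> = sigma p R (rho Z) * \<kappa> * cmod (f w)"
    using fac[OF w1] by (simp add: P_def norm_mult \<sigma>)
  also have "\<dots> \<le> sigma p R (rho Z) * \<kappa> * B"
    using B(1)[OF w(1)] \<kappa>0 q0[OF R0 R(1)] q0[OF \<rho>0 Z(2)] by (intro mult_left_mono) (auto simp: \<sigma>)
  finally show ?thesis .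
qed

theorem mainTheorem13:
  fixes f :: "complex \<Rightarrow> complex" and s p :: nat and Z :: "complex set" and R :: real
  assumes "f analytic_on cball 0 1"
    and "num_zeros f (ball 0 1) = enat s"
    and "sp_valent s p f (ball 0 1)"
    and "Z \<subseteq> ball 0 1" and "Z \<noteq> {}"
    and "rho Z < 1"
    and "0 < R" and "R < 1"
  shows "K_const s Z < \<infinity> \<longrightarrow>
    ereal (Sup ((\<lambda>z. cmod (f z)) ` cball 0 R))
      \<le> ereal (sigma p R (rho Z)) * K_const s Z * ereal (Sup ((\<lambda>z. cmod (f z)) ` Z))"
proof
  assume K: "K_const s Z < \<infinity>"
  have holo: "f holomorphic_on ball 0 1"
    using assms(1) analytic_imp_holomorphic holomorphic_on_subset ball_subset_cball by blast
  have fc: "continuous_on (cball 0 1) f"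
    using assms(1) by (intro holomorphic_on_imp_continuous_on analytic_imp_holomorphic)
  define B where "B = Sup ((\<lambda>z. cmod (f z)) ` Z)"
  define A where "A = Sup ((\<lambda>z. cmod (f z)) ` cball 0 R)"
  define \<sigma> where "\<sigma> = sigma p R (rho Z)"
  have "compact ((\<lambda>z. cmod (f z)) ` cball 0 1)"
    by (intro compact_continuous_image continuous_intros fc) auto
  then have "bdd_above ((\<lambda>z. cmod (f z)) ` cball 0 1)"
    by (intro bounded_imp_bdd_above compact_imp_bounded)
  moreover have "Z \<subseteq> cball 0 1" using assms(4) ball_subset_cball by blast
  ultimately have "bdd_above ((\<lambda>z. cmod (f z)) ` Z)" by (meson bdd_above_mono image_mono)
  then have B: "cmod (f z) \<le> B" if "z \<in> Z" for z
    unfolding B_def using that by (intro cSUP_upper)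
  obtain z0 where z0: "z0 \<in> Z" using assms(5) by auto
  have B0: "0 \<le> B" using B[OF z0] norm_ge_zero order_trans by blast
  have \<rho>0: "0 \<le> rho Z" using norm_le_rho[OF assms(4) z0] norm_ge_zero order_trans by blast
  have \<sigma>0: "0 < \<sigma>" unfolding \<sigma>_def sigma_def using assms(6-8) \<rho>0 by (intro zero_less_power mult_pos_pos divide_pos_pos) auto
  have bound: "A \<le> \<sigma> * \<kappa> * B"
    if \<kappa>: "s = 0 \<and> \<kappa> = 1 \<or> s \<ge> 1 \<and> (\<exists>\<alpha>>0. cover_const s \<alpha> Z \<noteq> 0 \<and> \<kappa> = (6 * exp (1 / \<alpha>) / cover_const s \<alpha> Z) ^ s)" for \<kappa>
    unfolding A_def \<sigma>_def
  proof (rule cSUP_least)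
    show "cball 0 R \<noteq> {}" using assms(7) by simp
    fix z :: complex assume "z \<in> cball 0 R"
    then show "cmod (f z) \<le> sigma p R (rho Z) * \<kappa> * B"
      by (intro valent_remez[OF holo assms(2,3,4,6) B assms(5,8) _ \<kappa>]) auto
  qed
  have "ereal A \<le> ereal \<sigma> * K_const s Z * ereal B"
  proof (cases "s = 0")
    case True
    then show ?thesis using bound[of 1] by (simp add: K_const_def)
  next
    case False
    define k where "k \<alpha> = (if cover_const s \<alpha> Z = 0 then \<infinity> else ereal ((6 * exp (1/\<alpha>) / cover_const s \<alpha> Z) ^ s))" for \<alpha>
    have Kk: "K_const s Z = (INF \<alpha>\<in>{0<..}. k \<alpha>)" using False by (simp add: K_const_def k_def)
    obtain \<alpha>0 where \<alpha>0: "\<alpha>0 > 0" "k \<alpha>0 < \<infinity>" using K unfolding Kk INF_less_iff by blast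
    have each: "A \<le> \<sigma> * (6 * exp (1/\<alpha>) / cover_const s \<alpha> Z) ^ s * B" if "\<alpha> > 0" "cover_const s \<alpha> Z \<noteq> 0" for \<alpha>
      using that False by (intro bound disjI2) auto
    show ?thesis
    proof (cases "B = 0")
      case True
      \<comment> \<open>The right-hand side is 0 here, so one finite term of the infimum is
        required; \<open>\<alpha>0\<close> provides it because \<open>K_const s Z\<close> is
        finite.\<close>
      have "A \<le> 0" using each[OF \<alpha>0(1)] \<alpha>0(2) True by (auto simp: k_def split: if_splits)
      then show ?thesis using True by (simp add: zero_ereal_def[symmetric])
    next
      case False
      then have Bp: "0 < B" using B0 by simp
      \<comment> \<open>With the positive factor divided out, the bound for every single term passes
        directly to the infimum.\<close>
      have "ereal (A / (\<sigma> * B)) \<le> K_const s Z"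
        unfolding Kk
      proof (rule INF_greatest)
        fix \<alpha> :: real assume "\<alpha> \<in> {0<..}"
        then show "ereal (A / (\<sigma> * B)) \<le> k \<alpha>"
          using each[of \<alpha>] \<sigma>0 Bp by (auto simp: k_def divide_le_eq mult_ac)
      qed
      then have "ereal (\<sigma> * B) * ereal (A / (\<sigma> * B)) \<le> ereal (\<sigma> * B) * K_const s Z"
        using \<sigma>0 Bp by (intro ereal_mult_left_mono) auto
      moreover have "ereal (\<sigma> * B) * ereal (A / (\<sigma> * B)) = ereal A" using \<sigma>0 Bp by simp
      moreover have "ereal (\<sigma> * B) * K_const s Z = ereal \<sigma> * K_const s Z * ereal B"
        by (metis mult.assoc mult.commute times_ereal.simps(1))
      ultimately show ?thesis by simp
    qed
  qed
  then show "ereal (Sup ((\<lambda>z. cmod (f z)) ` cball 0 R))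
      \<le> ereal (sigma p R (rho Z)) * K_const s Z * ereal (Sup ((\<lambda>z. cmod (f z)) ` Z))"
    by (simp add: A_def B_def \<sigma>_def)
qed

end
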